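(* Let $\Omega\subset\mathbb{R}^2$ be a (bounded, Lipschitz) polygonal domain, and let $0\le\theta\le\mu\le1$. Then there exists a constant $C>0$, depending on $\theta,\mu,\Omega$, the shape-regularity constant $\gamma$ and the quasi-uniformity constant $C_{\rm qu}$, such that the following holds. Let $\mathcal{T}$ be a mesh of $\Omega$ satisfying the mesh assumption (M) of the context with constant $\gamma$ which is quasi-uniform, i.e. $\max_{K\in\mathcal{T}}h_K\le C_{\rm qu}\min_{K\in\mathcal{T}}h_K$, and let $\mathbf{p}=(p_K)_{K\in\mathcal{T}}$ be a constant degree distribution, $p_K=p$ for all $K\in\mathcal{T}$ with an integer $p\ge1$. Then, with $h:=\max_{K\in\mathcal{T}}h_K$, $$\frac{h^{\mu-\theta}}{p^{2(\mu-\theta)}}\,\|u_h\|_{[L^2(\Omega),H^1(\Omega)]_\mu}\le C\,\|u_h\|_{[L^2(\Omega),H^1(\Omega)]_\theta}\qquad\text{for all }u_h\in\mathcal{S}^{\mathbf{p},1}(\mathcal{T}).$$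
   Context: Interpolation (K-method): for Banach spaces $X_1\subset X_0$ with continuous embedding and norms $\|\cdot\|_1,\|\cdot\|_0$, set $K^2(t,u):=\inf_{v\in X_1}\|u-v\|_0^2+t^2\|v\|_1^2$ and, for $\theta\in(0,1)$, $\|u\|_{[X_0,X_1]_\theta}^2:=\int_0^\infty t^{-2\theta}K^2(t,u)\,\frac{dt}{t}$, $[X_0,X_1]_\theta:=\{u\in X_0: \|u\|_{[X_0,X_1]_\theta}<\infty\}$. For $\theta=0$ and $\theta=1$, $[X_0,X_1]_\theta$ means $X_0$ and $X_1$ respectively. Reference elements: $\widehat T\subset\mathbb{R}^2$ is the open triangle with vertices $(0,\frac{2}{\sqrt3})$, $(1,-\frac1{\sqrt3})$, $(-1,-\frac1{\sqrt3})$, and $\widehat S=(-1,1)\times(-\frac1{\sqrt3},\frac2{\sqrt3})$. A mesh $\mathcal{T}$ of $\Omega$ is a finite partition of $\Omega$ into open elements $K$ (triangles and/or quadrilaterals); $h_K$ is the diameter of $K$. Mesh assumption (M): (1) For each $K\in\mathcal{T}$ there are $\widehat K\in\{\widehat S,\widehat T\}$ and a bijective element map $F_K:\overline{\widehat K}\to\overline K$ which is $C^1(\overline{\widehat K})$. (2) The two eigenvalues $\lambda_1(x),\lambda_2(x)$ of the Gramian $F_K'(x)^\top F_K'(x)$ satisfy $\sup_{x\in\widehat K}\max\big(\frac{h_K^2}{\lambda_1(x)},\frac{\lambda_1(x)}{h_K^2},\frac{h_K^2}{\lambda_2(x)},\frac{\lambda_2(x)}{h_K^2}\big)\le\gamma$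 for a fixed constant $\gamma>0$ (the shape-regularity constant). (3) The intersection $\overline{K_1}\cap\overline{K_2}$ of two distinct elements is either empty, exactly one point, or exactly one edge; if it is an edge $e=F_{K_1}(\widehat e_j)=F_{K_2}(\widehat e_k)$ (with $\widehat e_j,\widehat e_k$ edges of the respective reference elements), then $F_{K_1}^{-1}\circ F_{K_2}|_{\widehat e_k}:\widehat e_k\to\widehat e_j$ is an affine bijection. (4) Each edge is either fully contained in $\Omega$ or in $\partial\Omega$. Discrete spaces: $\mathcal{P}^p=\mathrm{span}\{x^iy^j: 0\le i,j,\ i+j\le p\}$, $\mathcal{Q}^p=\mathrm{span}\{x^iy^j:0\le i,j\le p\}$; $\mathcal{P}^p(\widehat K)=\mathcal{P}^p$ if $\widehat K=\widehat T$ and $\mathcal{P}^p(\widehat K)=\mathcal{Q}^p$ if $\widehat K=\widehat S$. For $\mathbf{p}=(p_K)_{K\in\mathcal{T}}$: $\mathcal{S}^{\mathbf{p},0}(\mathcal{T})=\{u\in L^2(\Omega): u\circ F_K\in\mathcal{P}^{p_K}(\widehat K)\ \forall K\in\mathcal{T}\}$, $\mathcal{S}^{\mathbf{p},1}(\mathcal{T})=\mathcal{S}^{\mathbf{p},0}(\mathcal{T})\cap H^1(\Omega)$. *)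

theory Defs
  imports "HOL-Analysis.Analysis"
begin

section \<open>Interpolation by the K-method\<close>

text \<open>A pair of spaces is given by carriers \<open>X0\<close>, \<open>X1\<close> and norm functions \<open>n0\<close>, \<open>n1\<close>. Elements of
  function spaces are represented by functions, not by classes modulo equality almost everywhere;
  the norms below do not distinguish equivalent functions.\<close>

definition K_sq :: "('v::minus \<Rightarrow> real) \<Rightarrow> 'v set \<Rightarrow> ('v \<Rightarrow> real) \<Rightarrow> real \<Rightarrow> 'v \<Rightarrow> real" where
  "K_sq n0 X1 n1 t u = (INF v\<in>X1. (n0 (u - v))\<^sup>2 + t\<^sup>2 * (n1 v)\<^sup>2)"

definition sqrt_ennreal :: "ennreal \<Rightarrow> ennreal" where
  "sqrt_ennreal a = (if a = \<infinity> then \<infinity> else ennreal (sqrt (enn2real a)))"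

text \<open>The norm takes the value \<open>\<infinity>\<close> exactly outside the interpolation space.\<close>

definition interp_norm ::
  "'v::minus set \<Rightarrow> ('v \<Rightarrow> real) \<Rightarrow> 'v set \<Rightarrow> ('v \<Rightarrow> real) \<Rightarrow> real \<Rightarrow> 'v \<Rightarrow> ennreal" where
  "interp_norm X0 n0 X1 n1 \<theta> u =
    (if \<theta> = 0 then (if u \<in> X0 then ennreal (n0 u) else \<infinity>)
     else if \<theta> = 1 then (if u \<in> X1 then ennreal (n1 u) else \<infinity>)
     else if u \<in> X0
       then sqrt_ennreal
              (\<integral>\<^sup>+t\<in>{0<..}. ennreal (t powr (-2 * \<theta>) * K_sq n0 X1 n1 t u / t) \<partial>lborel)
       else \<infinity>)"


section \<open>The spaces \<open>L\<^sup>2(\<Omega>)\<close> and \<open>H\<^sup>1(\<Omega>)\<close>\<close>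

definition L2 :: "(real^2) set \<Rightarrow> (real^2 \<Rightarrow> real) set" where
  "L2 \<Omega> = {u. u \<in> borel_measurable (lebesgue_on \<Omega>) \<and> integrable (lebesgue_on \<Omega>) (\<lambda>x. (u x)\<^sup>2)}"

definition L2_norm :: "(real^2) set \<Rightarrow> (real^2 \<Rightarrow> real) \<Rightarrow> real" where
  "L2_norm \<Omega> u = sqrt (\<integral>x. (u x)\<^sup>2 \<partial>lebesgue_on \<Omega>)"

primrec C_k :: "nat \<Rightarrow> (real^2 \<Rightarrow> real) \<Rightarrow> bool" where
  "C_k 0 f \<longleftrightarrow> continuous_on UNIV f"
| "C_k (Suc k) f \<longleftrightarrow>
     (\<exists>g :: real^2 \<Rightarrow> real^2. (\<forall>x. (f has_derivative (\<lambda>v. g x \<bullet> v)) (at x)) \<and>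
        (\<forall>i. C_k k (\<lambda>x. g x $ i)))"

definition test_function :: "(real^2) set \<Rightarrow> (real^2 \<Rightarrow> real) \<Rightarrow> bool" where
  "test_function \<Omega> \<phi> \<longleftrightarrow> (\<forall>k. C_k k \<phi>) \<and>
     compact (closure {x. \<phi> x \<noteq> 0}) \<and> closure {x. \<phi> x \<noteq> 0} \<subseteq> \<Omega>"

definition has_weak_gradient ::
  "(real^2) set \<Rightarrow> (real^2 \<Rightarrow> real) \<Rightarrow> (real^2 \<Rightarrow> real^2) \<Rightarrow> bool" where
  "has_weak_gradient \<Omega> u g \<longleftrightarrow>
     (\<forall>\<phi>. test_function \<Omega> \<phi> \<longrightarrow>
       (\<forall>i. (\<integral>x. u x * frechet_derivative \<phi> (at x) (axis i 1) \<partial>lebesgue_on \<Omega>)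
          = - (\<integral>x. g x $ i * \<phi> x \<partial>lebesgue_on \<Omega>)))"

definition L2_weak_gradient ::
  "(real^2) set \<Rightarrow> (real^2 \<Rightarrow> real) \<Rightarrow> (real^2 \<Rightarrow> real^2) \<Rightarrow> bool" where
  "L2_weak_gradient \<Omega> u g \<longleftrightarrow> has_weak_gradient \<Omega> u g \<and> (\<forall>i. (\<lambda>x. g x $ i) \<in> L2 \<Omega>)"

definition H1 :: "(real^2) set \<Rightarrow> (real^2 \<Rightarrow> real) set" where
  "H1 \<Omega> = {u \<in> L2 \<Omega>. \<exists>g. L2_weak_gradient \<Omega> u g}"

text \<open>The weak gradient is unique up to null sets, so the choice does not affect the norm.\<close>

definition weak_gradient :: "(real^2) set \<Rightarrow> (real^2 \<Rightarrow> real) \<Rightarrow> real^2 \<Rightarrow> real^2" where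
  "weak_gradient \<Omega> u = (SOME g. L2_weak_gradient \<Omega> u g)"

definition H1_norm :: "(real^2) set \<Rightarrow> (real^2 \<Rightarrow> real) \<Rightarrow> real" where
  "H1_norm \<Omega> u =
     sqrt ((L2_norm \<Omega> u)\<^sup>2 + (\<Sum>i\<in>UNIV. (L2_norm \<Omega> (\<lambda>x. weak_gradient \<Omega> u x $ i))\<^sup>2))"

definition L2_H1_norm :: "(real^2) set \<Rightarrow> real \<Rightarrow> (real^2 \<Rightarrow> real) \<Rightarrow> ennreal" where
  "L2_H1_norm \<Omega> = interp_norm (L2 \<Omega>) (L2_norm \<Omega>) (H1 \<Omega>) (H1_norm \<Omega>)"


section \<open>Polygonal Lipschitz domains\<close>

text \<open>Near each boundary point the set is, in rotated coordinates, the part below a Lipschitz graph.\<close>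

definition lipschitz_boundary :: "(real^2) set \<Rightarrow> bool" where
  "lipschitz_boundary \<Omega> \<longleftrightarrow>
     (\<forall>z\<in>frontier \<Omega>. \<exists>R \<psi> L r. orthogonal_transformation (R :: real^2 \<Rightarrow> real^2) \<and>
        L-lipschitz_on UNIV (\<psi> :: real \<Rightarrow> real) \<and> 0 < r \<and>
        \<Omega> \<inter> ball z r = {x \<in> ball z r. R x $ 2 < \<psi> (R x $ 1)})"

definition polygonal_lipschitz_domain :: "(real^2) set \<Rightarrow> bool" where
  "polygonal_lipschitz_domain \<Omega> \<longleftrightarrow>
     open \<Omega> \<and> connected \<Omega> \<and> \<Omega> \<noteq> {} \<and> bounded \<Omega> \<and> lipschitz_boundary \<Omega> \<and>
     (\<exists>S. finite S \<and> frontier \<Omega> = (\<Union>(a, b)\<in>S. closed_segment a b))"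


section \<open>Meshes\<close>

definition ref_triangle :: "(real^2) set" where
  "ref_triangle = interior (convex hull
     {vector [0, 2 / sqrt 3], vector [1, - 1 / sqrt 3], vector [- 1, - 1 / sqrt 3]})"

definition ref_square :: "(real^2) set" where
  "ref_square = box (vector [- 1, - 1 / sqrt 3]) (vector [1, 2 / sqrt 3])"

text \<open>A mesh consists of its set \<open>\<T>\<close> of elements and, for each element \<open>K\<close>, its reference element
  \<open>Kh K\<close> and its element map \<open>F K\<close>. Edges are closed: they are the images under \<open>F K\<close> of the
  one-dimensional faces of the closed reference element.\<close>

definition C1_on_closure :: "(real^2) set \<Rightarrow> (real^2 \<Rightarrow> real^2) \<Rightarrow> bool" where
  "C1_on_closure S f \<longleftrightarrow>
     (\<exists>J :: real^2 \<Rightarrow> real^2^2. continuous_on (closure S) J \<and>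
        (\<forall>x\<in>closure S. (f has_derivative (\<lambda>v. J x *v v)) (at x within closure S)))"

definition gramian :: "(real^2 \<Rightarrow> real^2) \<Rightarrow> real^2 \<Rightarrow> real^2^2" where
  "gramian f x = (let J = matrix (frechet_derivative f (at x)) in transpose J ** J)"

definition is_eigenvalue :: "real^'n^'n \<Rightarrow> real \<Rightarrow> bool" where
  "is_eigenvalue A l \<longleftrightarrow> (\<exists>v. v \<noteq> 0 \<and> A *v v = l *\<^sub>R v)"

text \<open>\<open>0 < l\<close> is required explicitly because division by \<open>0\<close> gives \<open>0\<close> here instead of \<open>\<infinity>\<close>.\<close>

definition shape_regular ::
  "real \<Rightarrow> (real^2) set \<Rightarrow> (real^2) set \<Rightarrow> (real^2 \<Rightarrow> real^2) \<Rightarrow> bool" where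
  "shape_regular \<gamma> K Kh f \<longleftrightarrow>
     (\<forall>x\<in>Kh. \<forall>l. is_eigenvalue (gramian f x) l \<longrightarrow>
        0 < l \<and> max ((diameter K)\<^sup>2 / l) (l / (diameter K)\<^sup>2) \<le> \<gamma>)"

definition affine_bijection :: "(real^2 \<Rightarrow> real^2) \<Rightarrow> (real^2) set \<Rightarrow> (real^2) set \<Rightarrow> bool" where
  "affine_bijection f A B \<longleftrightarrow> bij_betw f A B \<and> (\<exists>L b. linear L \<and> (\<forall>x\<in>A. f x = L x + b))"

definition partition_of :: "(real^2) set \<Rightarrow> (real^2) set set \<Rightarrow> bool" where
  "partition_of \<Omega> \<T> \<longleftrightarrow> finite \<T> \<and> (\<forall>K\<in>\<T>. open K \<and> K \<noteq> {} \<and> K \<subseteq> \<Omega>) \<and>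
     pairwise disjnt \<T> \<and> (\<Union>K\<in>\<T>. closure K) = closure \<Omega>"

text \<open>In the last condition the endpoints of the edges are removed, since an edge that is interior to
  \<open>\<Omega>\<close> may have an endpoint on the boundary.\<close>

definition admissible_mesh ::
  "(real^2) set \<Rightarrow> real \<Rightarrow> (real^2) set set \<Rightarrow> ((real^2) set \<Rightarrow> (real^2) set) \<Rightarrow>
    ((real^2) set \<Rightarrow> real^2 \<Rightarrow> real^2) \<Rightarrow> bool" where
  "admissible_mesh \<Omega> \<gamma> \<T> Kh F \<longleftrightarrow>
     partition_of \<Omega> \<T> \<and>
     (\<forall>K\<in>\<T>. Kh K \<in> {ref_square, ref_triangle} \<and>
        bij_betw (F K) (closure (Kh K)) (closure K) \<and> F K ` Kh K = K \<and>
        C1_on_closure (Kh K) (F K)) \<and>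
     (\<forall>K\<in>\<T>. shape_regular \<gamma> K (Kh K) (F K)) \<and>
     (\<forall>K1\<in>\<T>. \<forall>K2\<in>\<T>. K1 \<noteq> K2 \<longrightarrow>
        closure K1 \<inter> closure K2 = {} \<or>
        (\<exists>z. closure K1 \<inter> closure K2 = {z}) \<or>
        (\<exists>e1 e2. e1 edge_of closure (Kh K1) \<and> e2 edge_of closure (Kh K2) \<and>
           closure K1 \<inter> closure K2 = F K1 ` e1 \<and> F K1 ` e1 = F K2 ` e2 \<and>
           affine_bijection (inv_into (closure (Kh K1)) (F K1) \<circ> F K2) e2 e1)) \<and>
     (\<forall>K\<in>\<T>. \<forall>e. e edge_of closure (Kh K) \<longrightarrow>
        F K ` rel_interior e \<subseteq> \<Omega> \<or> F K ` rel_interior e \<subseteq> frontier \<Omega>)"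

definition mesh_width :: "(real^2) set set \<Rightarrow> real" where
  "mesh_width \<T> = Max (diameter ` \<T>)"

definition quasi_uniform :: "real \<Rightarrow> (real^2) set set \<Rightarrow> bool" where
  "quasi_uniform Cqu \<T> \<longleftrightarrow> Max (diameter ` \<T>) \<le> Cqu * Min (diameter ` \<T>)"


section \<open>Discrete spaces\<close>

definition monomial_span :: "(nat \<times> nat) set \<Rightarrow> (real^2 \<Rightarrow> real) set" where
  "monomial_span I = {q. \<exists>c. q = (\<lambda>x. \<Sum>(i, j)\<in>I. c i j * ((x $ 1) ^ i * (x $ 2) ^ j))}"

definition poly_P :: "nat \<Rightarrow> (real^2 \<Rightarrow> real) set" where
  "poly_P p = monomial_span {(i, j). i + j \<le> p}"

definition poly_Q :: "nat \<Rightarrow> (real^2 \<Rightarrow> real) set" where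
  "poly_Q p = monomial_span {(i, j). i \<le> p \<and> j \<le> p}"

definition ref_poly :: "(real^2) set \<Rightarrow> nat \<Rightarrow> (real^2 \<Rightarrow> real) set" where
  "ref_poly Kh p = (if Kh = ref_triangle then poly_P p else poly_Q p)"

definition spline0 ::
  "(real^2) set \<Rightarrow> (real^2) set set \<Rightarrow> ((real^2) set \<Rightarrow> (real^2) set) \<Rightarrow>
    ((real^2) set \<Rightarrow> real^2 \<Rightarrow> real^2) \<Rightarrow> ((real^2) set \<Rightarrow> nat) \<Rightarrow> (real^2 \<Rightarrow> real) set" where
  "spline0 \<Omega> \<T> Kh F pdeg = {u \<in> L2 \<Omega>. \<forall>K\<in>\<T>. \<exists>q\<in>ref_poly (Kh K) (pdeg K).
     AE x in lebesgue_on (Kh K). (u \<circ> F K) x = q x}"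

definition spline1 ::
  "(real^2) set \<Rightarrow> (real^2) set set \<Rightarrow> ((real^2) set \<Rightarrow> (real^2) set) \<Rightarrow>
    ((real^2) set \<Rightarrow> real^2 \<Rightarrow> real^2) \<Rightarrow> ((real^2) set \<Rightarrow> nat) \<Rightarrow> (real^2 \<Rightarrow> real) set" where
  "spline1 \<Omega> \<T> Kh F pdeg = spline0 \<Omega> \<T> Kh F pdeg \<inter> H1 \<Omega>"

end

theory Submission
  imports Defs "HOL-Computational_Algebra.Polynomial"
begin

text \<open>
  Put \<open>t = h / p\<^sup>2\<close>. The theorem follows from the single inequality
  \<open>t\<^sup>2 \<parallel>u\<parallel>\<^sub>1\<^sup>2 \<le> C (\<parallel>u - v\<parallel>\<^sub>0\<^sup>2 + t\<^sup>2 \<parallel>v\<parallel>\<^sub>1\<^sup>2)\<close> for discrete \<open>u\<close> and arbitrary \<open>v\<close> in \<open>H\<^sup>1\<close>: it says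
  \<open>t \<parallel>u\<parallel>\<^sub>1 \<le> C K(t, u)\<close>, and the rest is monotonicity of the K-functional, with the integral over
  \<open>(0, \<infinity>)\<close> split at \<open>t\<close>. Unlike the usual argument this needs no \<open>H\<^sup>1\<close>-stable projection onto the
  discrete space.

  The inequality is local. On an element it is reduced to the one-dimensional estimate
  \<open>\<parallel>q'\<parallel>\<^sup>2 \<le> C (\<parallel>f'\<parallel>\<^sup>2 + p\<^sup>4 \<parallel>q - f\<parallel>\<^sup>2)\<close> for polynomials \<open>q\<close> of degree at most \<open>p\<close>, applied along the axis-parallel
  lines of parallelograms that cover the reference element. It is proved by integrating
  \<open>q' (q - f)'\<close> by parts, with an endpoint estimate and Markov's inequality in \<open>L\<^sup>2\<close> for polynomials. On the parallelograms
  \<open>v\<close> is replaced by mollifications, and the weak gradient of \<open>u\<close> on an element is identified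
  with the classical one.
\<close>

section \<open>Inverse estimates for polynomials on an interval\<close>

text \<open>The competitor \<open>v\<close> is not discrete, so no inverse estimate applies to
  \<open>u - v\<close>. In one dimension, with \<open>e = q - f\<close>, the identity
  \<open>(q')^2 = (q' e)' + q' f' - q'' e\<close> leaves no derivative on \<open>e\<close>: it falls
  on \<open>q'\<close>, where Markov's inequality costs a factor \<open>p^2\<close>. This is where
  the scale \<open>h / p^2\<close> comes from. The constants degenerate on short intervals.
  Axis-parallel lines of a triangle become arbitrarily short near its vertices, whereas in the
  coordinates of a parallelogram they all have the same length; hence the covering, on whose lines
  the polynomials have degree at most \<open>2 p\<close>. The element maps are merely C^1. The
  mollified \<open>v\<close> is therefore formed on the physical element and then pulled back, so
  that only classical gradients have to be transformed; conversely \<open>u\<close> becomes a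
  polynomial only after being pulled back. The part of the H^1 norm without derivatives is harmless,
  since \<open>h / p^2\<close> is at most the diameter of the domain.\<close>

definition poly_int :: "real \<Rightarrow> real \<Rightarrow> real poly \<Rightarrow> real" where
  "poly_int a b p = integral {a..b} (poly p)"

text \<open>Degree less than \<open>n\<close>, expressed by coefficients: for \<open>n = 0\<close>
  this leaves exactly the zero polynomial, where the inductions below start. A polynomial of degree
  at most \<open>p\<close> satisfies it with \<open>n = p + 1\<close>.\<close>

definition coeffs_below :: "nat \<Rightarrow> real poly \<Rightarrow> bool" where
  "coeffs_below n p \<longleftrightarrow> (\<forall>i\<ge>n. coeff p i = 0)"

section \<open>The integral over an interval as a linear functional on polynomials\<close>

lemma poly_integrable [simp]: "poly (p :: real poly) integrable_on {a..b}"
  by (intro integrable_continuous_real continuous_intros)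

lemma poly_int_add: "poly_int a b (p + q) = poly_int a b p + poly_int a b q"
  unfolding poly_int_def poly_add by (rule integral_add) auto

lemma poly_int_smult: "poly_int a b (smult c p) = c * poly_int a b p"
  unfolding poly_int_def poly_smult by (rule integral_mult_right)

lemma poly_int_0 [simp]: "poly_int a b 0 = 0"
  using poly_int_smult[of a b 0 0] by simp

lemma poly_int_diff: "poly_int a b (p - q) = poly_int a b p - poly_int a b q"
  unfolding poly_int_def poly_diff by (rule integral_diff) auto

lemma poly_int_pderiv: "a \<le> b \<Longrightarrow> poly_int a b (pderiv p) = poly p b - poly p a"
  unfolding poly_int_def
  by (intro integral_unique fundamental_theorem_of_calculus)
     (auto simp flip: has_real_derivative_iff_has_vector_derivative
       intro!: DERIV_subset[OF poly_DERIV])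

text \<open>A continuous nonnegative integrand with integral zero vanishes on the whole interval,
  which gives a nonzero polynomial too many roots. This permits the division by
  \<open>poly_int a b (p * p)\<close> in the Gram-Schmidt step.\<close>

lemma poly_int_square_pos:
  assumes "a < b" "p \<noteq> 0"
  shows "0 < poly_int a b (p * p)"
proof -
  have nn: "0 \<le> poly_int a b (p * p)"
    unfolding poly_int_def by (intro integral_nonneg poly_integrable) simp
  moreover have "poly_int a b (p * p) \<noteq> 0"
  proof
    assume "poly_int a b (p * p) = 0"
    then have "((poly (p * p)) has_integral 0) (cbox a b)"
      unfolding poly_int_def using integrable_integral[OF poly_integrable, of "p * p" a b]
      by simp
    moreover have "continuous_on (cbox a b) (poly (p * p))"
      by (intro continuous_intros)
    moreover have "0 \<le> poly (p * p) x" for x by simp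
    ultimately have "poly (p * p) x = 0" if "x \<in> {a..b}" for x
      using has_integral_0_cbox_imp_0[of a b "poly (p * p)" x] assms that
      by (simp only: box_real cbox_interval greaterThanLessThan_empty_iff not_le)
    then have "{a..b} \<subseteq> {x. poly p x = 0}" by auto
    then have "finite {a..b}" using poly_roots_finite[OF assms(2)] finite_subset by blast
    then show False using infinite_Icc[OF assms(1)] by simp
  qed
  ultimately show ?thesis by linarith
qed

lemma coeffs_below_add: "coeffs_below n p \<Longrightarrow> coeffs_below n q \<Longrightarrow> coeffs_below n (p + q)"
  and coeffs_below_smult: "coeffs_below n p \<Longrightarrow> coeffs_below n (smult c p)"
  by (auto simp: coeffs_below_def)

lemma coeffs_below_mono: "coeffs_below n p \<Longrightarrow> n \<le> m \<Longrightarrow> coeffs_below m p"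
  by (auto simp: coeffs_below_def)

lemma coeffs_below_pderiv: "coeffs_below n p \<Longrightarrow> coeffs_below n (pderiv p)"
  by (auto simp: coeffs_below_def coeff_pderiv)

lemma coeffs_below_reduce:
  assumes "coeffs_below (Suc n) s" "coeffs_below (Suc n) p" "coeff p n = 1"
  shows "coeffs_below n (s - smult (coeff s n) p)"
  using assms unfolding coeffs_below_def
  by (metis coeff_diff coeff_smult diff_self mult.right_neutral mult_zero_right
      not_less_eq_eq le_antisym)

section \<open>Legendre polynomials, normalised to leading coefficient 1\<close>

definition monic_orth :: "real \<Rightarrow> real \<Rightarrow> nat \<Rightarrow> real poly \<Rightarrow> bool" where
  "monic_orth a b n p \<longleftrightarrow> coeffs_below (Suc n) p \<and> coeff p n = 1 \<and>
     (\<forall>r. coeffs_below n r \<longrightarrow> poly_int a b (p * r) = 0)"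

text \<open>Subtracting \<open>coeff s n\<close> times \<open>p\<close> from \<open>s\<close> lowers
  the degree below \<open>n\<close>, and the rest is orthogonal to \<open>p\<close>. Integrals
  against \<open>p\<close> are thus read off from one leading coefficient.\<close>

lemma monic_orth_expand:
  assumes "monic_orth a b n p" "coeffs_below (Suc n) s"
  shows "poly_int a b (p * s) = coeff s n * poly_int a b (p * p)"
proof -
  have "coeffs_below n (s - smult (coeff s n) p)"
    using assms by (auto simp: monic_orth_def intro: coeffs_below_reduce)
  then have "poly_int a b (p * (s - smult (coeff s n) p)) = 0"
    using assms by (auto simp: monic_orth_def)
  then show ?thesis by (simp add: right_diff_distrib poly_int_diff poly_int_smult)
qed

lemma monic_orth_of_projection:
  assumes "coeffs_below n r" "\<forall>s. coeffs_below n s \<longrightarrow> poly_int a b ((monom 1 n - r) * s) = 0"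
  shows "monic_orth a b n (monom 1 n - r)"
  using assms unfolding monic_orth_def by (auto simp: coeffs_below_def)

text \<open>Gram-Schmidt by induction on \<open>n\<close>, for all \<open>q\<close> at once: the
  hypothesis for \<open>monom 1 n\<close> yields the next orthogonal polynomial \<open>p\<close>,
  the hypothesis for \<open>q\<close> its projection \<open>r\<close> to lower degree, and the new
  projection adds the component \<open>c\<close> of \<open>q\<close> along \<open>p\<close>.\<close>

lemma projection_exists:
  assumes "a < b"
  shows "\<exists>r. coeffs_below n r \<and> (\<forall>s. coeffs_below n s \<longrightarrow> poly_int a b ((q - r) * s) = 0)"
proof (induction n arbitrary: q)
  case 0
  have "s = 0" if "coeffs_below 0 s" for s
    using that by (auto simp: coeffs_below_def poly_eq_iff)
  then have "poly_int a b ((q - 0) * s) = 0" if "coeffs_below 0 s" for s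
    using that by (metis mult_zero_right poly_int_0)
  then show ?case by (intro exI[of _ 0]) (simp add: coeffs_below_def)
next
  case (Suc n)
  obtain p where p: "monic_orth a b n p"
    using Suc.IH[of "monom 1 n"] monic_orth_of_projection by blast
  obtain r where r: "coeffs_below n r" "\<And>s. coeffs_below n s \<Longrightarrow> poly_int a b ((q - r) * s) = 0"
    using Suc.IH[of q] by blast
  have "p \<noteq> 0" using p by (auto simp: monic_orth_def)
  then have pos: "0 < poly_int a b (p * p)" using poly_int_square_pos assms by blast
  define c where "c = poly_int a b (q * p) / poly_int a b (p * p)"
  have rp: "poly_int a b (p * r) = 0" using p r(1) by (auto simp: monic_orth_def)
  show ?case
  proof (intro exI[of _ "r + smult c p"] conjI allI impI)
    show "coeffs_below (Suc n) (r + smult c p)"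
      using p r coeffs_below_mono[of n r "Suc n"]
      by (intro coeffs_below_add coeffs_below_smult) (auto simp: monic_orth_def)
    fix s assume s: "coeffs_below (Suc n) s"
    define s' where "s' = s - smult (coeff s n) p"
    have s': "coeffs_below n s'" unfolding s'_def
      using p s by (intro coeffs_below_reduce) (auto simp: monic_orth_def)
    have ps': "poly_int a b (p * s') = 0" using p s' by (auto simp: monic_orth_def)
    have s_eq: "s = s' + smult (coeff s n) p" by (simp add: s'_def)
    have "poly_int a b ((q - (r + smult c p)) * s) =
      poly_int a b ((q - r) * s') - c * poly_int a b (p * s')
      + coeff s n * (poly_int a b (q * p) - poly_int a b (p * r) - c * poly_int a b (p * p))"
      by (subst s_eq) (simp add: algebra_simps poly_int_add poly_int_diff poly_int_smult)
    also have "\<dots> = 0" using r(2)[OF s'] ps' rp pos by (simp add: c_def)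
    finally show "poly_int a b ((q - (r + smult c p)) * s) = 0" .
  qed
qed

lemma monic_orth_exists: "a < b \<Longrightarrow> \<exists>p. monic_orth a b n p"
  using projection_exists[of a b n "monom 1 n"] monic_orth_of_projection by blast

section \<open>The Legendre operator\<close>

lemma poly_int_by_parts:
  assumes "a \<le> b"
  shows "poly_int a b (p * pderiv q) = poly (p * q) b - poly (p * q) a - poly_int a b (pderiv p * q)"
proof -
  have "poly_int a b (pderiv (p * q)) = poly (p * q) b - poly (p * q) a"
    using assms by (rule poly_int_pderiv)
  then show ?thesis by (simp add: pderiv_mult poly_int_add algebra_simps)
qed

abbreviation (input) interval_weight :: "real \<Rightarrow> real \<Rightarrow> real poly" where
  "interval_weight a b \<equiv> [:- a, 1:] * [:b, - 1:]"

lemma coeff_linear_mult: "coeff ([:c, d:] * p) (Suc i) = c * coeff p (Suc i) + d * coeff p i"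
  for c d :: real
  by simp

lemma coeffs_below_linear_mult: "coeffs_below n p \<Longrightarrow> coeffs_below (Suc n) ([:c, d:] * p)"
  unfolding coeffs_below_def
proof (intro allI impI)
  fix i assume *: "\<forall>i\<ge>n. coeff p i = 0" "Suc n \<le> i"
  then obtain j where "i = Suc j" "n \<le> j" by (metis Suc_le_D Suc_le_mono)
  then show "coeff ([:c, d:] * p) i = 0" using *(1) by (simp only: coeff_linear_mult le_SucI)
qed

lemma coeffs_below_pderiv': "coeffs_below (Suc n) p \<Longrightarrow> coeffs_below n (pderiv p)"
  by (auto simp: coeffs_below_def coeff_pderiv)

text \<open>Each of the two differentiations lowers the degree by one, and the quadratic weight
  between them raises it by two.\<close>

lemma legendre_operator_below:
  assumes "coeffs_below n p"
  shows "coeffs_below n (pderiv (interval_weight a b * pderiv p))"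
proof (cases n)
  case 0
  then have "p = 0" using assms by (auto simp: coeffs_below_def poly_eq_iff)
  then show ?thesis by (simp add: coeffs_below_def)
next
  case (Suc m)
  then have "coeffs_below m (pderiv p)" using assms coeffs_below_pderiv' by blast
  then have "coeffs_below (Suc (Suc m)) (interval_weight a b * pderiv p)"
    unfolding mult.assoc by (intro coeffs_below_linear_mult)
  then show ?thesis using Suc coeffs_below_pderiv' by blast
qed

text \<open>The factor \<open>n (n + 1)\<close> is the eigenvalue of the Legendre operator in degree
  \<open>n\<close>; it comes from the leading term \<open>- x^2\<close> of the weight.\<close>

lemma coeff_legendre_operator:
  assumes "coeffs_below (Suc n) p"
  shows "coeff (pderiv (interval_weight a b * pderiv p)) n = - (real n * real (Suc n) * coeff p n)"
proof (cases n)
  case 0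
  then have "pderiv p = 0" using assms by (auto simp: coeffs_below_def coeff_pderiv poly_eq_iff)
  then show ?thesis using 0 by simp
next
  case (Suc m)
  have z: "coeff p (Suc n) = 0" "coeff p (Suc (Suc n)) = 0" using assms by (auto simp: coeffs_below_def)
  show ?thesis using z Suc
    unfolding mult.assoc coeff_pderiv
    by (simp only: coeff_linear_mult coeff_pderiv) simp
qed

lemma coeff_linear_pderiv:
  assumes "coeffs_below (Suc n) p"
  shows "coeff ([:c, d:] * pderiv p) n = d * (real n * coeff p n)"
proof (cases n)
  case 0
  then have "pderiv p = 0" using assms by (auto simp: coeffs_below_def coeff_pderiv poly_eq_iff)
  then show ?thesis using 0 by simp
next
  case (Suc m)
  have z: "coeff p (Suc n) = 0" using assms by (auto simp: coeffs_below_def)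
  show ?thesis using z unfolding Suc coeff_linear_mult coeff_pderiv by simp
qed

text \<open>The difference of both sides is \<open>s t (x / s - y / t)^2\<close>. It is used with
  \<open>s = 2 n + 1\<close> and \<open>t = n^2\<close>, whose sum is
  \<open>(n + 1)^2\<close>.\<close>

lemma weighted_cauchy_schwarz:
  fixes s t x y :: real
  assumes "0 < s" "0 < t"
  shows "(x + y)\<^sup>2 \<le> (s + t) * (x\<^sup>2 / s + y\<^sup>2 / t)"
proof -
  define A B where "A = x / s" and "B = y / t"
  have x: "x = s * A" and y: "y = t * B" using assms by (auto simp: A_def B_def)
  have e: "x\<^sup>2 / s + y\<^sup>2 / t = s * A\<^sup>2 + t * B\<^sup>2"
    using assms by (simp add: x y power2_eq_square)
  have "(s + t) * (s * A\<^sup>2 + t * B\<^sup>2) - (x + y)\<^sup>2 = s * t * (A - B)\<^sup>2"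
    unfolding x y by (simp add: power2_eq_square algebra_simps)
  moreover have "0 \<le> s * t * (A - B)\<^sup>2" using assms by simp
  ultimately show ?thesis unfolding e by linarith
qed

text \<open>The Legendre operator \<open>q \<mapsto> (w q')'\<close> with \<open>w = (x - a) (b - x)\<close> is symmetric and maps polynomials
  of degree at most \<open>n\<close> to such polynomials. Hence the forms on the left-hand sides diagonalize along the monic
  orthogonal polynomials \<open>p\<close>, and for these they follow from the leading coefficients alone:
  integrating \<open>((x - a) p\<^sup>2)'\<close> gives \<open>(b - a) p(b)\<^sup>2 = (2 n + 1) \<parallel>p\<parallel>\<^sup>2\<close>.\<close>

lemma legendre_inverse_estimates:
  assumes "a < b" "coeffs_below n q"
  shows "poly_int a b (interval_weight a b * (pderiv q * pderiv q)) \<le> (real n)\<^sup>2 * poly_int a b (q * q)"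
    and "(b - a) * (poly q b)\<^sup>2 \<le> (real n)\<^sup>2 * poly_int a b (q * q)"
    and "(b - a) * (poly q a)\<^sup>2 \<le> (real n)\<^sup>2 * poly_int a b (q * q)"
proof -
  let ?w = "interval_weight a b"
  \<comment> \<open>Induction step for the endpoint values: the component of degree \<open>n\<close>
    contributes \<open>2 n + 1\<close>, the lower degrees contribute \<open>n^2\<close>. For
    \<open>n = 0\<close> the weight \<open>n^2\<close> is not positive, but then \<open>y\<close>
    vanishes.\<close>
  have quad: "(x + y)\<^sup>2 * L \<le> (real (Suc n))\<^sup>2 * (X + Y)"
    if "x\<^sup>2 * L = (2 * real n + 1) * X" "y\<^sup>2 * L \<le> (real n)\<^sup>2 * Y" "0 < L" "0 \<le> Y" "0 \<le> X"
    for x y X Y L :: real and n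
  proof (cases "n = 0")
    case True
    then have "y\<^sup>2 * L \<le> 0" using that by simp
    then have "y = 0" using that
      by (metis linorder_not_less mult_pos_pos zero_less_power2)
    then show ?thesis using that True by simp
  next
    case False
    let ?s = "2 * real n + 1" and ?t = "(real n)\<^sup>2"
    have pos: "0 < ?t" "0 < ?s" using False by auto
    have "(x + y)\<^sup>2 \<le> (?s + ?t) * (x\<^sup>2 / ?s + y\<^sup>2 / ?t)"
      by (rule weighted_cauchy_schwarz[OF pos(2,1)])
    then have "(x + y)\<^sup>2 * L \<le> (?s + ?t) * (x\<^sup>2 / ?s + y\<^sup>2 / ?t) * L"
      using that by (intro mult_right_mono) auto
    also have "\<dots> = (?s + ?t) * (x\<^sup>2 * L / ?s + y\<^sup>2 * L / ?t)"
      by (simp only: mult.assoc distrib_right times_divide_eq_left)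
    also have "\<dots> \<le> (?s + ?t) * (X + Y)"
      using that pos by (intro mult_left_mono add_mono) (auto simp: field_simps)
    also have "?s + ?t = (real (Suc n))\<^sup>2" by (simp add: power2_eq_square algebra_simps)
    finally show ?thesis .
  qed
  have sqnn: "0 \<le> poly_int a b (p * p)" for p
    unfolding poly_int_def by (intro integral_nonneg poly_integrable) simp
  have "poly_int a b (?w * (pderiv q * pderiv q)) \<le> (real n)\<^sup>2 * poly_int a b (q * q) \<and>
    (poly q b)\<^sup>2 * (b - a) \<le> (real n)\<^sup>2 * poly_int a b (q * q) \<and>
    (poly q a)\<^sup>2 * (b - a) \<le> (real n)\<^sup>2 * poly_int a b (q * q)"
    using assms(2)
  proof (induction n arbitrary: q)
    case 0
    then have "q = 0" by (auto simp: coeffs_below_def poly_eq_iff)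
    then show ?case by simp
  next
    case (Suc n)
    obtain p where p: "monic_orth a b n p" using monic_orth_exists assms by blast
    then have pb: "coeffs_below (Suc n) p" and p1: "coeff p n = 1" by (auto simp: monic_orth_def)
    define c where "c = coeff q n"
    define r where "r = q - smult c p"
    have r: "coeffs_below n r" unfolding r_def c_def using Suc.prems pb p1 coeffs_below_reduce by blast
    have q: "q = smult c p + r" by (simp add: r_def)
    note IH = Suc.IH[OF r]
    let ?P = "poly_int a b (p * p)" and ?R = "poly_int a b (r * r)"
    have pr: "poly_int a b (p * r) = 0" using p r by (auto simp: monic_orth_def)
    have Q: "poly_int a b (q * q) = c\<^sup>2 * ?P + ?R"
    proof -
      have "q * q = smult (c\<^sup>2) (p * p) + smult (2 * c) (p * r) + r * r"
        unfolding q poly_eq_poly_eq_iff[symmetric]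
        by (rule ext) (simp add: algebra_simps power2_eq_square)
      then show ?thesis by (simp only: poly_int_add poly_int_smult pr mult_zero_right add_0_right)
    qed
    \<comment> \<open>Integration by parts; the boundary terms disappear because the weight is zero
      at \<open>a\<close> and \<open>b\<close>.\<close>
    have sym: "poly_int a b (?w * (pderiv p * pderiv s)) = - poly_int a b (p * pderiv (?w * pderiv s))" for s
    proof -
      have "poly_int a b (W * pderiv p) = - poly_int a b (pderiv W * p)"
        if "poly W a = 0" "poly W b = 0" for W
        using poly_int_by_parts[of a b W p] assms(1) that by simp
      from this[of "?w * pderiv s"]
      have "poly_int a b ((?w * pderiv s) * pderiv p) = - poly_int a b (pderiv (?w * pderiv s) * p)"
        by (simp only: poly_mult) simp
      then show ?thesis by (simp only: ac_simps)
    qed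
    have wpr: "poly_int a b (?w * (pderiv p * pderiv r)) = 0"
      unfolding sym using p legendre_operator_below[OF r] by (auto simp: monic_orth_def)
    \<comment> \<open>By \<open>monic_orth_expand\<close> only the leading coefficient of the
      operator applied to \<open>p\<close> matters, so the eigenvalue appears without showing that
      \<open>p\<close> is an eigenvector.\<close>
    have wpp: "poly_int a b (?w * (pderiv p * pderiv p)) = real n * real (Suc n) * ?P"
      unfolding sym using monic_orth_expand[OF p legendre_operator_below[OF pb]]
        coeff_legendre_operator[OF pb, of a b] p1 by simp
    have "poly_int a b (?w * (pderiv q * pderiv q)) =
        c\<^sup>2 * poly_int a b (?w * (pderiv p * pderiv p))
        + 2 * c * poly_int a b (?w * (pderiv p * pderiv r))
        + poly_int a b (?w * (pderiv r * pderiv r))"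
    proof -
      have "?w * (pderiv q * pderiv q) = smult (c\<^sup>2) (?w * (pderiv p * pderiv p))
          + smult (2 * c) (?w * (pderiv p * pderiv r)) + ?w * (pderiv r * pderiv r)"
      proof -
        have "W * ((smult d P + R) * (smult d P + R))
            = smult (d\<^sup>2) (W * (P * P)) + smult (2 * d) (W * (P * R)) + W * (R * R)"
          for W P R :: "real poly" and d
          unfolding poly_eq_poly_eq_iff[symmetric]
          by (rule ext) (simp add: algebra_simps power2_eq_square)
        then show ?thesis unfolding q pderiv_add pderiv_smult .
      qed
      then show ?thesis by (simp only: poly_int_add poly_int_smult)
    qed
    also have "\<dots> = c\<^sup>2 * (real n * real (Suc n) * ?P) + poly_int a b (?w * (pderiv r * pderiv r))"
      unfolding wpr wpp by simp
    also have "\<dots> \<le> c\<^sup>2 * ((real (Suc n))\<^sup>2 * ?P) + (real (Suc n))\<^sup>2 * ?R"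
    proof (rule add_mono)
      have "real n * real (Suc n) * ?P \<le> (real (Suc n))\<^sup>2 * ?P"
        using sqnn[of p] unfolding power2_eq_square by (intro mult_right_mono) auto
      then show "c\<^sup>2 * (real n * real (Suc n) * ?P) \<le> c\<^sup>2 * ((real (Suc n))\<^sup>2 * ?P)"
        by (intro mult_left_mono) auto
      have "poly_int a b (?w * (pderiv r * pderiv r)) \<le> (real n)\<^sup>2 * ?R" using IH by blast
      also have "\<dots> \<le> (real (Suc n))\<^sup>2 * ?R"
        using sqnn[of r] by (intro mult_right_mono power_mono) auto
      finally show "poly_int a b (?w * (pderiv r * pderiv r)) \<le> (real (Suc n))\<^sup>2 * ?R" .
    qed
    finally have 1: "poly_int a b (?w * (pderiv q * pderiv q)) \<le> (real (Suc n))\<^sup>2 * poly_int a b (q * q)"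
      by (simp add: Q algebra_simps)
    have lin: "poly_int a b ([:u, v:] * pderiv p * p) = v * real n * ?P" for u v
    proof -
      have "coeffs_below (Suc n) ([:u, v:] * pderiv p)"
        using coeffs_below_linear_mult[OF coeffs_below_pderiv'[OF pb]] .
      from monic_orth_expand[OF p this] show ?thesis
        unfolding coeff_linear_pderiv[OF pb] p1 by (simp only: ac_simps)
    qed
    \<comment> \<open>With the linear factor \<open>x - a\<close> (\<open>u = - a\<close>,
      \<open>v = 1\<close>) only the value at \<open>b\<close> survives, with \<open>b - x\<close>
      only the value at \<open>a\<close>.\<close>
    have endp: "poly ([:u, v:] * (p * p)) b - poly ([:u, v:] * (p * p)) a = v * (2 * real n + 1) * ?P" for u v
    proof -
      have "pderiv ([:u, v:] * (p * p)) = smult v (p * p) + smult 2 ([:u, v:] * pderiv p * p)"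
        unfolding pderiv_mult poly_eq_poly_eq_iff[symmetric]
        by (rule ext) (simp add: pderiv_pCons algebra_simps)
      then have "poly_int a b (pderiv ([:u, v:] * (p * p))) = v * ?P + 2 * (v * real n * ?P)"
        by (simp only: poly_int_add poly_int_smult lin)
      then show ?thesis using poly_int_pderiv[of a b "[:u, v:] * (p * p)"] assms
        by (simp add: algebra_simps)
    qed
    have pb2: "(c * poly p b)\<^sup>2 * (b - a) = (2 * real n + 1) * (c\<^sup>2 * ?P)"
    proof -
      have "(poly p b)\<^sup>2 * (b - a) = (2 * real n + 1) * ?P"
        using endp[of "- a" 1] by (simp add: algebra_simps power2_eq_square)
      then have "c\<^sup>2 * ((poly p b)\<^sup>2 * (b - a)) = c\<^sup>2 * ((2 * real n + 1) * ?P)" by simp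
      then show ?thesis by (simp only: power_mult_distrib ac_simps)
    qed
    have pa2: "(c * poly p a)\<^sup>2 * (b - a) = (2 * real n + 1) * (c\<^sup>2 * ?P)"
    proof -
      have "(poly p a)\<^sup>2 * (b - a) = (2 * real n + 1) * ?P"
        using endp[of b "-1"] by (simp add: algebra_simps power2_eq_square)
      then have "c\<^sup>2 * ((poly p a)\<^sup>2 * (b - a)) = c\<^sup>2 * ((2 * real n + 1) * ?P)" by simp
      then show ?thesis by (simp only: power_mult_distrib ac_simps)
    qed
    have qa: "poly q a = c * poly p a + poly r a" and qb: "poly q b = c * poly p b + poly r b"
      by (simp_all add: q)
    have 2: "(poly q b)\<^sup>2 * (b - a) \<le> (real (Suc n))\<^sup>2 * poly_int a b (q * q)"
      using quad[OF pb2, of "poly r b" ?R] IH sqnn assms(1) unfolding Q qb by simp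
    have 3: "(poly q a)\<^sup>2 * (b - a) \<le> (real (Suc n))\<^sup>2 * poly_int a b (q * q)"
      using quad[OF pa2, of "poly r a" ?R] IH sqnn assms(1) unfolding Q qa by simp
    from 1 2 3 show ?case by blast
  qed
  then show "poly_int a b (?w * (pderiv q * pderiv q)) \<le> (real n)\<^sup>2 * poly_int a b (q * q)"
    "(b - a) * (poly q b)\<^sup>2 \<le> (real n)\<^sup>2 * poly_int a b (q * q)"
    "(b - a) * (poly q a)\<^sup>2 \<le> (real n)\<^sup>2 * poly_int a b (q * q)"
    by (simp_all add: mult.commute)
qed


text \<open>With \<open>coeffs_below n\<close> the degree is at most \<open>n - 1\<close>, and
  \<open>n^2\<close> is the sum of \<open>2 k + 1\<close> over the degrees
  \<open>k < n\<close>.\<close>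

lemma poly_endpoint_bound:
  assumes "a < b" "coeffs_below n q"
  shows "(b - a) * (poly q b)\<^sup>2 \<le> (real n)\<^sup>2 * integral {a..b} (\<lambda>x. (poly q x)\<^sup>2)"
    and "(b - a) * (poly q a)\<^sup>2 \<le> (real n)\<^sup>2 * integral {a..b} (\<lambda>x. (poly q x)\<^sup>2)"
proof -
  have e: "poly_int a b (q * q) = integral {a..b} (\<lambda>x. (poly q x)\<^sup>2)"
    unfolding poly_int_def by (rule integral_cong) (simp add: power2_eq_square)
  show "(b - a) * (poly q b)\<^sup>2 \<le> (real n)\<^sup>2 * integral {a..b} (\<lambda>x. (poly q x)\<^sup>2)"
    "(b - a) * (poly q a)\<^sup>2 \<le> (real n)\<^sup>2 * integral {a..b} (\<lambda>x. (poly q x)\<^sup>2)"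
    using legendre_inverse_estimates(2,3)[OF assms] unfolding e by auto
qed

section \<open>Mass of a polynomial near the endpoints, and Markov's inequality\<close>

lemma poly_square_integrable: "(\<lambda>x. (poly (q :: real poly) x)\<^sup>2) integrable_on {a..b}"
  by (intro integrable_continuous_real continuous_intros)

text \<open>The strips \<open>[a, c]\<close> and \<open>[d, b]\<close> of width \<open>(b - a) / (8 n\<^sup>2)\<close> carry at most half of
  the \<open>L\<^sup>2\<close> mass of a polynomial; this is what makes the estimates below insensitive to the
  boundary.\<close>

lemma poly_mass_interior:
  fixes a b :: real
  assumes ab: "a < b" and q: "coeffs_below n q" and n: "1 \<le> n"
    and c: "a \<le> c" "c \<le> a + (b - a) / (8 * (real n)\<^sup>2)"
    and d: "b - (b - a) / (8 * (real n)\<^sup>2) \<le> d" "d \<le> b"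
  shows "c < d"
    and "integral {a..b} (\<lambda>x. (poly q x)\<^sup>2) \<le> 2 * integral {c..d} (\<lambda>x. (poly q x)\<^sup>2)"
    and "x \<in> {a..c} \<union> {d..b} \<Longrightarrow>
      (b - a) * (poly q x)\<^sup>2 \<le> 2 * (real n)\<^sup>2 * integral {a..b} (\<lambda>x. (poly q x)\<^sup>2)"
proof -
  let ?S = "integral {a..b} (\<lambda>x. (poly q x)\<^sup>2)"
  define \<delta> where "\<delta> = (b - a) / (8 * (real n)\<^sup>2)"
  have n2: "1 \<le> (real n)\<^sup>2" using n by simp
  have \<delta>0: "0 < \<delta>" unfolding \<delta>_def using ab n by (intro divide_pos_pos) auto
  have \<delta>8: "\<delta> \<le> (b - a) / 8"
    unfolding \<delta>_def using ab n n2 by (intro divide_left_mono) auto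
  have \<delta>n: "\<delta> * (8 * (real n)\<^sup>2) = b - a" using n by (simp add: \<delta>_def)
  have c': "c \<le> a + \<delta>" and d': "b - \<delta> \<le> d" using c d by (auto simp: \<delta>_def)
  have "a + (b - a) / 8 < b - (b - a) / 8" using ab by (simp add: field_simps)
  then show cd: "c < d" using c' d' \<delta>8 by linarith
  have S0: "0 \<le> ?S" by (intro integral_nonneg poly_square_integrable) simp
  have sub: "integral {u..v} (\<lambda>x. (poly q x)\<^sup>2) \<le> ?S" if "a \<le> u" "v \<le> b" for u v
    using that by (intro integral_subset_le poly_square_integrable) auto
  \<comment> \<open>A point \<open>x\<close> of a strip is an endpoint of \<open>[x, b]\<close> or
    \<open>[a, x]\<close>, whichever has at least half the full length; the endpoint bound is
    applied on that subinterval.\<close>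
  have pt: "(b - a) * (poly q x)\<^sup>2 \<le> 2 * (real n)\<^sup>2 * ?S" if x: "x \<in> {a..c} \<union> {d..b}" for x
  proof (cases "x \<le> c")
    case True
    then have xa: "x - a \<le> \<delta>" "a \<le> x" using c' x cd by auto
    have xb: "x < b" "(b - a) / 2 \<le> b - x" using xa \<delta>8 ab by auto
    have "(b - a) / 2 * (poly q x)\<^sup>2 \<le> (b - x) * (poly q x)\<^sup>2"
      using xb(2) by (rule mult_right_mono) simp
    also have "\<dots> \<le> (real n)\<^sup>2 * integral {x..b} (\<lambda>x. (poly q x)\<^sup>2)"
      using poly_endpoint_bound(2)[OF xb(1) q] .
    also have "\<dots> \<le> (real n)\<^sup>2 * ?S" using sub[of x b] xa by (intro mult_left_mono) auto
    finally show ?thesis by simp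
  next
    case False
    then have xa: "b - x \<le> \<delta>" "x \<le> b" using d' x by auto
    have xb: "a < x" "(b - a) / 2 \<le> x - a" using xa \<delta>8 ab by auto
    have "(b - a) / 2 * (poly q x)\<^sup>2 \<le> (x - a) * (poly q x)\<^sup>2"
      using xb(2) by (rule mult_right_mono) simp
    also have "\<dots> \<le> (real n)\<^sup>2 * integral {a..x} (\<lambda>x. (poly q x)\<^sup>2)"
      using poly_endpoint_bound(1)[OF xb(1) q] .
    also have "\<dots> \<le> (real n)\<^sup>2 * ?S" using sub[of a x] xa by (intro mult_left_mono) auto
    finally show ?thesis by simp
  qed
  then show "x \<in> {a..c} \<union> {d..b} \<Longrightarrow> (b - a) * (poly q x)\<^sup>2 \<le> 2 * (real n)\<^sup>2 * ?S" .
  \<comment> \<open>Width times pointwise bound: \<open>2 n^2 ?S / (b - a)\<close> over a length of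
    at most \<open>(b - a) / (8 n^2)\<close> gives a quarter of \<open>?S\<close>. The factor 8 in
    the strip width is chosen for this.\<close>
  have strip: "integral {u..v} (\<lambda>x. (poly q x)\<^sup>2) \<le> ?S / 4"
    if uv: "u \<le> v" "v - u \<le> \<delta>" "{u..v} \<subseteq> {a..c} \<union> {d..b}" for u v
  proof -
    let ?M = "2 * (real n)\<^sup>2 * ?S / (b - a)"
    have "integral {u..v} (\<lambda>x. (poly q x)\<^sup>2) \<le> integral {u..v} (\<lambda>x. ?M)"
      using pt uv ab by (intro integral_le poly_square_integrable) (auto simp: field_simps)
    also have "\<dots> = (v - u) * ?M" using uv(1) by simp
    also have "\<dots> \<le> \<delta> * ?M" using uv(2) S0 ab by (intro mult_right_mono) auto
    also have "\<dots> = (\<delta> * (8 * (real n)\<^sup>2)) * ?S / (4 * (b - a))"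
    proof -
      have "\<delta> * (2 * m * S / L) = (\<delta> * (8 * m)) * S / (4 * L)" for m S L :: real by simp
      then show ?thesis .
    qed
    also have "\<dots> = ?S / 4"
    proof -
      have "L * S / (4 * L) = S / 4" if "0 < L" for L S :: real using that by simp
      from this[of "b - a"] show ?thesis unfolding \<delta>n using ab by (simp only: diff_gt_0_iff_gt)
    qed
    finally show ?thesis .
  qed
  have "?S = integral {a..c} (\<lambda>x. (poly q x)\<^sup>2) + integral {c..d} (\<lambda>x. (poly q x)\<^sup>2)
      + integral {d..b} (\<lambda>x. (poly q x)\<^sup>2)"
    using Henstock_Kurzweil_Integration.integral_combine[of a c b "\<lambda>x. (poly q x)\<^sup>2"]
      Henstock_Kurzweil_Integration.integral_combine[of c d b "\<lambda>x. (poly q x)\<^sup>2"]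
      poly_square_integrable c d cd by auto
  then show "?S \<le> 2 * integral {c..d} (\<lambda>x. (poly q x)\<^sup>2)"
    using strip[of a c] strip[of d b] c' d' c(1) d(2) by auto
qed

text \<open>The weighted estimate loses control where the weight vanishes. Outside the strips the
  weight is at least \<open>\<delta> (b - a) / 2 = (b - a)^2 / (16 n^2)\<close>, and at least half
  of the mass of the derivative lies there; hence the constant 32.\<close>

lemma poly_markov_L2:
  fixes a b :: real
  assumes ab: "a < b" and q: "coeffs_below n q" and n: "1 \<le> n"
  shows "(b - a)\<^sup>2 * integral {a..b} (\<lambda>x. (poly (pderiv q) x)\<^sup>2)
    \<le> 32 * (real n)^4 * integral {a..b} (\<lambda>x. (poly q x)\<^sup>2)"
proof -
  let ?w = "interval_weight a b"
  define \<delta> where "\<delta> = (b - a) / (8 * (real n)\<^sup>2)"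
  let ?c = "a + \<delta>" and ?d = "b - \<delta>"
  have n2: "1 \<le> (real n)\<^sup>2" using n by simp
  have \<delta>0: "0 < \<delta>" unfolding \<delta>_def using ab n by (intro divide_pos_pos) auto
  have \<delta>8: "\<delta> \<le> (b - a) / 8"
    unfolding \<delta>_def using ab n n2 by (intro divide_left_mono) auto
  have \<delta>n: "\<delta> * (8 * (real n)\<^sup>2) = b - a" using n by (simp add: \<delta>_def)
  have 1: "integral {a..b} (\<lambda>x. (poly (pderiv q) x)\<^sup>2)
      \<le> 2 * integral {?c..?d} (\<lambda>x. (poly (pderiv q) x)\<^sup>2)"
    using \<delta>0 by (intro poly_mass_interior(2)[OF ab coeffs_below_pderiv[OF q] n]) (auto simp: \<delta>_def)
  have "\<delta> * (b - a) / 2 * integral {?c..?d} (\<lambda>x. (poly (pderiv q) x)\<^sup>2)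
      = integral {?c..?d} (\<lambda>x. \<delta> * (b - a) / 2 * (poly (pderiv q) x)\<^sup>2)" by simp
  also have "\<dots> \<le> integral {?c..?d} (poly (?w * (pderiv q * pderiv q)))"
  proof (intro integral_le poly_integrable)
    show "(\<lambda>x. \<delta> * (b - a) / 2 * (poly (pderiv q) x)\<^sup>2) integrable_on {?c..?d}"
      by (intro integrable_continuous_real continuous_intros)
    fix x assume x: "x \<in> {?c..?d}"
    \<comment> \<open>The smaller of the distances to the two endpoints is at least
      \<open>\<delta>\<close>, the larger at least \<open>(b - a) / 2\<close>.\<close>
    have "\<delta> * (b - a) / 2 \<le> (x - a) * (b - x)"
    proof (cases "x - a \<le> (b - a) / 2")
      case True
      then have "\<delta> * ((b - a) / 2) \<le> (x - a) * (b - x)"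
        using x ab \<delta>0 by (intro mult_mono) auto
      then show ?thesis by simp
    next
      case False
      then have "((b - a) / 2) * \<delta> \<le> (x - a) * (b - x)"
        using x ab \<delta>0 by (intro mult_mono) auto
      then show ?thesis by (simp add: mult.commute)
    qed
    then have "\<delta> * (b - a) / 2 * (poly (pderiv q) x)\<^sup>2 \<le> ((x - a) * (b - x)) * (poly (pderiv q) x)\<^sup>2"
      by (intro mult_right_mono) auto
    then show "\<delta> * (b - a) / 2 * (poly (pderiv q) x)\<^sup>2 \<le> poly (?w * (pderiv q * pderiv q)) x"
      by (simp add: power2_eq_square algebra_simps)
  qed
  also have "\<dots> \<le> integral {a..b} (poly (?w * (pderiv q * pderiv q)))"
  proof (intro integral_subset_le poly_integrable)
    show "\<forall>x\<in>{a..b}. 0 \<le> poly (?w * (pderiv q * pderiv q)) x"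
    proof
      fix x assume that: "x \<in> {a..b}"
      have "0 \<le> (x - a) * (b - x) * (poly (pderiv q) x * poly (pderiv q) x)"
        using that by (intro mult_nonneg_nonneg zero_le_square) auto
      then show "0 \<le> poly (?w * (pderiv q * pderiv q)) x" by (simp add: algebra_simps)
    qed
  qed (use \<delta>0 in auto)
  also have "\<dots> \<le> (real n)\<^sup>2 * poly_int a b (q * q)"
    using legendre_inverse_estimates(1)[OF ab q] by (simp only: poly_int_def)
  also have "poly_int a b (q * q) = integral {a..b} (\<lambda>x. (poly q x)\<^sup>2)"
    unfolding poly_int_def by (rule integral_cong) (simp add: power2_eq_square)
  finally have 2: "\<delta> * (b - a) / 2 * integral {?c..?d} (\<lambda>x. (poly (pderiv q) x)\<^sup>2)
      \<le> (real n)\<^sup>2 * integral {a..b} (\<lambda>x. (poly q x)\<^sup>2)" .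
  have "(b - a)\<^sup>2 = 16 * (real n)\<^sup>2 * (\<delta> * (b - a) / 2)"
  proof -
    have "(b - a)\<^sup>2 = (\<delta> * (8 * (real n)\<^sup>2)) * (b - a)" unfolding \<delta>n by (simp add: power2_eq_square)
    then show ?thesis by simp
  qed
  then have "(b - a)\<^sup>2 * integral {a..b} (\<lambda>x. (poly (pderiv q) x)\<^sup>2)
      \<le> 16 * (real n)\<^sup>2 * (\<delta> * (b - a) / 2)
         * (2 * integral {?c..?d} (\<lambda>x. (poly (pderiv q) x)\<^sup>2))"
    using 1 ab \<delta>0 by (simp only:, intro mult_left_mono) auto
  also have "\<dots> = 32 * (real n)\<^sup>2 * (\<delta> * (b - a) / 2 * integral {?c..?d} (\<lambda>x. (poly (pderiv q) x)\<^sup>2))"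
    by (simp only: ac_simps)
  also have "\<dots> \<le> 32 * (real n)\<^sup>2 * ((real n)\<^sup>2 * integral {a..b} (\<lambda>x. (poly q x)\<^sup>2))"
    using 2 by (intro mult_left_mono) auto
  also have "\<dots> = 32 * (real n)^4 * integral {a..b} (\<lambda>x. (poly q x)\<^sup>2)"
    by (simp add: power4_eq_xxxx power2_eq_square)
  finally show ?thesis .
qed


section \<open>A polynomial against an arbitrary C^1 function on an interval\<close>

lemma young_ineq: "0 < s \<Longrightarrow> x * y \<le> s * x\<^sup>2 + y\<^sup>2 / (4 * s)" for s x y :: real
proof -
  assume s: "0 < s"
  have "0 \<le> (2 * s * x - y)\<^sup>2 / (4 * s)" using s by simp
  also have "\<dots> = s * x\<^sup>2 + y\<^sup>2 / (4 * s) - x * y"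
    using s by (simp add: power2_eq_square field_simps)
  finally show ?thesis by simp
qed

text \<open>The minimum of \<open>e^2\<close> over \<open>[u, v]\<close> is at most its mean there,
  and the integral over \<open>[u, v]\<close> is at most the one over \<open>[a, b]\<close>.\<close>

lemma exists_point_below_mean:
  fixes e :: "real \<Rightarrow> real"
  assumes "a \<le> u" "u < v" "v \<le> b" "continuous_on {a..b} e"
  shows "\<exists>c\<in>{u..v}. (v - u) * (e c)\<^sup>2 \<le> integral {a..b} (\<lambda>x. (e x)\<^sup>2)"
proof -
  have ce: "continuous_on {a..b} (\<lambda>x. (e x)\<^sup>2)" using assms(4) by (intro continuous_intros)
  then have cuv: "continuous_on {u..v} (\<lambda>x. (e x)\<^sup>2)" using assms by (auto intro: continuous_on_subset)
  obtain c where c: "c \<in> {u..v}" "\<And>x. x \<in> {u..v} \<Longrightarrow> (e c)\<^sup>2 \<le> (e x)\<^sup>2"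
    using continuous_attains_inf[OF compact_Icc _ cuv] assms(2) by auto
  have "(v - u) * (e c)\<^sup>2 = integral {u..v} (\<lambda>x. (e c)\<^sup>2)" using assms(2) by simp
  also have "\<dots> \<le> integral {u..v} (\<lambda>x. (e x)\<^sup>2)"
    using c cuv by (intro integral_le integrable_continuous_real) auto
  also have "\<dots> \<le> integral {a..b} (\<lambda>x. (e x)\<^sup>2)"
    using cuv ce assms by (intro integral_subset_le integrable_continuous_real) auto
  finally show ?thesis using c(1) by blast
qed

text \<open>Instead of a trace inequality, the integration by parts is carried out on \<open>[c, d]\<close>, where \<open>c\<close> and \<open>d\<close>
  lie in the boundary strips and are chosen such that \<open>q - f\<close> is small there.\<close>

proposition inverse_estimate_interval:
  fixes f f' :: "real \<Rightarrow> real"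
  assumes ab: "a < b" and q: "coeffs_below n q" and n: "1 \<le> n"
    and f: "\<And>x. x \<in> {a..b} \<Longrightarrow> (f has_real_derivative f' x) (at x within {a..b})"
    and f': "continuous_on {a..b} f'"
  shows "integral {a..b} (\<lambda>x. (poly (pderiv q) x)\<^sup>2)
    \<le> 16 * integral {a..b} (\<lambda>x. (f' x)\<^sup>2)
      + 1024 * ((real n)^4 / (b - a)\<^sup>2) * integral {a..b} (\<lambda>x. (poly q x - f x)\<^sup>2)"
proof -
  define \<delta> where "\<delta> = (b - a) / (8 * (real n)\<^sup>2)"
  have n2: "1 \<le> (real n)\<^sup>2" using n by simp
  have \<delta>0: "0 < \<delta>" unfolding \<delta>_def using ab n by (intro divide_pos_pos) auto
  have \<delta>8: "\<delta> \<le> (b - a) / 8"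
    unfolding \<delta>_def using ab n n2 by (intro divide_left_mono) auto
  let ?q' = "poly (pderiv q)" and ?q'' = "poly (pderiv (pderiv q))"
  define e where "e = (\<lambda>x. poly q x - f x)"
  define A where "A = integral {a..b} (\<lambda>x. (?q' x)\<^sup>2)"
  define A2 where "A2 = integral {a..b} (\<lambda>x. (?q'' x)\<^sup>2)"
  define E where "E = integral {a..b} (\<lambda>x. (e x)\<^sup>2)"
  define F where "F = integral {a..b} (\<lambda>x. (f' x)\<^sup>2)"
  define N where "N = (real n)^4 / (b - a)\<^sup>2"
  have N: "0 < N" using n ab by (auto simp: N_def)
  have cf: "continuous_on {a..b} f"
    using f by (meson DERIV_continuous continuous_on_eq_continuous_within)
  have ce: "continuous_on {a..b} e" unfolding e_def by (intro continuous_intros cf)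
  obtain c where c: "c \<in> {a..a+\<delta>}" "\<delta> * (e c)\<^sup>2 \<le> E"
    using exists_point_below_mean[of a a "a + \<delta>" b e] \<delta>0 \<delta>8 ab ce by (auto simp: E_def)
  obtain d where d: "d \<in> {b-\<delta>..b}" "\<delta> * (e d)\<^sup>2 \<le> E"
    using exists_point_below_mean[of a "b - \<delta>" b b e] \<delta>0 \<delta>8 ab ce by (auto simp: E_def)
  note mass = poly_mass_interior[OF ab coeffs_below_pderiv[OF q] n, of c d, folded A_def \<delta>_def]
  have cd: "c < d" "a \<le> c" "d \<le> b" using mass(1) c d by auto
  have A_le: "A \<le> 2 * integral {c..d} (\<lambda>x. (?q' x)\<^sup>2)" using mass(2) c d by auto
  have bdry: "\<bar>?q' x * e x\<bar> \<le> A / 16 + 64 * N * E"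
    if x: "x \<in> {c, d}" and ex: "\<delta> * (e x)\<^sup>2 \<le> E" for x
  proof -
    have qx: "(b - a) * (?q' x)\<^sup>2 \<le> 2 * (real n)\<^sup>2 * A"
      using mass(3)[of x] c d x cd by auto
    \<comment> \<open>This \<open>s\<close> makes the first term of Young's inequality at most
      \<open>A / 16\<close>; the price for the second is \<open>64 N E\<close>, since
      \<open>\<delta> (e x)^2\<close> is at most \<open>E\<close>.\<close>
    define s where "s = (b - a) / (32 * (real n)\<^sup>2)"
    have s0: "0 < s" unfolding s_def using ab n by (intro divide_pos_pos) auto
    have "\<bar>?q' x * e x\<bar> \<le> s * \<bar>?q' x\<bar>\<^sup>2 + \<bar>e x\<bar>\<^sup>2 / (4 * s)"
      unfolding abs_mult by (rule young_ineq[OF s0])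
    also have "\<dots> = s * (?q' x)\<^sup>2 + (e x)\<^sup>2 / (4 * s)" by simp
    also have "\<dots> \<le> A / 16 + 64 * N * E"
    proof (rule add_mono)
      have "s * (?q' x)\<^sup>2 = ((b - a) * (?q' x)\<^sup>2) / (32 * (real n)\<^sup>2)" by (simp add: s_def)
      also have "\<dots> \<le> (2 * (real n)\<^sup>2 * A) / (32 * (real n)\<^sup>2)"
        using qx by (intro divide_right_mono) auto
      also have "\<dots> = A / 16" using n by simp
      finally show "s * (?q' x)\<^sup>2 \<le> A / 16" .
      have "(e x)\<^sup>2 / (4 * s) = (\<delta> * (e x)\<^sup>2) * (64 * N)"
      proof -
        have *: "y / (4 * (L / (32 * m))) = (L / (8 * m) * y) * (64 * (m\<^sup>2 / L\<^sup>2))"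
          if "0 < L" "0 < m" for y L m :: real
          using that by (simp add: power2_eq_square)
        have "(real n)^4 = ((real n)\<^sup>2)\<^sup>2" by simp
        then show ?thesis using *[of "b - a" "(real n)\<^sup>2" "(e x)\<^sup>2"] ab n
          by (simp only: s_def \<delta>_def N_def) auto
      qed
      also have "\<dots> \<le> E * (64 * N)" using ex N by (intro mult_right_mono) auto
      finally show "(e x)\<^sup>2 / (4 * s) \<le> 64 * N * E" by (simp add: mult.commute)
    qed
    finally show ?thesis .
  qed
  have cdsub: "{c..d} \<subseteq> {a..b}" using cd by auto
  have f'cd: "continuous_on {c..d} f'" using f' cdsub continuous_on_subset by blast
  have ecd: "continuous_on {c..d} e" using ce cdsub continuous_on_subset by blast
  have E0: "integral {c..d} (\<lambda>x. (e x)\<^sup>2) \<le> E" unfolding E_def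
    using cdsub by (intro integral_subset_le integrable_continuous_real continuous_intros ecd ce) auto
  have F0: "integral {c..d} (\<lambda>x. (f' x)\<^sup>2) \<le> F" unfolding F_def
    using cdsub by (intro integral_subset_le integrable_continuous_real continuous_intros f'cd f') auto
  have A0: "integral {c..d} (\<lambda>x. (?q' x)\<^sup>2) \<le> A" unfolding A_def
    using cdsub by (intro integral_subset_le integrable_continuous_real continuous_intros) auto
  have A20: "integral {c..d} (\<lambda>x. (?q'' x)\<^sup>2) \<le> A2" unfolding A2_def
    using cdsub by (intro integral_subset_le integrable_continuous_real continuous_intros) auto
  have A2_le: "A2 \<le> 32 * N * A"
    using poly_markov_L2[OF ab coeffs_below_pderiv[OF q] n] ab
    unfolding A2_def A_def N_def by (simp add: field_simps)
  have e': "(e has_real_derivative (?q' x - f' x)) (at x within {c..d})" if "x \<in> {c..d}" for x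
  proof -
    have "(f has_real_derivative f' x) (at x within {c..d})"
      using f[of x] that cdsub by (auto intro: DERIV_subset)
    then show ?thesis unfolding e_def by (auto intro!: derivative_eq_intros poly_DERIV)
  qed
  have ftc: "((\<lambda>x. ?q'' x * e x + ?q' x * (?q' x - f' x)) has_integral (?q' d * e d - ?q' c * e c)) {c..d}"
  proof (rule fundamental_theorem_of_calculus)
    show "c \<le> d" using cd by simp
    show "((\<lambda>x. ?q' x * e x) has_vector_derivative ?q'' x * e x + ?q' x * (?q' x - f' x))
        (at x within {c..d})" if "x \<in> {c..d}" for x
      unfolding has_real_derivative_iff_has_vector_derivative[symmetric]
      by (rule derivative_eq_intros e'[OF that] DERIV_subset[OF poly_DERIV[of "pderiv q"]] subset_UNIV)+ simp
  qed
  \<comment> \<open>Chosen such that Markov's inequality bounds \<open>s\<close> times the square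
    integral of \<open>q''\<close> by \<open>A / 16\<close>.\<close>
  define s where "s = 1 / (512 * N)"
  have s0: "0 < s" using N by (simp add: s_def)
  have int1: "(\<lambda>x. ?q'' x * e x + ?q' x * (?q' x - f' x)) integrable_on {c..d}"
    using ftc by blast
  have cont: "continuous_on {c..d} (\<lambda>x. s * (?q'' x)\<^sup>2 + (e x)\<^sup>2 / (4 * s) + ((?q' x)\<^sup>2 / 16 + 4 * (f' x)\<^sup>2))"
    using s0 by (intro continuous_intros ecd f'cd) auto
  have "integral {c..d} (\<lambda>x. (?q' x)\<^sup>2) = integral {c..d} (\<lambda>x.
      (?q'' x * e x + ?q' x * (?q' x - f' x)) + (?q' x * f' x - ?q'' x * e x))"
    by (rule integral_cong) (simp add: power2_eq_square algebra_simps)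
  also have "\<dots> = (?q' d * e d - ?q' c * e c) + integral {c..d} (\<lambda>x. ?q' x * f' x - ?q'' x * e x)"
    using ftc by (subst integral_add)
      (auto intro!: integrable_continuous_real continuous_intros ecd f'cd simp: integral_unique)
  also have "integral {c..d} (\<lambda>x. ?q' x * f' x - ?q'' x * e x) \<le> integral {c..d}
      (\<lambda>x. s * (?q'' x)\<^sup>2 + (e x)\<^sup>2 / (4 * s) + ((?q' x)\<^sup>2 / 16 + 4 * (f' x)\<^sup>2))"
  proof (intro integral_le integrable_continuous_real cont)
    show "continuous_on {c..d} (\<lambda>x. ?q' x * f' x - ?q'' x * e x)"
      by (intro continuous_intros ecd f'cd)
    fix x
    have "?q' x * f' x \<le> (?q' x)\<^sup>2 / 16 + 4 * (f' x)\<^sup>2"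
      using young_ineq[of "1/16" "?q' x" "f' x"] by simp
    moreover have "- (?q'' x * e x) \<le> s * (?q'' x)\<^sup>2 + (e x)\<^sup>2 / (4 * s)"
      using young_ineq[OF s0, of "?q'' x" "- e x"] by simp
    ultimately show "?q' x * f' x - ?q'' x * e x
        \<le> s * (?q'' x)\<^sup>2 + (e x)\<^sup>2 / (4 * s) + ((?q' x)\<^sup>2 / 16 + 4 * (f' x)\<^sup>2)" by linarith
  qed
  also have "\<dots> = s * integral {c..d} (\<lambda>x. (?q'' x)\<^sup>2) + integral {c..d} (\<lambda>x. (e x)\<^sup>2) / (4 * s)
      + (integral {c..d} (\<lambda>x. (?q' x)\<^sup>2) / 16 + 4 * integral {c..d} (\<lambda>x. (f' x)\<^sup>2))"
  proof -
    have ig: "(\<lambda>x. (?q'' x)\<^sup>2) integrable_on {c..d}" "(\<lambda>x. (e x)\<^sup>2) integrable_on {c..d}"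
      "(\<lambda>x. (?q' x)\<^sup>2) integrable_on {c..d}" "(\<lambda>x. (f' x)\<^sup>2) integrable_on {c..d}"
      by (intro integrable_continuous_real continuous_intros ecd f'cd)+
    show ?thesis
      by (intro integral_unique has_integral_add has_integral_mult_right has_integral_divide
          integrable_integral ig)
  qed
  also have "\<dots> \<le> s * (32 * N * A) + E / (4 * s) + (A / 16 + 4 * F)"
    using A20 A2_le E0 A0 F0 s0
    by (intro add_mono mult_left_mono divide_right_mono) auto
  also have "s * (32 * N * A) = A / 16" using N by (simp add: s_def)
  also have "E / (4 * s) = 128 * N * E" by (simp add: s_def)
  finally have "integral {c..d} (\<lambda>x. (?q' x)\<^sup>2)
      \<le> (?q' d * e d - ?q' c * e c) + (A / 16 + 128 * N * E + (A / 16 + 4 * F))"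
    by simp
  \<comment> \<open>Four terms \<open>A / 16\<close>, two of them from the endpoints, add up to
    \<open>A / 4\<close>. The factor 2 from \<open>A_le\<close> makes this \<open>A / 2\<close>,
    which the left-hand side absorbs.\<close>
  then have "A \<le> 2 * (A / 4 + 4 * F + 256 * N * E)"
    using A_le bdry[of c] bdry[of d] c d by auto
  then have "A \<le> 16 * F + 1024 * N * E" by simp
  then show ?thesis by (simp only: A_def F_def E_def N_def e_def)
qed

section \<open>Smooth bump functions\<close>

text \<open>The functions \<open>P(1/x) exp(-1/x)\<close>, extended by \<open>0\<close> to \<open>x \<le> 0\<close>, are closed under differentiation.\<close>

definition flat :: "real poly \<Rightarrow> real \<Rightarrow> real" where
  "flat P x = (if 0 < x then poly P (1 / x) * exp (- (1 / x)) else 0)"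

text \<open>With \<open>y = 1 / x\<close> one has \<open>y' = - y^2\<close>, so
  \<open>P(y) exp(-y)\<close> differentiates to \<open>y^2 (P - P')(y) exp(-y)\<close>.\<close>

definition flat_deriv :: "real poly \<Rightarrow> real poly" where
  "flat_deriv P = [:0, 0, 1:] * (P - pderiv P)"

lemma poly_times_exp_tendsto_0: "((\<lambda>y. poly P y * exp (- y)) \<longlongrightarrow> (0::real)) at_top"
proof -
  have "((\<lambda>y. \<Sum>i\<le>degree P. coeff P i * (y ^ i / exp y)) \<longlongrightarrow> (0::real)) at_top"
    by (intro tendsto_null_sum tendsto_mult_right_zero tendsto_power_div_exp_0)
  then show ?thesis
    by (simp add: poly_altdef sum_distrib_right exp_minus divide_inverse mult.assoc)
qed

text \<open>Only the point 0 needs an argument: with \<open>y = 1 / h\<close> the right difference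
  quotient is \<open>y P(y) exp(-y)\<close>, which tends to 0. The extra factor \<open>y\<close> is
  absorbed in the polynomial \<open>pCons 0 P\<close>.\<close>

lemma flat_has_derivative:
  "(flat P has_real_derivative flat (flat_deriv P) x) (at x)"
proof -
  consider "0 < x" | "x < 0" | "x = 0" by linarith
  then show ?thesis
  proof cases
    case 1
    have "((\<lambda>x. poly P (1 / x) * exp (- (1 / x))) has_real_derivative flat (flat_deriv P) x) (at x)"
      using 1 unfolding flat_def flat_deriv_def
      by (auto intro!: derivative_eq_intros DERIV_chain2[OF poly_DERIV]
          simp: power2_eq_square field_simps)
    then show ?thesis
      by (rule has_field_derivative_transform_within_open[where S = "{0<..}"])
         (use 1 in \<open>auto simp: flat_def\<close>)
  next
    case 2
    have "((\<lambda>x. 0) has_real_derivative flat (flat_deriv P) x) (at x)"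
      using 2 by (simp add: flat_def)
    then show ?thesis
      by (rule has_field_derivative_transform_within_open[where S = "{..<0}"])
         (use 2 in \<open>auto simp: flat_def\<close>)
  next
    case 3
    have r: "((\<lambda>h. flat P h / h) \<longlongrightarrow> 0) (at_right 0)"
    proof -
      have "((\<lambda>h. poly (pCons 0 P) (inverse h) * exp (- inverse h)) \<longlongrightarrow> 0) (at_right (0::real))"
        by (rule filterlim_compose[OF poly_times_exp_tendsto_0 filterlim_inverse_at_top_right])
      then show ?thesis
      proof (rule Lim_transform_eventually)
        show "\<forall>\<^sub>F h in at_right 0. poly (pCons 0 P) (inverse h) * exp (- inverse h) = flat P h / h"
          by (auto simp: eventually_at_filter flat_def divide_inverse ac_simps)
      qed
    qed
    have l: "((\<lambda>h. flat P h / h) \<longlongrightarrow> 0) (at_left 0)"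
      by (rule tendsto_eventually) (auto simp: eventually_at_filter flat_def)
    have "((\<lambda>h. flat P h / h) \<longlongrightarrow> 0) (at 0)"
      using l r by (simp add: filterlim_at_split)
    then show ?thesis using 3 by (simp add: has_field_derivative_iff flat_def)
  qed
qed

lemma flat_1: "flat 1 x = (if 0 < x then exp (- (1 / x)) else 0)"
  by (simp add: flat_def)

lemma flat_1_bounds: "0 \<le> flat 1 x" "flat 1 x \<le> 1"
  by (auto simp: flat_1)

text \<open>One factor per side of the box. The four polynomials are kept separate because
  differentiation changes one factor at a time; up to linear combinations the family is then closed
  under partial derivatives. \<open>n\<close> controls the steepness: with all polynomials equal to
  1, the functions tend to the indicator of the open box.\<close>

definition bump :: "real poly \<Rightarrow> real poly \<Rightarrow> real poly \<Rightarrow> real poly \<Rightarrow> real \<Rightarrow> real^2 \<Rightarrow> real^2 \<Rightarrow> real^2 \<Rightarrow> real" where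
  "bump P Q R S n a b x = flat P (n * (x $ 1 - a $ 1)) * flat Q (n * (b $ 1 - x $ 1)) *
     (flat R (n * (x $ 2 - a $ 2)) * flat S (n * (b $ 2 - x $ 2)))"

lemma bump_has_derivative:
  "(bump P Q R S n a b has_derivative (\<lambda>v. (vector
     [n * bump (flat_deriv P) Q R S n a b x + (- n) * bump P (flat_deriv Q) R S n a b x,
      n * bump P Q (flat_deriv R) S n a b x + (- n) * bump P Q R (flat_deriv S) n a b x] :: real^2) \<bullet> v)) (at x)"
proof -
  have f: "((\<lambda>x. flat P (n * (x $ i - c))) has_derivative (\<lambda>v. flat (flat_deriv P) (n * (x $ i - c)) * (n * v $ i))) (at x)"
    "((\<lambda>x. flat P (n * (c - x $ i))) has_derivative (\<lambda>v. flat (flat_deriv P) (n * (c - x $ i)) * (- n * v $ i))) (at x)"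
    for P i c and x :: "real^2"
  proof -
    have nth: "((\<lambda>x::real^2. x $ i) has_derivative (\<lambda>v. v $ i)) (at x)"
      by (rule bounded_linear.has_derivative[OF bounded_linear_vec_nth has_derivative_ident])
    have 1: "((\<lambda>x::real^2. n * (x $ i - c)) has_derivative (\<lambda>v. n * v $ i)) (at x)"
      by (auto intro!: derivative_eq_intros nth)
    have 2: "((\<lambda>x::real^2. n * (c - x $ i)) has_derivative (\<lambda>v. - n * v $ i)) (at x)"
      by (auto intro!: derivative_eq_intros nth)
    note d = flat_has_derivative[of P, unfolded has_field_derivative_def]
    show "((\<lambda>x. flat P (n * (x $ i - c))) has_derivative (\<lambda>v. flat (flat_deriv P) (n * (x $ i - c)) * (n * v $ i))) (at x)"
      using has_derivative_compose[OF 1 d] by simp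
    show "((\<lambda>x. flat P (n * (c - x $ i))) has_derivative (\<lambda>v. flat (flat_deriv P) (n * (c - x $ i)) * (- n * v $ i))) (at x)"
      using has_derivative_compose[OF 2 d] by simp
  qed
  show ?thesis
    unfolding bump_def[abs_def]
    by (rule has_derivative_eq_rhs, (rule has_derivative_mult f)+)
       (auto simp: inner_vec_def sum_2 algebra_simps)
qed

lemma continuous_bump: "continuous_on X (bump P Q R S n a b)"
  by (intro continuous_at_imp_continuous_on ballI has_derivative_continuous[OF bump_has_derivative])

text \<open>Partial derivatives of a bump are differences of bumps, so the induction for bumps needs
  closure under linear combinations.\<close>

lemma C_k_lincomb: "C_k k f \<Longrightarrow> C_k k g \<Longrightarrow> C_k k (\<lambda>x. c * f x + d * g x)"
proof (induction k arbitrary: f g)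
  case 0
  then show ?case by (auto intro!: continuous_intros)
next
  case (Suc k)
  from Suc.prems obtain f' where f: "\<And>x. (f has_derivative (\<lambda>v. f' x \<bullet> v)) (at x)"
    "\<And>i. C_k k (\<lambda>x. f' x $ i)" by auto
  from Suc.prems obtain g' where g: "\<And>x. (g has_derivative (\<lambda>v. g' x \<bullet> v)) (at x)"
    "\<And>i. C_k k (\<lambda>x. g' x $ i)" by auto
  have "((\<lambda>x. c * f x + d * g x) has_derivative (\<lambda>v. (c *\<^sub>R f' x + d *\<^sub>R g' x) \<bullet> v)) (at x)" for x
    by (auto intro!: derivative_eq_intros f g simp: inner_add_left)
  moreover have "C_k k (\<lambda>x. (c *\<^sub>R f' x + d *\<^sub>R g' x) $ i)" for i
    using Suc.IH[OF f(2) g(2)] by simp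
  ultimately show ?case by (auto intro!: exI[of _ "\<lambda>x. c *\<^sub>R f' x + d *\<^sub>R g' x"])
qed

lemma C_k_bump: "C_k k (bump P Q R S n a b)"
proof (induction k arbitrary: P Q R S)
  case 0
  then show ?case by (simp add: continuous_bump)
next
  case (Suc k)
  let ?g = "\<lambda>x. (vector
     [n * bump (flat_deriv P) Q R S n a b x + (- n) * bump P (flat_deriv Q) R S n a b x,
      n * bump P Q (flat_deriv R) S n a b x + (- n) * bump P Q R (flat_deriv S) n a b x] :: real^2)"
  have "C_k k (\<lambda>x. ?g x $ i)" for i
  proof -
    have "i = 1 \<or> i = 2" by (rule exhaust_2)
    moreover have "C_k k (\<lambda>x. n * bump P Q R S n a b x - n * bump P' Q' R' S' n a b x)"
      for P Q R S P' Q' R' S'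
      using C_k_lincomb[OF Suc.IH Suc.IH, of n P Q R S "- n" P' Q' R' S'] by simp
    ultimately show ?thesis by auto
  qed
  then show ?case using bump_has_derivative by (auto intro!: exI[of _ ?g])
qed

lemma bump_support:
  assumes "0 < n" shows "bump P Q R S n a b x \<noteq> 0 \<Longrightarrow> x \<in> box a b"
  using assms by (auto simp: bump_def flat_def mem_box_cart forall_2 zero_less_mult_iff split: if_splits)

lemma test_function_bump:
  assumes "0 < n" "cbox a b \<subseteq> \<Omega>"
  shows "test_function \<Omega> (\<lambda>x. c * bump P Q R S n a b x)"
proof -
  have "C_k k (\<lambda>x. c * bump P Q R S n a b x)" for k
    using C_k_lincomb[OF C_k_bump C_k_bump, of k c P Q R S n a b 0 P Q R S n a b] by simp
  moreover have sub: "closure {x. c * bump P Q R S n a b x \<noteq> 0} \<subseteq> cbox a b"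
  proof (intro closure_minimal closed_cbox subsetI)
    fix x assume "x \<in> {x. c * bump P Q R S n a b x \<noteq> 0}"
    then show "x \<in> cbox a b" using bump_support[OF assms(1)] box_subset_cbox by fastforce
  qed
  moreover have "compact (closure {x. c * bump P Q R S n a b x \<noteq> 0})"
    using sub bounded_cbox bounded_subset closed_closure compact_eq_bounded_closed by blast
  ultimately show ?thesis using assms(2) unfolding test_function_def by blast
qed

lemma bump_1_bounds: "0 \<le> bump 1 1 1 1 n a b x" "bump 1 1 1 1 n a b x \<le> 1"
  unfolding bump_def by (auto intro!: mult_nonneg_nonneg mult_le_one flat_1_bounds)

text \<open>Inside the open box all four arguments tend to infinity; outside, some factor is 0 for
  every \<open>n\<close>. Weak identities can thereby be tested on boxes.\<close>

lemma bump_1_tendsto_indicator: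
  "(\<lambda>n. bump 1 1 1 1 (real n) a b x) \<longlonglongrightarrow> indicator (box a b) x"
proof -
  have pos: "(\<lambda>n. flat 1 (real n * s)) \<longlonglongrightarrow> 1" if "0 < s" for s
  proof -
    have "(\<lambda>n. exp (- (1 / (real n * s)))) \<longlonglongrightarrow> exp (- 0)"
    proof (intro tendsto_intros)
      have "(\<lambda>n. (1 / real n) * (1 / s)) \<longlonglongrightarrow> 0 * (1 / s)"
        by (intro tendsto_mult lim_1_over_n tendsto_const)
      then show "(\<lambda>n. 1 / (real n * s)) \<longlonglongrightarrow> 0" by (simp add: field_simps)
    qed
    moreover have "\<forall>\<^sub>F n in sequentially. exp (- (1 / (real n * s))) = flat 1 (real n * s)"
      using eventually_gt_at_top[of 0] by eventually_elim (use that in \<open>auto simp: flat_1\<close>)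
    ultimately show ?thesis using Lim_transform_eventually by fastforce
  qed
  have neg: "flat 1 (real n * s) = 0" if "s \<le> 0" for s n
    using that by (auto simp: flat_1 zero_less_mult_iff)
  show ?thesis
  proof (cases "x \<in> box a b")
    case True
    then have p: "0 < x $ i - a $ i" "0 < b $ i - x $ i" for i by (auto simp: mem_box_cart)
    have "(\<lambda>n. bump 1 1 1 1 (real n) a b x) \<longlonglongrightarrow> 1 * 1 * (1 * 1)"
      unfolding bump_def by (intro tendsto_mult pos p)
    then show ?thesis using True by simp
  next
    case False
    have "bump 1 1 1 1 (real n) a b x = 0" for n
      using False by (auto simp: bump_def mem_box_cart forall_2 not_less neg)
    then show ?thesis using False by simp
  qed
qed

lemma bump_translate: "bump P Q R S n (a + x) (b + x) y = bump P Q R S n a b (y - x)"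
  by (simp add: bump_def algebra_simps)

section \<open>Mollification\<close>

lemma integrable_mult_bounded_lborel:
  fixes v w :: "'a::euclidean_space \<Rightarrow> real"
  assumes "integrable lborel v" "w \<in> borel_measurable borel" "\<And>x. \<bar>w x\<bar> \<le> B"
  shows "integrable lborel (\<lambda>x. v x * w x)"
proof (rule Bochner_Integration.integrable_bound[where f = "\<lambda>x. B * v x"])
  show "integrable lborel (\<lambda>x. B * v x)" using assms by simp
  show "(\<lambda>x. v x * w x) \<in> borel_measurable lborel" using assms by simp
  have "\<bar>v x * w x\<bar> \<le> \<bar>B * v x\<bar>" for x
  proof -
    have "\<bar>v x\<bar> * \<bar>w x\<bar> \<le> \<bar>v x\<bar> * \<bar>B\<bar>"
      using assms(3)[of x] by (intro mult_left_mono) auto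
    then show ?thesis by (simp add: abs_mult mult.commute)
  qed
  then show "AE x in lborel. norm (v x * w x) \<le> norm (B * v x)" by simp
qed

text \<open>On the ball of radius \<open>R + 1\<close> compactness suffices. If one of two points at
  distance below 1 lies outside that ball, both have norm above \<open>R\<close> and
  \<open>f\<close> is zero at both.\<close>

lemma uniformly_continuous_compact_support:
  fixes f :: "'a::euclidean_space \<Rightarrow> 'b::real_normed_vector"
  assumes f: "continuous_on UNIV f" and supp: "\<And>x. f x \<noteq> 0 \<Longrightarrow> norm x \<le> R" and \<eta>: "0 < \<eta>"
  shows "\<exists>d>0. \<forall>x y. norm (x - y) < d \<longrightarrow> norm (f x - f y) \<le> \<eta>"
proof -
  have "uniformly_continuous_on (cball 0 (R + 1)) f"
    using f by (intro compact_uniformly_continuous) (auto intro: continuous_on_subset)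
  then obtain d where d: "0 < d" "\<And>x y. x \<in> cball 0 (R + 1) \<Longrightarrow> y \<in> cball 0 (R + 1) \<Longrightarrow>
      dist y x < d \<Longrightarrow> dist (f y) (f x) < \<eta>"
    using \<eta> unfolding uniformly_continuous_on_def by metis
  have "norm (f x - f y) \<le> \<eta>" if "norm (x - y) < min d 1" for x y
  proof (cases "x \<in> cball 0 (R + 1) \<and> y \<in> cball 0 (R + 1)")
    case True
    then show ?thesis using d(2)[of y x] that by (auto simp: dist_norm less_imp_le)
  next
    case False
    have "norm x \<le> norm y + 1" "norm y \<le> norm x + 1"
      using that norm_triangle_sub[of x y] norm_triangle_sub[of y x]
      by (auto simp: norm_minus_commute)
    then have "\<not> norm x \<le> R" "\<not> norm y \<le> R" using False by auto
    then have "f x = 0" "f y = 0" using supp by blast+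
    then show ?thesis using \<eta> by simp
  qed
  then show ?thesis using d(1) by (intro exI[of _ "min d 1"]) auto
qed

text \<open>The gradient \<open>r\<close> belongs to the data because weak gradients are tested with
  explicit gradients. Evenness makes \<open>\<rho> (y - x)\<close> a density in either variable, and
  the last clause turns translates into test functions.\<close>

definition mollifier :: "real \<Rightarrow> (real^2 \<Rightarrow> real) \<Rightarrow> (real^2 \<Rightarrow> real^2) \<Rightarrow> bool" where
  "mollifier \<epsilon> \<rho> r \<longleftrightarrow> (\<forall>z. 0 \<le> \<rho> z) \<and> (\<forall>z. \<rho> z \<noteq> 0 \<longrightarrow> norm z < \<epsilon>) \<and> (\<forall>z. r z \<noteq> 0 \<longrightarrow> norm z < \<epsilon>) \<and>
     (\<forall>z. (\<rho> has_derivative (\<lambda>v. r z \<bullet> v)) (at z)) \<and> continuous_on UNIV r \<and>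
     (\<forall>z. \<rho> (- z) = \<rho> z) \<and> (\<integral>z. \<rho> z \<partial>lborel) = 1 \<and>
     (\<forall>x \<Omega>. cball x \<epsilon> \<subseteq> \<Omega> \<longrightarrow> test_function \<Omega> (\<lambda>y. \<rho> (y - x)))"

lemma mollifier_exists:
  assumes "0 < \<epsilon>"
  shows "\<exists>\<rho> r. mollifier \<epsilon> \<rho> r"
proof -
  \<comment> \<open>With half side \<open>\<epsilon> / 2\<close> the sum of the absolute values of
    the two coordinates, and with it the Euclidean norm, stays below
    \<open>\<epsilon>\<close>.\<close>
  define e where "e = (\<chi> i. \<epsilon> / 2 :: real^2)"
  have e: "e $ i = \<epsilon> / 2" for i by (simp add: e_def)
  let ?b = "bump 1 1 1 1 1 (- e) e"
  have small: "norm z < \<epsilon>" if "z \<in> box (- e) e" for z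
  proof -
    have *: "\<bar>z $ i\<bar> < \<epsilon> / 2" for i
    proof -
      have "- (\<epsilon> / 2) < z $ i" "z $ i < \<epsilon> / 2"
        using that[unfolded mem_box_cart, rule_format, of i] by (auto simp: e)
      then show ?thesis by linarith
    qed
    have "norm z \<le> (\<Sum>i\<in>UNIV. \<bar>z $ i\<bar>)" by (rule norm_le_l1_cart)
    also have "\<dots> = \<bar>z $ 1\<bar> + \<bar>z $ 2\<bar>" by (simp add: sum_2)
    also have "\<dots> < \<epsilon>" using *[of 1] *[of 2] by linarith
    finally show ?thesis .
  qed
  have bmeas: "?b \<in> borel_measurable borel"
    using borel_measurable_continuous_onI[OF continuous_bump] .
  have bint: "integrable lborel ?b"
  proof (rule Bochner_Integration.integrable_bound[where f = "indicator (cbox (- e) e) :: real^2 \<Rightarrow> real"])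
    show "integrable lborel (indicator (cbox (- e) e) :: real^2 \<Rightarrow> real)"
      using emeasure_lborel_cbox_finite[of "- e" e] by (simp add: integrable_indicator_iff)
    show "?b \<in> borel_measurable lborel" using bmeas by simp
    have "norm (?b x) \<le> norm (indicator (cbox (- e) e) x :: real)" for x
      using bump_support[of 1 1 1 1 1 "- e" e x] bump_1_bounds[of 1 "- e" e x] box_subset_cbox[of "- e" e]
      by (auto simp: indicator_def)
    then show "AE x in lborel. norm (?b x) \<le> norm (indicator (cbox (- e) e) x :: real)" by simp
  qed
  define c where "c = (\<integral>z. ?b z \<partial>lborel)"
  have c: "0 < c"
  proof -
    have "0 \<le> c" unfolding c_def by (intro integral_nonneg_AE) (simp add: bump_1_bounds)
    \<comment> \<open>The bump is nonzero on a nonempty open set, which is not negligible.\<close>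
    moreover have "c \<noteq> 0"
    proof
      assume "c = 0"
      then have "AE z in lborel. ?b z = 0"
        using integral_nonneg_eq_0_iff_AE[OF bint] bump_1_bounds by (auto simp: c_def)
      then have "{z. ?b z \<noteq> 0} \<in> null_sets lborel"
        using bmeas by (subst (asm) AE_iff_null) (auto intro!: borel_measurable_const)
      then have "negligible {z. ?b z \<noteq> 0}"
        by (simp add: negligible_iff_null_sets null_sets_completionI)
      moreover have "open {z. ?b z \<noteq> 0}"
        using continuous_bump by (intro open_Collect_neq) auto
      ultimately have "{z. ?b z \<noteq> 0} = {}" using open_not_negligible by blast
      moreover have "?b 0 \<noteq> 0" using assms by (simp add: bump_def flat_1 e)
      ultimately show False by blast
    qed
    ultimately show ?thesis by linarith
  qed
  define \<rho> where "\<rho> = (\<lambda>z. (1 / c) * ?b z)"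
  define r :: "real^2 \<Rightarrow> real^2" where "r = (\<lambda>z. (1 / c) *\<^sub>R vector
     [1 * bump (flat_deriv 1) 1 1 1 1 (- e) e z + (- 1) * bump 1 (flat_deriv 1) 1 1 1 (- e) e z,
      1 * bump 1 1 (flat_deriv 1) 1 1 (- e) e z + (- 1) * bump 1 1 1 (flat_deriv 1) 1 (- e) e z])"
  have "norm z < \<epsilon>" if "r z \<noteq> 0" for z
  proof -
    have "z \<in> box (- e) e"
    proof (rule ccontr)
      assume "z \<notin> box (- e) e"
      then have "bump P Q R S 1 (- e) e z = 0" for P Q R S
        by (metis bump_support zero_less_one)
      then have "r z = 0" by (simp add: r_def vec_eq_iff forall_2)
      with that show False by simp
    qed
    then show ?thesis by (rule small)
  qed
  moreover have "norm z < \<epsilon>" if "\<rho> z \<noteq> 0" for z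
    using that small bump_support[of 1 1 1 1 1 "- e" e z] by (simp add: \<rho>_def)
  moreover have "(\<rho> has_derivative (\<lambda>v. r z \<bullet> v)) (at z)" for z
    unfolding \<rho>_def r_def inner_scaleR_left
    by (rule has_derivative_mult_right[OF bump_has_derivative])
  moreover have "continuous_on UNIV r"
  proof -
    have "continuous_on UNIV (\<lambda>z. r z $ i)" for i
    proof -
      have "continuous_on UNIV (\<lambda>z. r z $ 1)" "continuous_on UNIV (\<lambda>z. r z $ 2)"
        unfolding r_def vector_scaleR_component vector_2 using c
        by (auto intro!: continuous_intros continuous_bump)
      moreover have "i = 1 \<or> i = 2" by (rule exhaust_2)
      ultimately show ?thesis by auto
    qed
    then have "continuous_on UNIV (\<lambda>z. \<chi> i. r z $ i)" by (rule continuous_on_vec_lambda)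
    then show ?thesis by simp
  qed
  moreover have "\<rho> (- z) = \<rho> z" for z
    unfolding \<rho>_def bump_def by (simp add: algebra_simps)
  moreover have "(\<integral>z. \<rho> z \<partial>lborel) = 1"
    unfolding \<rho>_def using c by (simp add: c_def)
  moreover have "0 \<le> \<rho> z" for z unfolding \<rho>_def using c bump_1_bounds by simp
  moreover have "test_function \<Omega> (\<lambda>y. \<rho> (y - x))" if sub: "cball x \<epsilon> \<subseteq> \<Omega>" for x \<Omega>
  proof -
    have "cbox (- e + x) (e + x) \<subseteq> cball x \<epsilon>"
    proof
      fix z assume z: "z \<in> cbox (- e + x) (e + x)"
      have *: "\<bar>(x - z) $ i\<bar> \<le> \<epsilon> / 2" for i
      proof -
        have "- (\<epsilon> / 2) + x $ i \<le> z $ i" "z $ i \<le> \<epsilon> / 2 + x $ i"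
          using z[unfolded mem_box_cart, rule_format, of i] by (auto simp: e)
        then have "\<bar>x $ i - z $ i\<bar> \<le> \<epsilon> / 2" by linarith
        then show ?thesis by (simp only: vector_minus_component)
      qed
      have "norm (x - z) \<le> (\<Sum>i\<in>UNIV. \<bar>(x - z) $ i\<bar>)" by (rule norm_le_l1_cart)
      also have "\<dots> = \<bar>(x - z) $ 1\<bar> + \<bar>(x - z) $ 2\<bar>" by (simp only: sum_2)
      also have "\<dots> \<le> \<epsilon>" using *[of 1] *[of 2] by linarith
      finally show "z \<in> cball x \<epsilon>" by (simp add: dist_norm)
    qed
    then have "test_function \<Omega> (\<lambda>y. (1 / c) * bump 1 1 1 1 1 (- e + x) (e + x) y)"
      using sub by (intro test_function_bump) auto
    then show ?thesis by (simp only: \<rho>_def bump_translate)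
  qed
  ultimately have "mollifier \<epsilon> \<rho> r" unfolding mollifier_def by blast
  then show ?thesis by blast
qed

section \<open>Differentiability and L^2 bounds of mollified functions\<close>

context
  fixes \<epsilon> \<rho> r assumes moll: "mollifier \<epsilon> \<rho> r"
begin

lemma mollifier_nonneg: "0 \<le> \<rho> z"
  and mollifier_support: "\<rho> z \<noteq> 0 \<Longrightarrow> norm z < \<epsilon>"
  and mollifier_deriv_support: "r z \<noteq> 0 \<Longrightarrow> norm z < \<epsilon>"
  and mollifier_has_derivative: "(\<rho> has_derivative (\<lambda>v. r z \<bullet> v)) (at z)"
  and mollifier_deriv_continuous: "continuous_on UNIV r"
  and mollifier_even: "\<rho> (- z) = \<rho> z"
  and mollifier_integral: "(\<integral>z. \<rho> z \<partial>lborel) = 1"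
  and mollifier_test_function: "cball x \<epsilon> \<subseteq> \<Omega> \<Longrightarrow> test_function \<Omega> (\<lambda>y. \<rho> (y - x))"
  using moll by (auto simp: mollifier_def)

lemma mollifier_continuous: "continuous_on UNIV \<rho>"
  by (intro continuous_at_imp_continuous_on ballI has_derivative_continuous[OF mollifier_has_derivative])

lemma mollifier_measurable [measurable]: "\<rho> \<in> borel_measurable borel" "r \<in> borel_measurable borel"
  using mollifier_continuous mollifier_deriv_continuous by (auto intro: borel_measurable_continuous_onI)

lemma mollifier_bounded: "\<exists>B. \<forall>z. \<bar>\<rho> z\<bar> \<le> B" "\<exists>B. \<forall>z. norm (r z) \<le> B"
proof -
  have *: "\<exists>B. \<forall>z. norm (f z) \<le> B" if f: "continuous_on UNIV f" "\<And>z. f z \<noteq> 0 \<Longrightarrow> norm z < \<epsilon>"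
    for f :: "real^2 \<Rightarrow> 'b::real_normed_vector"
  proof -
    have "compact (f ` cball 0 \<epsilon>)"
      using f by (intro compact_continuous_image) (auto intro: continuous_on_subset)
    then obtain B where B: "\<And>z. z \<in> cball 0 \<epsilon> \<Longrightarrow> norm (f z) \<le> B"
      using compact_imp_bounded bounded_iff by (metis imageI)
    have "norm (f z) \<le> max B 0" for z
      using B[of z] f(2)[of z] by (cases "f z = 0") auto
    then show ?thesis by blast
  qed
  show "\<exists>B. \<forall>z. \<bar>\<rho> z\<bar> \<le> B" using *[OF mollifier_continuous mollifier_support] by simp
  show "\<exists>B. \<forall>z. norm (r z) \<le> B" using *[OF mollifier_deriv_continuous mollifier_deriv_support] by simp
qed

lemma integrable_mult_mollifier:
  assumes "integrable lborel v"
  shows "integrable lborel (\<lambda>y. v y * \<rho> (y - x))"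
proof -
  obtain B where "\<And>z. \<bar>\<rho> z\<bar> \<le> B" using mollifier_bounded by blast
  then show ?thesis by (intro integrable_mult_bounded_lborel[OF assms]) auto
qed

lemma integrable_scaleR_mollifier_deriv:
  assumes "integrable lborel v"
  shows "integrable lborel (\<lambda>y. v y *\<^sub>R r (y - x))"
proof -
  obtain B where B: "\<And>z. norm (r z) \<le> B" using mollifier_bounded by blast
  show ?thesis
  proof (rule Bochner_Integration.integrable_bound[where f = "\<lambda>x. B * v x"])
    show "integrable lborel (\<lambda>x. B * v x)" using assms by simp
    show "(\<lambda>y. v y *\<^sub>R r (y - x)) \<in> borel_measurable lborel" using assms by simp
    have "norm (v y *\<^sub>R r (y - x)) \<le> norm (B * v y)" for y
    proof -
      have "norm (r (y - x)) \<le> \<bar>B\<bar>" using B[of "y - x"] by linarith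
      then have "\<bar>v y\<bar> * norm (r (y - x)) \<le> \<bar>v y\<bar> * \<bar>B\<bar>" by (intro mult_left_mono) auto
      then show ?thesis by (simp add: abs_mult mult.commute)
    qed
    then show "AE y in lborel. norm (v y *\<^sub>R r (y - x)) \<le> norm (B * v y)" by simp
  qed
qed

text \<open>Differentiation under the integral sign: uniform continuity of \<open>r\<close> bounds
  the linearization error of \<open>\<rho>\<close> by \<open>norm h * \<eta>\<close> uniformly in
  the base point, and this bound is integrated against the absolute value of \<open>v\<close>. The
  minus sign arises because \<open>x\<close> enters as \<open>y - x\<close>.\<close>

lemma mollified_has_derivative:
  assumes v: "integrable lborel v"
  shows "((\<lambda>x. \<integral>y. v y * \<rho> (y - x) \<partial>lborel) has_derivative
      (\<lambda>h. - (\<integral>y. v y *\<^sub>R r (y - x) \<partial>lborel) \<bullet> h)) (at x)"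
  unfolding has_derivative_at_alt
proof (intro conjI allI impI)
  show "bounded_linear (\<lambda>h. - (\<integral>y. v y *\<^sub>R r (y - x) \<partial>lborel) \<bullet> h)"
    by (rule bounded_linear_inner_right)
  fix e :: real assume e: "0 < e"
  define M where "M = (\<integral>y. \<bar>v y\<bar> \<partial>lborel)"
  have M: "0 \<le> M" unfolding M_def by simp
  \<comment> \<open>\<open>M + 1\<close> instead of \<open>M\<close> keeps the quotient meaningful
    when \<open>v\<close> vanishes almost everywhere.\<close>
  define \<eta> where "\<eta> = e / (M + 1)"
  have \<eta>: "0 < \<eta>" using e M by (simp add: \<eta>_def)
  obtain d where d: "0 < d" "\<And>z w. norm (z - w) < d \<Longrightarrow> norm (r z - r w) \<le> \<eta>"
    using uniformly_continuous_compact_support[OF mollifier_deriv_continuous _ \<eta>, of \<epsilon>]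
      mollifier_deriv_support by (meson less_imp_le)
  have lin: "\<bar>\<rho> (z - h) - \<rho> z - r z \<bullet> (- h)\<bar> \<le> norm h * \<eta>" if h: "norm h < d" for z h
  proof -
    have "norm (\<rho> (z - h) - \<rho> z - r z \<bullet> ((z - h) - z)) \<le> norm ((z - h) - z) * \<eta>"
    proof (rule differentiable_bound_linearization[where S = "ball z d" and f' = "\<lambda>x v. r x \<bullet> v"])
      fix t :: real assume "t \<in> {0..1}"
      then have "t * norm h \<le> 1 * norm h" by (intro mult_right_mono) auto
      then show "z + t *\<^sub>R (z - h - z) \<in> ball z d" using h \<open>t \<in> {0..1}\<close> by (simp add: dist_norm)
    next
      fix x assume "x \<in> ball z d"
      show "(\<rho> has_derivative (\<bullet>) (r x)) (at x within ball z d)"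
        using mollifier_has_derivative has_derivative_at_withinI by blast
    next
      fix x assume "x \<in> ball z d"
      then have "norm (r x - r z) \<le> \<eta>" by (intro d(2)) (simp add: dist_norm norm_minus_commute)
      then have "norm ((r x - r z) \<bullet> v) \<le> \<eta> * norm v" for v
        using Cauchy_Schwarz_ineq2[of "r x - r z" v]
        by (metis dual_order.trans mult_right_mono norm_ge_zero real_norm_def)
      then show "onorm ((\<bullet>) (r x) - (\<bullet>) (r z)) \<le> \<eta>"
        by (intro onorm_le) (simp add: inner_diff_left)
    qed (use d in auto)
    then show ?thesis by simp
  qed
  show "\<exists>d>0. \<forall>x'. norm (x' - x) < d \<longrightarrow>
      norm ((\<integral>y. v y * \<rho> (y - x') \<partial>lborel) - (\<integral>y. v y * \<rho> (y - x) \<partial>lborel) -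
        - (\<integral>y. v y *\<^sub>R r (y - x) \<partial>lborel) \<bullet> (x' - x)) \<le> e * norm (x' - x)"
  proof (intro exI[of _ d] conjI allI impI d(1))
    fix x' assume x': "norm (x' - x) < d"
    define h where "h = x' - x"
    have ir: "integrable lborel (\<lambda>y. (v y *\<^sub>R r (y - x)) \<bullet> h)"
      using integrable_scaleR_mollifier_deriv[OF v] by (rule integrable_inner_left)
    have "(\<integral>y. v y * \<rho> (y - x') \<partial>lborel) - (\<integral>y. v y * \<rho> (y - x) \<partial>lborel) -
        - (\<integral>y. v y *\<^sub>R r (y - x) \<partial>lborel) \<bullet> h
      = (\<integral>y. v y * \<rho> (y - x') - v y * \<rho> (y - x) + (v y *\<^sub>R r (y - x)) \<bullet> h \<partial>lborel)"
    proof -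
      have "(\<integral>y. v y *\<^sub>R r (y - x) \<partial>lborel) \<bullet> h = (\<integral>y. (v y *\<^sub>R r (y - x)) \<bullet> h \<partial>lborel)"
        using integrable_scaleR_mollifier_deriv[OF v] by (rule integral_inner_left[symmetric])
      then show ?thesis
        using ir integrable_mult_mollifier[OF v]
        by (simp del: integral_inner_left inner_scaleR_left)
    qed
    also have "\<dots> = (\<integral>y. v y * (\<rho> (y - x - h) - \<rho> (y - x) - r (y - x) \<bullet> (- h)) \<partial>lborel)"
      by (intro Bochner_Integration.integral_cong) (auto simp: h_def algebra_simps)
    finally have eq: "(\<integral>y. v y * \<rho> (y - x') \<partial>lborel) - (\<integral>y. v y * \<rho> (y - x) \<partial>lborel) -
        - (\<integral>y. v y *\<^sub>R r (y - x) \<partial>lborel) \<bullet> h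
      = (\<integral>y. v y * (\<rho> (y - x - h) - \<rho> (y - x) - r (y - x) \<bullet> (- h)) \<partial>lborel)" .
    have "norm \<dots> \<le> (\<integral>y. norm (v y * (\<rho> (y - x - h) - \<rho> (y - x) - r (y - x) \<bullet> (- h))) \<partial>lborel)"
      by (rule integral_norm_bound)
    also have "\<dots> \<le> (\<integral>y. \<bar>v y\<bar> * (norm h * \<eta>) \<partial>lborel)"
    proof (rule integral_mono')
      show "integrable lborel (\<lambda>y. \<bar>v y\<bar> * (norm h * \<eta>))" using v by simp
      show "norm (v y * (\<rho> (y - x - h) - \<rho> (y - x) - r (y - x) \<bullet> (- h))) \<le> \<bar>v y\<bar> * (norm h * \<eta>)" for y
        using lin[of h "y - x"] x' unfolding real_norm_def abs_mult h_def
        by (intro mult_left_mono) auto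
    qed (use \<eta> in auto)
    also have "\<dots> = M * \<eta> * norm h" by (simp add: M_def mult_ac)
    also have "\<dots> \<le> e * norm h"
    proof (rule mult_right_mono)
      have "M * e \<le> (M + 1) * e" using e by (intro mult_right_mono) auto
      then show "M * \<eta> \<le> e" unfolding \<eta>_def using M by (simp add: field_simps)
    qed simp
    finally show "norm ((\<integral>y. v y * \<rho> (y - x') \<partial>lborel) - (\<integral>y. v y * \<rho> (y - x) \<partial>lborel) -
        - (\<integral>y. v y *\<^sub>R r (y - x) \<partial>lborel) \<bullet> (x' - x)) \<le> e * norm (x' - x)"
      unfolding eq[unfolded h_def] h_def .
  qed
qed

lemma mollifier_nn_integral:
  "(\<integral>\<^sup>+ z. ennreal (\<rho> (z - x)) \<partial>lborel) = 1" "(\<integral>\<^sup>+ x. ennreal (\<rho> (z - x)) \<partial>lborel) = 1"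
proof -
  have int: "integrable lborel \<rho>" using mollifier_integral not_integrable_integral_eq by fastforce
  have t: "(\<integral>\<^sup>+ z. ennreal (\<rho> (z - x)) \<partial>lborel) = 1" for x
  proof -
    have "(\<integral>\<^sup>+ z. ennreal (\<rho> (z - x)) \<partial>lborel) = (\<integral>\<^sup>+ z. ennreal (\<rho> (- x + z)) \<partial>lborel)"
      by (simp add: algebra_simps)
    also have "\<dots> = (\<integral>\<^sup>+ z. ennreal (\<rho> z) \<partial>distr lborel borel ((+) (- x)))"
      by (subst nn_integral_distr) auto
    also have "\<dots> = (\<integral>\<^sup>+ z. ennreal (\<rho> z) \<partial>lborel)" by (simp only: lborel_distr_plus)
    also have "\<dots> = ennreal (\<integral>z. \<rho> z \<partial>lborel)"
      using int mollifier_nonneg by (intro nn_integral_eq_integral) auto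
    finally show ?thesis by (simp add: mollifier_integral)
  qed
  then show "(\<integral>\<^sup>+ z. ennreal (\<rho> (z - x)) \<partial>lborel) = 1" .
  have "\<rho> (z - x) = \<rho> (x - z)" for x using mollifier_even[of "x - z"] by simp
  then show "(\<integral>\<^sup>+ x. ennreal (\<rho> (z - x)) \<partial>lborel) = 1" using t[of z] by simp
qed

lemma mollifier_translate_integrable: "integrable lborel (\<lambda>y. \<rho> (y - x))"
  and mollifier_translate_integral: "(\<integral>y. \<rho> (y - x) \<partial>lborel) = 1"
proof -
  show 1: "integrable lborel (\<lambda>y. \<rho> (y - x))"
    using mollifier_nn_integral(1)[of x] mollifier_nonneg by (intro integrableI_nonneg) auto
  have "ennreal (\<integral>y. \<rho> (y - x) \<partial>lborel) = 1"
    using nn_integral_eq_integral[OF 1] mollifier_nonneg mollifier_nn_integral(1)[of x] by simp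
  then show "(\<integral>y. \<rho> (y - x) \<partial>lborel) = 1" by simp
qed

text \<open>Jensen's inequality for the probability density \<open>\<rho> (y - x)\<close>, proved as
  nonnegativity of a variance.\<close>

lemma mollified_square_le:
  assumes w: "integrable lborel w" and w2: "integrable lborel (\<lambda>y. (w y)\<^sup>2)"
  shows "(\<integral>y. w y * \<rho> (y - x) \<partial>lborel)\<^sup>2 \<le> (\<integral>y. (w y)\<^sup>2 * \<rho> (y - x) \<partial>lborel)"
proof -
  define m where "m = (\<integral>y. w y * \<rho> (y - x) \<partial>lborel)"
  have "0 \<le> (\<integral>y. (w y - m)\<^sup>2 * \<rho> (y - x) \<partial>lborel)"
    by (intro integral_nonneg_AE) (simp add: mollifier_nonneg)
  also have "\<dots> = (\<integral>y. (w y)\<^sup>2 * \<rho> (y - x) - 2 * m * (w y * \<rho> (y - x)) + m\<^sup>2 * \<rho> (y - x) \<partial>lborel)"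
    by (simp add: power2_eq_square algebra_simps)
  also have "\<dots> = (\<integral>y. (w y)\<^sup>2 * \<rho> (y - x) \<partial>lborel) - m\<^sup>2"
    using integrable_mult_mollifier[OF w, of x] integrable_mult_mollifier[OF w2, of x]
      mollifier_translate_integrable[of x]
    by (simp add: mollifier_translate_integral power2_eq_square flip: m_def)
  finally show ?thesis by (simp add: m_def)
qed

text \<open>Jensen's inequality inside, then Tonelli, where the integral of
  \<open>\<rho> (y - x)\<close> over \<open>x\<close> is 1. Mollification is thus a contraction in
  L^2.\<close>

lemma mollified_L2_bound:
  assumes w: "integrable lborel w" and w2: "integrable lborel (\<lambda>y. (w y)\<^sup>2)"
  shows "(\<integral>\<^sup>+ x. ennreal ((\<integral>y. w y * \<rho> (y - x) \<partial>lborel)\<^sup>2) \<partial>lborel) \<le> (\<integral>\<^sup>+ y. ennreal ((w y)\<^sup>2) \<partial>lborel)"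
proof -
  have [measurable]: "w \<in> borel_measurable borel" using w by simp
  have "(\<integral>\<^sup>+ x. ennreal ((\<integral>y. w y * \<rho> (y - x) \<partial>lborel)\<^sup>2) \<partial>lborel)
      \<le> (\<integral>\<^sup>+ x. \<integral>\<^sup>+ y. ennreal ((w y)\<^sup>2 * \<rho> (y - x)) \<partial>lborel \<partial>lborel)"
  proof (rule nn_integral_mono)
    fix x
    have "(\<integral>\<^sup>+ y. ennreal ((w y)\<^sup>2 * \<rho> (y - x)) \<partial>lborel) = ennreal (\<integral>y. (w y)\<^sup>2 * \<rho> (y - x) \<partial>lborel)"
      using integrable_mult_mollifier[OF w2] mollifier_nonneg by (intro nn_integral_eq_integral) auto
    then show "ennreal ((\<integral>y. w y * \<rho> (y - x) \<partial>lborel)\<^sup>2) \<le> (\<integral>\<^sup>+ y. ennreal ((w y)\<^sup>2 * \<rho> (y - x)) \<partial>lborel)"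
      using mollified_square_le[OF w w2] by (simp add: ennreal_leI)
  qed
  also have "\<dots> = (\<integral>\<^sup>+ y. \<integral>\<^sup>+ x. ennreal ((w y)\<^sup>2 * \<rho> (y - x)) \<partial>lborel \<partial>lborel)"
    by (rule lborel_pair.Fubini') measurable
  also have "\<dots> = (\<integral>\<^sup>+ y. ennreal ((w y)\<^sup>2) * (\<integral>\<^sup>+ x. ennreal (\<rho> (y - x)) \<partial>lborel) \<partial>lborel)"
    by (simp add: ennreal_mult mollifier_nonneg nn_integral_cmult)
  also have "\<dots> = (\<integral>\<^sup>+ y. ennreal ((w y)\<^sup>2) \<partial>lborel)" by (simp add: mollifier_nn_integral)
  finally show ?thesis .
qed

lemma mollified_close:
  assumes w: "integrable lborel w" and close: "\<And>y. y \<in> ball x \<epsilon> \<Longrightarrow> \<bar>w y - c\<bar> \<le> \<eta>"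
  shows "\<bar>(\<integral>y. w y * \<rho> (y - x) \<partial>lborel) - c\<bar> \<le> \<eta>"
proof -
  have "(\<integral>y. w y * \<rho> (y - x) \<partial>lborel) - c = (\<integral>y. (w y - c) * \<rho> (y - x) \<partial>lborel)"
    using integrable_mult_mollifier[OF w, of x] mollifier_translate_integrable[of x]
    by (simp add: algebra_simps mollifier_translate_integral)
  also have "norm \<dots> \<le> (\<integral>y. norm ((w y - c) * \<rho> (y - x)) \<partial>lborel)" by (rule integral_norm_bound)
  also have "\<dots> \<le> (\<integral>y. \<eta> * \<rho> (y - x) \<partial>lborel)"
  proof (rule integral_mono')
    show b: "norm ((w y - c) * \<rho> (y - x)) \<le> \<eta> * \<rho> (y - x)" for y
    proof (cases "\<rho> (y - x) = 0")
      case False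
      then have "y \<in> ball x \<epsilon>" using mollifier_support[of "y - x"]
        by (simp add: dist_norm norm_minus_commute)
      then show ?thesis using close mollifier_nonneg
        by (auto simp: abs_mult intro!: mult_right_mono)
    qed simp
    show "integrable lborel (\<lambda>y. \<eta> * \<rho> (y - x))" using mollifier_translate_integrable by simp
    show "0 \<le> \<eta> * \<rho> (y - x)" for y using b norm_ge_zero order_trans by blast
  qed
  also have "\<dots> = \<eta>" by (simp add: mollifier_translate_integral)
  finally show ?thesis by simp
qed

end

declare mollifier_measurable [measurable del]

section \<open>Weak gradients\<close>

text \<open>The spaces are built on \<open>lebesgue_on \<Omega>\<close>, whereas mollification and
  Fubini's theorem work with Borel functions and \<open>lborel\<close> on the whole plane.
  \<open>w\<close> is a Borel version of \<open>u\<close>, extended by zero.\<close>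

definition borel_rep :: "(real^2) set \<Rightarrow> (real^2 \<Rightarrow> real) \<Rightarrow> (real^2 \<Rightarrow> real) \<Rightarrow> bool" where
  "borel_rep \<Omega> u w \<longleftrightarrow> w \<in> borel_measurable borel \<and> (\<forall>x. x \<notin> \<Omega> \<longrightarrow> w x = 0) \<and>
     (AE x in lebesgue. x \<in> \<Omega> \<longrightarrow> u x = w x)"

lemma borel_rep_exists:
  assumes \<Omega>: "open \<Omega>" and u: "u \<in> borel_measurable (lebesgue_on \<Omega>)"
  shows "\<exists>w. borel_rep \<Omega> u w"
proof -
  have "(\<lambda>x. if x \<in> \<Omega> then u x else 0) \<in> borel_measurable lebesgue"
    using \<Omega> u by (intro borel_measurable_if_I) auto
  then obtain w where w: "w \<in> borel_measurable lborel" "AE x in lborel. (if x \<in> \<Omega> then u x else 0) = w x"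
    using completion_ex_borel_measurable_real by blast
  have [measurable]: "\<Omega> \<in> sets borel" using \<Omega> by simp
  have [measurable]: "w \<in> borel_measurable borel" using w by simp
  have "(\<lambda>x. w x * indicator \<Omega> x) \<in> borel_measurable borel" by measurable
  moreover have "AE x in lebesgue. x \<in> \<Omega> \<longrightarrow> u x = w x * indicator \<Omega> x"
    using AE_completion[OF w(2)] by eventually_elim auto
  ultimately have "borel_rep \<Omega> u (\<lambda>x. w x * indicator \<Omega> x)" by (auto simp: borel_rep_def)
  then show ?thesis by blast
qed

lemma borel_rep_mult:
  assumes "borel_rep \<Omega> u w" "\<phi> \<in> borel_measurable borel"
  shows "borel_rep \<Omega> (\<lambda>x. u x * \<phi> x) (\<lambda>x. w x * \<phi> x)"
  using assms unfolding borel_rep_def by (auto elim: eventually_mono)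

lemma borel_rep_square: "borel_rep \<Omega> u w \<Longrightarrow> borel_rep \<Omega> (\<lambda>x. (u x)\<^sup>2) (\<lambda>x. (w x)\<^sup>2)"
  unfolding borel_rep_def by (auto elim: eventually_mono)

lemma borel_measurable_vec_nth' [measurable]:
  fixes f :: "'a \<Rightarrow> real^'n"
  assumes "f \<in> borel_measurable M"
  shows "(\<lambda>x. f x $ i) \<in> borel_measurable M"
  using assms
proof (rule measurable_compose)
  show "(\<lambda>x. x $ i) \<in> borel_measurable (borel :: (real^'n) measure)"
    by (intro borel_measurable_continuous_onI continuous_intros)
qed

text \<open>Changes on a null set preserve measurability because Lebesgue measure is
  complete.\<close>

lemma measurable_lebesgue_cong_AE:
  fixes f g :: "'a::euclidean_space \<Rightarrow> real"
  assumes ae: "AE x in lebesgue. f x = g x" and f: "f \<in> borel_measurable lebesgue"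
  shows "g \<in> borel_measurable lebesgue"
proof (rule measurableI)
  fix S :: "real set" assume "S \<in> sets borel"
  then have A: "f -` S \<inter> space lebesgue \<in> sets lebesgue" using f by (rule measurable_sets[rotated])
  have "AE x in lebesgue. x \<in> f -` S \<inter> space lebesgue \<longleftrightarrow> x \<in> g -` S \<inter> space lebesgue"
    using ae by eventually_elim auto
  from this A show "g -` S \<inter> space lebesgue \<in> sets lebesgue"
    by (rule completion.in_sets_AE) simp
qed simp

lemma borel_rep_measurable:
  assumes "open \<Omega>" "borel_rep \<Omega> u w"
  shows "(\<lambda>x. if x \<in> \<Omega> then u x else 0) \<in> borel_measurable lebesgue"
proof -
  have "AE x in lebesgue. w x = (if x \<in> \<Omega> then u x else 0)"
    using assms(2) by (auto simp: borel_rep_def elim: eventually_mono)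
  moreover have "w \<in> borel_measurable lebesgue"
    using assms(2) by (intro measurable_completion) (simp add: borel_rep_def)
  ultimately show ?thesis
    by (rule measurable_lebesgue_cong_AE)
qed

lemma borel_rep_integral:
  assumes \<Omega>: "open \<Omega>" and rep: "borel_rep \<Omega> u w"
  shows "(\<integral>x. u x \<partial>lebesgue_on \<Omega>) = (\<integral>x. w x \<partial>lborel)"
    and "integrable (lebesgue_on \<Omega>) u \<longleftrightarrow> integrable lborel w"
proof -
  have S: "\<Omega> \<inter> space lebesgue \<in> sets lebesgue" using \<Omega> by auto
  have m: "(\<lambda>x. indicator \<Omega> x *\<^sub>R u x) \<in> borel_measurable lebesgue"
  proof -
    have "(\<lambda>x. indicator \<Omega> x *\<^sub>R u x) = (\<lambda>x. if x \<in> \<Omega> then u x else 0)"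
      by (auto simp: indicator_def)
    then show ?thesis using borel_rep_measurable[OF assms] by simp
  qed
  have w: "w \<in> borel_measurable borel" using rep by (auto simp: borel_rep_def)
  have ae: "AE x in lebesgue. indicator \<Omega> x *\<^sub>R u x = w x"
    using rep by (auto simp: borel_rep_def indicator_def elim: eventually_mono)
  have wl: "w \<in> borel_measurable lebesgue" using w by (intro measurable_completion) simp
  show "(\<integral>x. u x \<partial>lebesgue_on \<Omega>) = (\<integral>x. w x \<partial>lborel)"
    using integral_cong_AE[OF m wl ae] w by (simp add: integral_restrict_space[OF S] integral_completion)
  show "integrable (lebesgue_on \<Omega>) u \<longleftrightarrow> integrable lborel w"
    using integrable_cong_AE[OF m wl ae] w by (simp add: integrable_restrict_space[OF S] integrable_completion)
qed

text \<open>On the bounded set \<open>2 |w| \<le> 1 + w^2\<close>, and outside it \<open>w\<close>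
  vanishes. Mollification requires integrability.\<close>

lemma integrable_of_square_integrable:
  fixes w :: "real^2 \<Rightarrow> real"
  assumes "bounded \<Omega>" "w \<in> borel_measurable borel" "\<And>x. x \<notin> \<Omega> \<Longrightarrow> w x = 0"
    "integrable lborel (\<lambda>x. (w x)\<^sup>2)"
  shows "integrable lborel w"
proof -
  obtain a b where ab: "\<Omega> \<subseteq> cbox a b" using bounded_subset_cbox_symmetric[OF assms(1)] by metis
  have "integrable lborel (\<lambda>x. indicator (cbox a b) x + (w x)\<^sup>2)"
    using assms(4) emeasure_lborel_cbox_finite[of a b]
    by (intro Bochner_Integration.integrable_add) (simp_all add: integrable_indicator_iff)
  then show ?thesis
  proof (rule Bochner_Integration.integrable_bound)
    show "w \<in> borel_measurable lborel" using assms by simp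
    have "\<bar>w x\<bar> \<le> indicator (cbox a b) x + (w x)\<^sup>2" for x
    proof (cases "x \<in> \<Omega>")
      case True
      have "0 \<le> (\<bar>w x\<bar> - 1)\<^sup>2" by simp
      then have "2 * \<bar>w x\<bar> \<le> 1 + (w x)\<^sup>2" by (simp add: power2_diff)
      moreover have "0 \<le> (w x)\<^sup>2" by simp
      ultimately show ?thesis using True ab by (auto simp: indicator_def)
    qed (use assms in simp)
    then show "AE x in lborel. norm (w x) \<le> norm (indicator (cbox a b) x + (w x)\<^sup>2)"
      by (auto simp: indicator_def)
  qed
qed

lemma L2_borel_rep:
  assumes \<Omega>: "open \<Omega>" "bounded \<Omega>" and u: "u \<in> L2 \<Omega>"
  obtains w where "borel_rep \<Omega> u w" "integrable lborel (\<lambda>x. (w x)\<^sup>2)" "integrable lborel w"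
proof -
  obtain w where w: "borel_rep \<Omega> u w" using borel_rep_exists[OF \<Omega>(1)] u by (auto simp: L2_def)
  have w2: "integrable lborel (\<lambda>x. (w x)\<^sup>2)"
    using borel_rep_integral(2)[OF \<Omega>(1) borel_rep_square[OF w]] u by (auto simp: L2_def)
  have "integrable lborel w"
    by (rule integrable_of_square_integrable[OF \<Omega>(2) _ _ w2]) (use w in \<open>auto simp: borel_rep_def\<close>)
  then show ?thesis by (rule that[OF w w2])
qed

lemma L2_norm_sq_borel_rep:
  assumes "open \<Omega>" "borel_rep \<Omega> u w" "integrable lborel (\<lambda>x. (w x)\<^sup>2)"
  shows "ennreal ((L2_norm \<Omega> u)\<^sup>2) = (\<integral>\<^sup>+x. ennreal ((w x)\<^sup>2) \<partial>lborel)"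
proof -
  have "(L2_norm \<Omega> u)\<^sup>2 = (\<integral>x. (w x)\<^sup>2 \<partial>lborel)"
    using borel_rep_integral(1)[OF assms(1) borel_rep_square[OF assms(2)]] by (simp add: L2_norm_def)
  then show ?thesis using nn_integral_eq_integral[OF assms(3)] by simp
qed

text \<open>Translation invariance takes the place of the fundamental theorem: every difference
  quotient of \<open>W\<close> in direction \<open>i\<close> has integral zero, and the quotients
  converge to \<open>D x $ i\<close> under a common bound, the Lipschitz constant of
  \<open>W\<close>.\<close>

lemma integral_gradient_compact_support:
  fixes W :: "real^2 \<Rightarrow> real" and D :: "real^2 \<Rightarrow> real^2"
  assumes W: "\<And>x. (W has_derivative (\<lambda>v. D x \<bullet> v)) (at x)" and D: "continuous_on UNIV D"
    and supp: "\<And>x. W x \<noteq> 0 \<Longrightarrow> norm x \<le> R" "\<And>x. D x \<noteq> 0 \<Longrightarrow> norm x \<le> R"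
  shows "(\<integral>x. D x $ i \<partial>lborel) = 0"
proof -
  let ?e = "axis i 1 :: real^2"
  have cW: "continuous_on UNIV W"
    by (intro continuous_at_imp_continuous_on ballI has_derivative_continuous[OF W])
  have [measurable]: "W \<in> borel_measurable borel" "D \<in> borel_measurable borel"
    using cW D by (auto intro: borel_measurable_continuous_onI)
  have "compact (D ` cball 0 R)"
    using D by (intro compact_continuous_image) (auto intro: continuous_on_subset)
  then obtain B0 where B0: "\<And>z. z \<in> cball 0 R \<Longrightarrow> norm (D z) \<le> B0"
    using compact_imp_bounded bounded_iff by (metis imageI)
  define B where "B = max B0 0"
  have B: "norm (D z) \<le> B" for z
    using B0[of z] supp(2)[of z] by (cases "D z = 0") (auto simp: B_def)
  have lip: "\<bar>W x - W y\<bar> \<le> B * norm (x - y)" for x y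
  proof -
    have "norm (W x - W y) \<le> B * norm (x - y)"
    proof (rule differentiable_bound[where S = UNIV and f' = "\<lambda>x v. D x \<bullet> v"])
      show "onorm ((\<bullet>) (D x)) \<le> B" for x
      proof (rule onorm_le)
        show "norm (D x \<bullet> v) \<le> B * norm v" for v
          using Cauchy_Schwarz_ineq2[of "D x" v] mult_right_mono[OF B[of x] norm_ge_zero[of v]]
          by simp
      qed
    qed (use W in auto)
    then show ?thesis by simp
  qed
  have intW: "integrable lborel W"
  proof -
    have "integrable lborel (\<lambda>x. indicator (cball 0 R) x *\<^sub>R W x)"
      using cW by (intro borel_integrable_compact) (auto intro: continuous_on_subset)
    moreover have "(\<lambda>x. indicator (cball 0 R) x *\<^sub>R W x) = W"
    proof
      show "indicator (cball 0 R) x *\<^sub>R W x = W x" for x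
        using supp(1)[of x] by (cases "W x = 0") auto
    qed
    ultimately show ?thesis by simp
  qed
  define q where "q n x = real (Suc n) * (W ((1 / real (Suc n)) *\<^sub>R ?e + x) - W x)" for n x
  have shift: "(\<integral>x. W (c + x) \<partial>lborel) = (\<integral>x. W x \<partial>lborel)" "integrable lborel (\<lambda>x. W (c + x))" for c
  proof -
    have "(\<integral>x. W x \<partial>distr lborel borel ((+) c)) = (\<integral>x. W (c + x) \<partial>lborel)"
      by (subst integral_distr) auto
    then show "(\<integral>x. W (c + x) \<partial>lborel) = (\<integral>x. W x \<partial>lborel)" by (simp only: lborel_distr_plus)
    have "integrable (distr lborel borel ((+) c)) W" using intW by (simp only: lborel_distr_plus)
    then show "integrable lborel (\<lambda>x. W (c + x))" by (subst (asm) integrable_distr_eq) auto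
  qed
  have q0: "(\<integral>x. q n x \<partial>lborel) = 0" for n
    unfolding q_def using shift intW by simp
  \<comment> \<open>The shifts have length at most 1, so all quotients vanish outside the ball of
    radius \<open>R + 1\<close>.\<close>
  have "(\<lambda>n. \<integral>x. q n x \<partial>lborel) \<longlonglongrightarrow> (\<integral>x. D x $ i \<partial>lborel)"
  proof (rule integral_dominated_convergence[where w = "\<lambda>x. B * indicator (cball (0::real^2) (R + 1)) x"])
    show "(\<lambda>x. D x $ i) \<in> borel_measurable lborel" by measurable
    show "q n \<in> borel_measurable lborel" for n unfolding q_def by measurable
    show "integrable lborel (\<lambda>x. B * indicator (cball (0::real^2) (R + 1)) x :: real)"
      using emeasure_bounded_finite[OF bounded_cball, of "0 :: real^2" "R + 1"]
      by (intro integrable_mult_right) (simp add: integrable_indicator_iff)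
    show "AE x in lborel. (\<lambda>n. q n x) \<longlonglongrightarrow> D x $ i"
    proof (rule AE_I2)
      fix x
      have "((\<lambda>t. W (x + t *\<^sub>R ?e)) has_derivative (\<lambda>t. D x \<bullet> (t *\<^sub>R ?e))) (at 0)"
      proof (rule has_derivative_compose[where f = "\<lambda>t. x + t *\<^sub>R ?e" and g = W])
        show "((\<lambda>t. x + t *\<^sub>R ?e) has_derivative (\<lambda>t. t *\<^sub>R ?e)) (at 0)"
          by (auto intro!: derivative_eq_intros)
      qed (use W in simp)
      then have "((\<lambda>t. W (x + t *\<^sub>R ?e)) has_real_derivative D x $ i) (at 0)"
        by (simp add: has_field_derivative_def inner_axis mult_commute_abs)
      then have "((\<lambda>t. (W (x + t *\<^sub>R ?e) - W x) / t) \<longlongrightarrow> D x $ i) (at 0)"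
        by (simp add: has_field_derivative_iff)
      moreover have "filterlim (\<lambda>n. 1 / real (Suc n)) (at 0) sequentially"
        using LIMSEQ_inverse_real_of_nat by (simp add: filterlim_at inverse_eq_divide)
      ultimately have "(\<lambda>n. (W (x + (1 / real (Suc n)) *\<^sub>R ?e) - W x) / (1 / real (Suc n))) \<longlonglongrightarrow> D x $ i"
        by (rule filterlim_compose)
      then show "(\<lambda>n. q n x) \<longlonglongrightarrow> D x $ i"
        by (simp add: q_def add.commute mult.commute)
    qed
    show "AE x in lborel. norm (q n x) \<le> B * indicator (cball (0::real^2) (R + 1)) x" for n
    proof (rule AE_I2)
      fix x
      let ?h = "(1 / real (Suc n)) *\<^sub>R ?e"
      have h: "norm ?h = 1 / real (Suc n)" by simp
      show "norm (q n x) \<le> B * indicator (cball (0::real^2) (R + 1)) x"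
      proof (cases "x \<in> cball 0 (R + 1)")
        case True
        have "norm (q n x) = real (Suc n) * \<bar>W (?h + x) - W x\<bar>"
          by (simp add: q_def abs_mult)
        also have "\<dots> \<le> real (Suc n) * (B * norm (?h + x - x))"
          by (intro mult_left_mono lip) simp
        also have "\<dots> = B" using h by simp
        finally show ?thesis using True by simp
      next
        case False
        then have x: "R + 1 < norm x" by simp
        have "norm ?h \<le> 1" unfolding h by simp
        moreover have "norm x \<le> norm (?h + x) + norm ?h"
          using norm_triangle_ineq4[of "?h + x" ?h] by (simp only: add_diff_cancel_left')
        ultimately have "R < norm (?h + x)" using x by linarith
        then have "W (?h + x) = 0" "W x = 0" using supp(1)[of "?h + x"] supp(1)[of x] x by auto
        then show ?thesis using False by (simp add: q_def)
      qed
    qed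
  qed
  then show ?thesis by (simp add: q0 LIMSEQ_const_iff)
qed

text \<open>The defining identity, moved to \<open>lborel\<close> and to an explicit gradient
  \<open>r\<close> in place of \<open>frechet_derivative\<close>; mollifiers are tested in this
  form.\<close>

lemma weak_gradient_borel_rep:
  assumes \<Omega>: "open \<Omega>" and wg: "has_weak_gradient \<Omega> u g"
    and u: "borel_rep \<Omega> u w" and g: "borel_rep \<Omega> (\<lambda>x. g x $ i) \<gamma>"
    and \<phi>: "test_function \<Omega> \<phi>" "\<And>x. (\<phi> has_derivative (\<lambda>v. r x \<bullet> v)) (at x)" "continuous_on UNIV r"
  shows "(\<integral>x. w x * r x $ i \<partial>lborel) = - (\<integral>x. \<gamma> x * \<phi> x \<partial>lborel)"
proof -
  have "frechet_derivative \<phi> (at x) = (\<lambda>v. r x \<bullet> v)" for x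
    using frechet_derivative_at[OF \<phi>(2)] by simp
  then have fd: "frechet_derivative \<phi> (at x) (axis i 1) = r x $ i" for x
    by (simp add: inner_axis)
  have cphi: "continuous_on UNIV \<phi>"
    by (intro continuous_at_imp_continuous_on ballI has_derivative_continuous[OF \<phi>(2)])
  have [measurable]: "\<phi> \<in> borel_measurable borel" "r \<in> borel_measurable borel"
    using cphi \<phi>(3) by (auto intro: borel_measurable_continuous_onI)
  have "(\<integral>x. u x * r x $ i \<partial>lebesgue_on \<Omega>) = - (\<integral>x. g x $ i * \<phi> x \<partial>lebesgue_on \<Omega>)"
  proof -
    have "(\<integral>x. u x * frechet_derivative \<phi> (at x) (axis i 1) \<partial>lebesgue_on \<Omega>)
        = - (\<integral>x. g x $ i * \<phi> x \<partial>lebesgue_on \<Omega>)"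
      using wg \<phi>(1) unfolding has_weak_gradient_def by blast
    then show ?thesis by (simp only: fd)
  qed
  then show ?thesis
    using borel_rep_integral(1)[OF \<Omega> borel_rep_mult[OF u, of "\<lambda>x. r x $ i"]]
      borel_rep_integral(1)[OF \<Omega> borel_rep_mult[OF g, of \<phi>]] by simp
qed

text \<open>The fundamental lemma of the calculus of variations. The bumps tend to indicators of
  boxes, so all integrals over boxes in \<open>U\<close> vanish; Lebesgue differentiation gives the
  claim on one box, and countably many boxes exhaust \<open>U\<close>.\<close>

lemma AE_zero_of_bump_integrals:
  fixes f :: "real^2 \<Rightarrow> real"
  assumes f: "integrable lborel f" and U: "open U"
    and z: "\<And>n a b. cbox a b \<subseteq> U \<Longrightarrow> (\<integral>x. f x * bump 1 1 1 1 (real (Suc n)) a b x \<partial>lborel) = 0"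
  shows "AE x in lebesgue. x \<in> U \<longrightarrow> f x = 0"
proof -
  have [measurable]: "f \<in> borel_measurable borel" using f by simp
  have box0: "integral (cbox a b) f = 0" if "cbox a b \<subseteq> U" for a b
  proof -
    have "(\<lambda>n. \<integral>x. f x * bump 1 1 1 1 (real (Suc n)) a b x \<partial>lborel) \<longlonglongrightarrow> (\<integral>x. f x * indicator (box a b) x \<partial>lborel)"
    proof (rule integral_dominated_convergence[where w = "\<lambda>x. \<bar>f x\<bar>"])
      show "(\<lambda>x. f x * indicator (box a b) x) \<in> borel_measurable lborel" by measurable
      have [measurable]: "bump 1 1 1 1 (real (Suc n)) a b \<in> borel_measurable borel" for n
        using continuous_bump by (rule borel_measurable_continuous_onI)
      show "(\<lambda>x. f x * bump 1 1 1 1 (real (Suc n)) a b x) \<in> borel_measurable lborel" for n by measurable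
      show "integrable lborel (\<lambda>x. \<bar>f x\<bar>)" using f by simp
      show "AE x in lborel. (\<lambda>n. f x * bump 1 1 1 1 (real (Suc n)) a b x) \<longlonglongrightarrow> f x * indicator (box a b) x"
        by (intro AE_I2 tendsto_mult tendsto_const LIMSEQ_Suc[OF bump_1_tendsto_indicator])
      show "AE x in lborel. norm (f x * bump 1 1 1 1 (real (Suc n)) a b x) \<le> \<bar>f x\<bar>" for n
        using bump_1_bounds by (auto simp: abs_mult intro!: mult_left_le)
    qed
    then have "(\<integral>x. f x * indicator (box a b) x \<partial>lborel) = 0"
      using z[OF that] by (simp add: LIMSEQ_const_iff)
    moreover have si: "set_integrable lborel (box a b) f"
      unfolding set_integrable_def using f by (intro integrable_mult_indicator) auto
    ultimately have "set_lebesgue_integral lborel (box a b) f = 0"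
      by (simp add: set_lebesgue_integral_def mult.commute)
    then have "integral (box a b) f = 0" using set_borel_integral_eq_integral(2)[OF si] by simp
    then show ?thesis by (simp add: integral_open_interval)
  qed
  have onbox: "AE x in lebesgue. x \<in> cbox a b \<longrightarrow> f x = 0" if ab: "cbox a b \<subseteq> U" for a b
  proof -
    \<comment> \<open>After cutting off outside \<open>cbox a b\<close> the integral over every box
      is zero, also over boxes that stick out; the differentiation theorem uses small boxes with
      lower corner \<open>x\<close>.\<close>
    define F where "F = (\<lambda>x. if x \<in> cbox a b then f x else 0)"
    have fi: "f integrable_on S" if "S \<in> sets borel" for S
    proof -
      have "set_integrable lborel S f" unfolding set_integrable_def
        using f that by (intro integrable_mult_indicator) auto
      then show ?thesis using set_borel_integral_eq_integral(1) by blast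
    qed
    have F: "integral (cbox c d) F = 0" for c d
    proof -
      obtain c' d' where e: "cbox a b \<inter> cbox c d = cbox c' d'"
        unfolding Int_interval by blast
      have "integral (cbox c d) F = integral (cbox a b \<inter> cbox c d) f"
        unfolding F_def by (rule Henstock_Kurzweil_Integration.integral_restrict_Int)
      also have "\<dots> = 0" using box0[of c' d'] e ab by auto
      finally show ?thesis .
    qed
    have "F integrable_on cbox c d" for c d
      unfolding F_def integrable_restrict_Int by (rule fi) auto
    then obtain N where N: "negligible N" "\<And>x e. x \<notin> N \<Longrightarrow> 0 < e \<Longrightarrow> \<exists>d>0. \<forall>h. 0 < h \<and> h < d \<longrightarrow>
        norm (integral (cbox x (x + h *\<^sub>R One)) F /\<^sub>R h ^ DIM(real^2) - F x) < e"
      using integrable_ccontinuous_explicit[of F] by blast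
    have "F x = 0" if xN: "x \<notin> N" for x
    proof (rule ccontr)
      assume "F x \<noteq> 0"
      then obtain d where d: "0 < d" "\<forall>h. 0 < h \<and> h < d \<longrightarrow>
          norm (integral (cbox x (x + h *\<^sub>R One)) F /\<^sub>R h ^ DIM(real^2) - F x) < norm (F x)"
        using N(2)[OF xN, of "norm (F x)"] by auto
      from d(2)[rule_format, of "d / 2"] d(1) show False by (simp add: F)
    qed
    moreover have "AE x in lebesgue. x \<notin> N"
      using N(1) by (intro AE_not_in) (simp add: negligible_iff_null_sets)
    ultimately have "AE x in lebesgue. F x = 0" by (auto elim: eventually_mono)
    then show ?thesis
    proof eventually_elim
      case (elim x)
      then show ?case by (cases "x \<in> cbox a b") (simp_all add: F_def)
    qed
  qed
  obtain \<D> where D: "countable \<D>" "\<D> \<subseteq> Pow U" "\<And>X. X \<in> \<D> \<Longrightarrow> \<exists>a b. X = cbox a b" "\<Union>\<D> = U"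
    using open_countable_Union_open_cbox[OF U] by metis
  have "AE x in lebesgue. \<forall>X\<in>\<D>. x \<in> X \<longrightarrow> f x = 0"
    unfolding AE_ball_countable[OF D(1)]
  proof
    fix X assume X: "X \<in> \<D>"
    then obtain a b where ab: "X = cbox a b" using D(3) by blast
    moreover have "X \<subseteq> U" using D(2) X by blast
    ultimately show "AE x in lebesgue. x \<in> X \<longrightarrow> f x = 0" using onbox[of a b] by simp
  qed
  then show ?thesis by eventually_elim (use D in blast)
qed

text \<open>For a bump \<open>\<phi>\<close> supported in \<open>K\<close> the product of
  \<open>f\<close> and \<open>\<phi>\<close> is C^1 with compact support, so its gradient has
  integral zero. Comparison with the weak identity shows that \<open>g - G\<close> is orthogonal to
  all such \<open>\<phi>\<close>.\<close>

lemma weak_gradient_eq_classical: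
  assumes \<Omega>: "open \<Omega>" "bounded \<Omega>" and u: "u \<in> L2 \<Omega>" and g: "L2_weak_gradient \<Omega> u g"
    and K: "open K" "K \<subseteq> \<Omega>" and eq: "AE x in lebesgue. x \<in> K \<longrightarrow> u x = f x"
    and f: "\<And>x. x \<in> K \<Longrightarrow> (f has_derivative (\<lambda>v. G x \<bullet> v)) (at x)" "continuous_on K G"
  shows "AE x in lebesgue. x \<in> K \<longrightarrow> g x $ i = G x $ i"
proof -
  obtain w where w: "borel_rep \<Omega> u w" "integrable lborel w"
    using L2_borel_rep[OF \<Omega> u] by metis
  have gi: "(\<lambda>x. g x $ i) \<in> L2 \<Omega>" using g by (auto simp: L2_weak_gradient_def)
  obtain \<gamma> where \<gamma>: "borel_rep \<Omega> (\<lambda>x. g x $ i) \<gamma>" "integrable lborel \<gamma>"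
    using L2_borel_rep[OF \<Omega> gi] by metis
  have wf: "AE x in lebesgue. x \<in> K \<longrightarrow> w x = f x"
    using eq w(1)[unfolded borel_rep_def] K(2) by (auto elim: eventually_elim2)
  have cf: "continuous_on K f"
    using f(1) has_derivative_continuous continuous_at_imp_continuous_on by blast
  have main: "AE x in lebesgue. x \<in> cbox a b \<longrightarrow> \<gamma> x - G x $ i = 0" if ab: "cbox a b \<subseteq> K" for a b
  proof -
    \<comment> \<open>\<open>G\<close> need not be integrable up to the boundary of
      \<open>K\<close>; restricted to a closed box in \<open>K\<close> it is.\<close>
    define H where "H = (\<lambda>x. indicator (cbox a b) x * (\<gamma> x - G x $ i))"
    have Hi: "integrable lborel H"
    proof -
      have "integrable lborel (\<lambda>x. indicator (cbox a b) x *\<^sub>R (G x $ i))"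
        using f(2) ab by (intro borel_integrable_compact continuous_intros) (auto intro: continuous_on_subset)
      moreover have "integrable lborel (\<lambda>x. indicator (cbox a b) x *\<^sub>R \<gamma> x)"
        using \<gamma>(2) by (intro integrable_mult_indicator) auto
      ultimately have "integrable lborel (\<lambda>x. indicator (cbox a b) x *\<^sub>R \<gamma> x - indicator (cbox a b) x *\<^sub>R (G x $ i))"
        by (intro Bochner_Integration.integrable_diff)
      then show ?thesis by (simp add: H_def right_diff_distrib)
    qed
    have "(\<integral>x. H x * bump 1 1 1 1 (real (Suc n)) c d x \<partial>lborel) = 0" if cd: "cbox c d \<subseteq> box a b" for n c d
    proof -
      let ?n = "real (Suc n)"
      let ?\<phi> = "bump 1 1 1 1 ?n c d"
      define r where "r = (\<lambda>x. vector
        [?n * bump (flat_deriv 1) 1 1 1 ?n c d x + (- ?n) * bump 1 (flat_deriv 1) 1 1 ?n c d x,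
         ?n * bump 1 1 (flat_deriv 1) 1 ?n c d x + (- ?n) * bump 1 1 1 (flat_deriv 1) ?n c d x] :: real^2)"
      have cdK: "cbox c d \<subseteq> K" using cd ab box_subset_cbox by blast
      have r: "(?\<phi> has_derivative (\<lambda>v. r x \<bullet> v)) (at x)" for x
        unfolding r_def by (rule bump_has_derivative)
      have cr: "continuous_on UNIV r"
      proof -
        have "continuous_on UNIV (\<lambda>z. r z $ 1)" "continuous_on UNIV (\<lambda>z. r z $ 2)"
          unfolding r_def vector_2 by (intro continuous_intros continuous_bump)+
        then have "continuous_on UNIV (\<lambda>z. r z $ i)" for i
          using exhaust_2[of i] by auto
        then have "continuous_on UNIV (\<lambda>z. \<chi> i. r z $ i)" by (rule continuous_on_vec_lambda)
        then show ?thesis by simp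
      qed
      have b0: "?\<phi> x = 0" "r x = 0" if "x \<notin> cbox c d" for x
      proof -
        have x: "x \<notin> box c d" using that box_subset_cbox by blast
        have "bump P Q R S ?n c d x = 0" for P Q R S
          using x bump_support[of ?n P Q R S c d x] by (metis of_nat_0_less_iff zero_less_Suc)
        then show "?\<phi> x = 0" "r x = 0" by (auto simp: r_def vec_eq_iff forall_2)
      qed
      have tf: "test_function \<Omega> ?\<phi>"
        using test_function_bump[of ?n c d \<Omega> 1 1 1 1 1] cdK K(2) by auto
      have 1: "(\<integral>x. w x * r x $ i \<partial>lborel) = - (\<integral>x. \<gamma> x * ?\<phi> x \<partial>lborel)"
        using g by (intro weak_gradient_borel_rep[OF \<Omega>(1) _ w(1) \<gamma>(1) tf r cr]) (simp add: L2_weak_gradient_def)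
      \<comment> \<open>\<open>W\<close> is the product of \<open>f\<close> and the bump, extended
        by zero, and \<open>D\<close> is its gradient. The open sets \<open>K\<close> and
        \<open>- cbox c d\<close> cover the plane, so differentiability is checked on each of
        them.\<close>
      define W where "W = (\<lambda>x. if x \<in> K then f x * ?\<phi> x else 0)"
      define D where "D = (\<lambda>x. if x \<in> K then ?\<phi> x *\<^sub>R G x + f x *\<^sub>R r x else 0)"
      have out: "W x = 0" "D x = 0" if "x \<notin> cbox c d" for x
        using b0[OF that] by (auto simp: W_def D_def)
      have UN: "x \<in> K \<or> x \<in> - cbox c d" for x using cdK by auto
      have o2: "open (- cbox c d)" by (simp add: closed_cbox open_Compl)
      have Wd: "(W has_derivative (\<lambda>v. D x \<bullet> v)) (at x)" for x
        using UN[of x]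
      proof
        assume x: "x \<in> K"
        have "((\<lambda>x. f x * ?\<phi> x) has_derivative (\<lambda>v. D x \<bullet> v)) (at x)"
          using x by (intro has_derivative_eq_rhs[OF has_derivative_mult[OF f(1)[OF x] r]])
            (auto simp: D_def inner_add_left)
        then show ?thesis
          by (rule has_derivative_transform_within_open[OF _ K(1) x]) (simp add: W_def)
      next
        assume x: "x \<in> - cbox c d"
        have "((\<lambda>x. 0) has_derivative (\<lambda>v. D x \<bullet> v)) (at x)" using out x by simp
        then show ?thesis
          by (rule has_derivative_transform_within_open[OF _ o2 x]) (simp add: out)
      qed
      have cD: "continuous_on UNIV D"
      proof -
        have "continuous_on K (\<lambda>x. ?\<phi> x *\<^sub>R G x + f x *\<^sub>R r x)"
          using cr by (intro continuous_intros continuous_bump cf f(2)) (auto intro: continuous_on_subset)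
        then have "continuous_on K D" by (rule continuous_on_eq) (simp add: D_def)
        moreover have "continuous_on (- cbox c d) D"
          by (rule continuous_on_eq[OF continuous_on_const[of _ 0]]) (simp add: out)
        ultimately have "continuous_on (K \<union> - cbox c d) D"
          by (intro continuous_on_open_Un K o2)
        then show ?thesis using UN by (auto elim!: continuous_on_subset)
      qed
      obtain R where R: "\<And>x. x \<in> cbox c d \<Longrightarrow> norm x \<le> R"
        using bounded_cbox[of c d] bounded_iff by metis
      have 2: "(\<integral>x. D x $ i \<partial>lborel) = 0"
        by (rule integral_gradient_compact_support[OF Wd cD, of R]) (use out R in blast)+
      have Dm: "D \<in> borel_measurable borel" using cD by (rule borel_measurable_continuous_onI)
      have phim: "?\<phi> \<in> borel_measurable borel" using continuous_bump by (rule borel_measurable_continuous_onI)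
      have rm: "r \<in> borel_measurable borel" using cr by (rule borel_measurable_continuous_onI)
      have wm: "w \<in> borel_measurable borel" "\<gamma> \<in> borel_measurable borel" using w \<gamma> by auto
      have i1: "integrable lborel (\<lambda>x. \<gamma> x * ?\<phi> x)"
        using bump_1_bounds by (intro integrable_mult_bounded_lborel[OF \<gamma>(2) phim, of 1]) auto
      have i3: "integrable lborel (\<lambda>x. H x * ?\<phi> x)"
        using bump_1_bounds by (intro integrable_mult_bounded_lborel[OF Hi phim, of 1]) auto
      have ae: "AE x in lborel. w x * r x $ i = D x $ i + H x * ?\<phi> x - \<gamma> x * ?\<phi> x"
      proof -
        have "AE x in lborel. x \<in> K \<longrightarrow> w x = f x" using wf by (simp add: AE_completion_iff)
        then show ?thesis
        proof eventually_elim
          case (elim x)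
          show ?case
          proof (cases "x \<in> cbox c d")
            case True
            then have "x \<in> K" "x \<in> cbox a b" using cdK cd box_subset_cbox by blast+
            then show ?thesis using elim by (simp add: D_def H_def algebra_simps)
          next
            case False
            then show ?thesis using out b0 by simp
          qed
        qed
      qed
      have iD: "integrable lborel (\<lambda>x. D x $ i)"
      proof -
        have "integrable lborel (\<lambda>x. indicator (cbox c d) x *\<^sub>R (D x $ i))"
          using cD by (intro borel_integrable_compact continuous_intros) (auto intro: continuous_on_subset)
        moreover have "(\<lambda>x. indicator (cbox c d) x *\<^sub>R (D x $ i)) = (\<lambda>x. D x $ i)"
        proof
          show "indicator (cbox c d) x *\<^sub>R (D x $ i) = D x $ i" for x
            using out[of x] by (cases "x \<in> cbox c d") auto
        qed
        ultimately show ?thesis by simp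
      qed
      have "(\<integral>x. w x * r x $ i \<partial>lborel) = (\<integral>x. D x $ i + H x * ?\<phi> x - \<gamma> x * ?\<phi> x \<partial>lborel)"
        using wm rm i1 i3 iD by (intro integral_cong_AE ae) auto
      also have "\<dots> = (\<integral>x. H x * ?\<phi> x \<partial>lborel) - (\<integral>x. \<gamma> x * ?\<phi> x \<partial>lborel)"
        using iD i1 i3 2 by simp
      finally show ?thesis using 1 by simp
    qed
    then have *: "AE x in lebesgue. x \<in> box a b \<longrightarrow> H x = 0"
      using AE_zero_of_bump_integrals[OF Hi open_box] by blast
    have "negligible (cbox a b - box a b)" by (rule negligible_frontier_interval)
    then have "AE x in lebesgue. x \<notin> cbox a b - box a b"
      by (intro AE_not_in) (simp add: negligible_iff_null_sets)
    with * show ?thesis by eventually_elim (auto simp: H_def)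
  qed
  obtain \<D> where D: "countable \<D>" "\<D> \<subseteq> Pow K" "\<And>X. X \<in> \<D> \<Longrightarrow> \<exists>a b. X = cbox a b" "\<Union>\<D> = K"
    using open_countable_Union_open_cbox[OF K(1)] by metis
  have "AE x in lebesgue. \<forall>X\<in>\<D>. x \<in> X \<longrightarrow> \<gamma> x - G x $ i = 0"
    unfolding AE_ball_countable[OF D(1)]
  proof
    fix X assume X: "X \<in> \<D>"
    then obtain a b where ab: "X = cbox a b" using D(3) by blast
    moreover have "X \<subseteq> K" using D(2) X by blast
    ultimately show "AE x in lebesgue. x \<in> X \<longrightarrow> \<gamma> x - G x $ i = 0" using main[of a b] by simp
  qed
  moreover have "AE x in lebesgue. x \<in> \<Omega> \<longrightarrow> g x $ i = \<gamma> x" using \<gamma>(1) by (auto simp: borel_rep_def)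
  ultimately show ?thesis by eventually_elim (use D K(2) in auto)
qed

text \<open>Both gradients have the same integrals against bumps. This is what makes the arbitrarily
  chosen \<open>weak_gradient\<close> of the zero function vanish almost everywhere.\<close>

lemma weak_gradient_unique:
  assumes \<Omega>: "open \<Omega>" "bounded \<Omega>" and u: "u \<in> L2 \<Omega>"
    and g: "L2_weak_gradient \<Omega> u g" and g': "L2_weak_gradient \<Omega> u g'"
  shows "AE x in lebesgue. x \<in> \<Omega> \<longrightarrow> g x $ i = g' x $ i"
proof -
  obtain w where w: "borel_rep \<Omega> u w" using L2_borel_rep[OF \<Omega> u] by metis
  have gi: "(\<lambda>x. g x $ i) \<in> L2 \<Omega>" "(\<lambda>x. g' x $ i) \<in> L2 \<Omega>"
    using g g' by (auto simp: L2_weak_gradient_def)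
  obtain \<gamma> where \<gamma>: "borel_rep \<Omega> (\<lambda>x. g x $ i) \<gamma>" "integrable lborel \<gamma>"
    using L2_borel_rep[OF \<Omega> gi(1)] by metis
  obtain \<gamma>' where \<gamma>': "borel_rep \<Omega> (\<lambda>x. g' x $ i) \<gamma>'" "integrable lborel \<gamma>'"
    using L2_borel_rep[OF \<Omega> gi(2)] by metis
  have int: "integrable lborel (\<lambda>x. \<gamma> x - \<gamma>' x)" using \<gamma> \<gamma>' by simp
  have "AE x in lebesgue. x \<in> \<Omega> \<longrightarrow> \<gamma> x - \<gamma>' x = 0"
  proof (rule AE_zero_of_bump_integrals[OF int \<Omega>(1)])
    fix n and a b :: "real^2" assume ab: "cbox a b \<subseteq> \<Omega>"
    let ?n = "real (Suc n)"
    let ?\<phi> = "bump 1 1 1 1 ?n a b"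
    have tf: "test_function \<Omega> ?\<phi>" using test_function_bump[of ?n a b \<Omega> 1 1 1 1 1] ab by auto
    have phim: "?\<phi> \<in> borel_measurable borel" using continuous_bump by (rule borel_measurable_continuous_onI)
    have "(\<integral>x. g x $ i * ?\<phi> x \<partial>lebesgue_on \<Omega>) = (\<integral>x. g' x $ i * ?\<phi> x \<partial>lebesgue_on \<Omega>)"
    proof -
      have "(\<integral>x. u x * frechet_derivative ?\<phi> (at x) (axis i 1) \<partial>lebesgue_on \<Omega>)
          = - (\<integral>x. h x $ i * ?\<phi> x \<partial>lebesgue_on \<Omega>)" if "L2_weak_gradient \<Omega> u h" for h
        using that tf unfolding L2_weak_gradient_def has_weak_gradient_def by blast
      from this[OF g] this[OF g'] show ?thesis by linarith
    qed
    then have "(\<integral>x. \<gamma> x * ?\<phi> x \<partial>lborel) = (\<integral>x. \<gamma>' x * ?\<phi> x \<partial>lborel)"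
      using borel_rep_integral(1)[OF \<Omega>(1) borel_rep_mult[OF \<gamma>(1) phim]]
        borel_rep_integral(1)[OF \<Omega>(1) borel_rep_mult[OF \<gamma>'(1) phim]] by simp
    moreover have "integrable lborel (\<lambda>x. \<gamma> x * ?\<phi> x)" "integrable lborel (\<lambda>x. \<gamma>' x * ?\<phi> x)"
      using integrable_mult_bounded_lborel[OF \<gamma>(2) phim, of 1]
        integrable_mult_bounded_lborel[OF \<gamma>'(2) phim, of 1] bump_1_bounds by auto
    ultimately show "(\<integral>x. (\<gamma> x - \<gamma>' x) * ?\<phi> x \<partial>lborel) = 0"
      by (simp add: left_diff_distrib)
  qed
  moreover have "AE x in lebesgue. x \<in> \<Omega> \<longrightarrow> g x $ i = \<gamma> x" "AE x in lebesgue. x \<in> \<Omega> \<longrightarrow> g' x $ i = \<gamma>' x"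
    using \<gamma>(1) \<gamma>'(1) by (auto simp: borel_rep_def)
  ultimately show ?thesis by eventually_elim auto
qed

section \<open>The inverse estimate on a square\<close>

definition pt :: "real \<Rightarrow> real \<Rightarrow> real^2" where
  "pt x y = (\<chi> i. if i = 1 then x else y)"

lemma pt_nth [simp]: "pt x y $ 1 = x" "pt x y $ 2 = y"
  by (simp_all add: pt_def)

lemma continuous_pt [continuous_intros]:
  "continuous_on S f \<Longrightarrow> continuous_on S g \<Longrightarrow> continuous_on S (\<lambda>x. pt (f x) (g x))"
  unfolding pt_def
proof (rule continuous_on_vec_lambda)
  fix i :: 2
  assume "continuous_on S f" "continuous_on S g"
  then show "continuous_on S (\<lambda>x. if i = 1 then f x else g x)" by (cases "i = 1") auto
qed

lemma mem_cbox_pt: "pt x y \<in> cbox (pt s s') (pt t t') \<longleftrightarrow> x \<in> {s..t} \<and> y \<in> {s'..t'}"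
  by (auto simp: mem_box_cart forall_2)

lemma pt_has_derivative:
  "((\<lambda>x. pt x y) has_derivative (\<lambda>t. t *\<^sub>R axis 1 1)) (at x within S)"
  "((\<lambda>y. pt x y) has_derivative (\<lambda>t. t *\<^sub>R axis 2 1)) (at y within S)"
proof -
  have 1: "pt x y = x *\<^sub>R axis 1 1 + y *\<^sub>R axis 2 1" for x y
    by (simp add: vec_eq_iff forall_2 axis_def)
  show "((\<lambda>x. pt x y) has_derivative (\<lambda>t. t *\<^sub>R axis 1 1)) (at x within S)"
    unfolding 1 by (auto intro!: derivative_eq_intros)
  show "((\<lambda>y. pt x y) has_derivative (\<lambda>t. t *\<^sub>R axis 2 1)) (at y within S)"
    unfolding 1 by (auto intro!: derivative_eq_intros)
qed

lemma prod_Basis_vec2: "(\<Prod>b\<in>Basis. (z :: real^2) \<bullet> b) = z $ 1 * z $ 2"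
proof -
  have B: "(Basis :: (real^2) set) = {axis 1 1, axis 2 1}"
    by (auto simp: Basis_vec_def UNIV_2)
  show ?thesis unfolding B by (simp add: inner_axis axis_eq_axis)
qed

lemma measurable_pt: "(\<lambda>p. pt (fst p) (snd p)) \<in> borel_measurable (lborel \<Otimes>\<^sub>M lborel)"
proof -
  have "(\<lambda>p. pt (fst p) (snd p)) \<in> borel_measurable borel"
    by (intro borel_measurable_continuous_onI continuous_intros)
  then show ?thesis by (simp add: lborel_prod)
qed

text \<open>\<open>lborel\<close> is determined by its values on boxes. The identification with a
  product measure is the basis of Fubini's theorem for \<open>real^2\<close>.\<close>

lemma lborel_vec2: "(lborel :: (real^2) measure) = distr (lborel \<Otimes>\<^sub>M lborel) borel (\<lambda>p. pt (fst p) (snd p))"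
proof (rule lborel_eqI)
  fix l u :: "real^2" assume le: "\<And>b. b \<in> Basis \<Longrightarrow> l \<bullet> b \<le> u \<bullet> b"
  have le': "l $ 1 \<le> u $ 1" "l $ 2 \<le> u $ 2"
    using le[of "axis 1 1"] le[of "axis 2 1"] by (auto simp: inner_axis axis_in_Basis_iff)
  have v: "(\<lambda>p. pt (fst p) (snd p)) -` box l u \<inter> space (lborel \<Otimes>\<^sub>M lborel)
      = {l $ 1<..<u $ 1} \<times> {l $ 2<..<u $ 2}"
    by (auto simp: mem_box_cart forall_2 space_pair_measure)
  have "emeasure (distr (lborel \<Otimes>\<^sub>M lborel) borel (\<lambda>p. pt (fst p) (snd p))) (box l u)
      = emeasure (lborel \<Otimes>\<^sub>M lborel) ({l $ 1<..<u $ 1} \<times> {l $ 2<..<u $ 2})"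
    using measurable_pt by (subst emeasure_distr) (auto simp: v)
  also have "\<dots> = emeasure lborel {l $ 1<..<u $ 1} * emeasure lborel {l $ 2<..<u $ 2}"
    by (intro lborel.emeasure_pair_measure_Times) auto
  also have "\<dots> = ennreal ((u $ 1 - l $ 1) * (u $ 2 - l $ 2))"
    using le' by (simp add: ennreal_mult)
  also have "\<dots> = (\<Prod>b\<in>Basis. (u - l) \<bullet> b)" unfolding prod_Basis_vec2 by simp
  finally show "emeasure (distr (lborel \<Otimes>\<^sub>M lborel) borel (\<lambda>p. pt (fst p) (snd p))) (box l u)
      = (\<Prod>b\<in>Basis. (u - l) \<bullet> b)" .
qed simp

lemma nn_integral_vec2:
  fixes f :: "real^2 \<Rightarrow> ennreal"
  assumes f: "f \<in> borel_measurable borel"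
  shows "(\<integral>\<^sup>+ z. f z \<partial>lborel) = (\<integral>\<^sup>+ x. \<integral>\<^sup>+ y. f (pt x y) \<partial>lborel \<partial>lborel)"
    and "(\<integral>\<^sup>+ z. f z \<partial>lborel) = (\<integral>\<^sup>+ y. \<integral>\<^sup>+ x. f (pt x y) \<partial>lborel \<partial>lborel)"
    and "(\<lambda>x. \<integral>\<^sup>+ y. f (pt x y) \<partial>lborel) \<in> borel_measurable borel"
    and "(\<lambda>y. \<integral>\<^sup>+ x. f (pt x y) \<partial>lborel) \<in> borel_measurable borel"
proof -
  have m: "(\<lambda>p. f (pt (fst p) (snd p))) \<in> borel_measurable (lborel \<Otimes>\<^sub>M lborel)"
    using measurable_compose[OF measurable_pt f] .
  have 1: "(\<integral>\<^sup>+ z. f z \<partial>lborel) = (\<integral>\<^sup>+ p. f (pt (fst p) (snd p)) \<partial>(lborel \<Otimes>\<^sub>M lborel))"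
    using f measurable_pt by (subst lborel_vec2, subst nn_integral_distr) auto
  show *: "(\<integral>\<^sup>+ z. f z \<partial>lborel) = (\<integral>\<^sup>+ x. \<integral>\<^sup>+ y. f (pt x y) \<partial>lborel \<partial>lborel)"
    unfolding 1 using lborel.nn_integral_fst[OF m] by simp
  have m': "(\<lambda>(x, y). f (pt x y)) \<in> borel_measurable (lborel \<Otimes>\<^sub>M lborel)"
    using m by (simp add: case_prod_beta)
  show "(\<integral>\<^sup>+ z. f z \<partial>lborel) = (\<integral>\<^sup>+ y. \<integral>\<^sup>+ x. f (pt x y) \<partial>lborel \<partial>lborel)"
    unfolding * using lborel_pair.Fubini'[OF m'] by simp
  show "(\<lambda>x. \<integral>\<^sup>+ y. f (pt x y) \<partial>lborel) \<in> borel_measurable borel"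
    using lborel.borel_measurable_nn_integral_fst[OF m] by simp
  show "(\<lambda>y. \<integral>\<^sup>+ x. f (pt x y) \<partial>lborel) \<in> borel_measurable borel"
  proof -
    have "(\<lambda>p. pt (snd p) (fst p)) \<in> borel_measurable borel"
      by (intro borel_measurable_continuous_onI continuous_intros)
    then have "(\<lambda>p. pt (snd p) (fst p)) \<in> borel_measurable (lborel \<Otimes>\<^sub>M lborel)"
      by (simp add: lborel_prod)
    from lborel.borel_measurable_nn_integral_fst[OF measurable_compose[OF this f]]
    show ?thesis by simp
  qed
qed

section \<open>From parallel lines to the square\<close>

lemma measurable_continuous_times_indicator:
  fixes g :: "real^2 \<Rightarrow> real"
  assumes "continuous_on S g" "S \<in> sets borel"
  shows "(\<lambda>z. ennreal (g z) * indicator S z) \<in> borel_measurable borel"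
proof -
  have "(\<lambda>z. indicator S z *\<^sub>R g z) \<in> borel_measurable borel"
    using assms by (intro borel_measurable_continuous_on_indicator) auto
  then have "(\<lambda>z. ennreal (indicator S z *\<^sub>R g z)) \<in> borel_measurable borel" by simp
  moreover have "(\<lambda>z. ennreal (indicator S z *\<^sub>R g z)) = (\<lambda>z. ennreal (g z) * indicator S z)"
    by (rule ext) (auto simp: indicator_def)
  ultimately show ?thesis by simp
qed

text \<open>The one-dimensional inequality is integrated over a family of parallel lines. In
  \<open>\<sigma> x y\<close> the variable \<open>x\<close> runs along a line and \<open>y\<close>
  selects it; the two choices of \<open>\<sigma>\<close> treat horizontal and vertical lines
  together.\<close>

lemma square_estimate_of_slices:
  fixes g h k :: "real^2 \<Rightarrow> real" and \<sigma> :: "real \<Rightarrow> real \<Rightarrow> real^2"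
  assumes \<sigma>: "\<sigma> = pt \<or> \<sigma> = (\<lambda>x y. pt y x)" and cd: "0 \<le> c" "0 \<le> d"
    and cont: "continuous_on (cbox (pt s s) (pt t t)) g" "continuous_on (cbox (pt s s) (pt t t)) h"
      "continuous_on (cbox (pt s s) (pt t t)) k"
    and nn: "\<And>z. 0 \<le> g z" "\<And>z. 0 \<le> h z" "\<And>z. 0 \<le> k z"
    and slice: "\<And>y. y \<in> {s..t} \<Longrightarrow> integral {s..t} (\<lambda>x. g (\<sigma> x y))
      \<le> c * integral {s..t} (\<lambda>x. h (\<sigma> x y)) + d * integral {s..t} (\<lambda>x. k (\<sigma> x y))"
  shows "(\<integral>\<^sup>+ z\<in>cbox (pt s s) (pt t t). ennreal (g z) \<partial>lborel)
    \<le> ennreal c * (\<integral>\<^sup>+ z\<in>cbox (pt s s) (pt t t). ennreal (h z) \<partial>lborel)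
      + ennreal d * (\<integral>\<^sup>+ z\<in>cbox (pt s s) (pt t t). ennreal (k z) \<partial>lborel)"
proof -
  let ?B = "cbox (pt s s) (pt t t)"
  have meas: "(\<lambda>z. ennreal (f z) * indicator ?B z) \<in> borel_measurable borel"
    if "continuous_on ?B f" for f :: "real^2 \<Rightarrow> real"
    using that by (rule measurable_continuous_times_indicator) simp
  define I where "I f y = (\<integral>\<^sup>+ x. ennreal (f (\<sigma> x y)) * indicator ?B (\<sigma> x y) \<partial>lborel)"
    for f :: "real^2 \<Rightarrow> real" and y
  have I: "(\<integral>\<^sup>+ z\<in>?B. ennreal (f z) \<partial>lborel) = (\<integral>\<^sup>+ y. I f y \<partial>lborel)"
    "I f \<in> borel_measurable borel" if "continuous_on ?B f" for f
    using \<sigma> nn_integral_vec2[OF meas[OF that]] by (auto simp: I_def[abs_def])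
  have I_in: "I f y = ennreal (integral {s..t} (\<lambda>x. f (\<sigma> x y)))"
    if f: "continuous_on ?B f" "\<And>z. 0 \<le> f z" and y: "y \<in> {s..t}" for f y
  proof -
    have mem: "\<sigma> x y \<in> ?B \<longleftrightarrow> x \<in> {s..t}" for x using \<sigma> y by (auto simp: mem_cbox_pt)
    have c\<sigma>: "continuous_on {s..t} (\<lambda>x. \<sigma> x y)" using \<sigma> by (auto intro!: continuous_intros)
    have cf: "continuous_on {s..t} (\<lambda>x. f (\<sigma> x y))"
      by (rule continuous_on_compose2[OF f(1) c\<sigma>]) (use mem in blast)
    have "((\<lambda>x. f (\<sigma> x y)) has_integral integral {s..t} (\<lambda>x. f (\<sigma> x y))) {s..t}"
      using cf by (intro integrable_integral integrable_continuous_real)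
    then have "(\<integral>\<^sup>+ x. ennreal (f (\<sigma> x y)) * indicator {s..t} x \<partial>lborel) = ennreal (integral {s..t} (\<lambda>x. f (\<sigma> x y)))"
      by (rule nn_integral_has_integral_lebesgue'[rotated]) (rule f(2))
    moreover have "I f y = (\<integral>\<^sup>+ x. ennreal (f (\<sigma> x y)) * indicator {s..t} x \<partial>lborel)"
      unfolding I_def
    proof (intro nn_integral_cong)
      show "ennreal (f (\<sigma> x y)) * indicator ?B (\<sigma> x y) = ennreal (f (\<sigma> x y)) * indicator {s..t} x" for x
        using mem[of x] by (simp add: indicator_def)
    qed
    ultimately show ?thesis by simp
  qed
  have I_out: "I f y = 0" if "y \<notin> {s..t}" for f y
  proof -
    have "\<sigma> x y \<notin> ?B" for x using \<sigma> that by (auto simp: mem_cbox_pt)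
    then show ?thesis by (simp add: I_def)
  qed
  \<comment> \<open>The integral of a non-integrable function is 0 by convention, so the claim holds
    for every nonnegative \<open>f\<close>.\<close>
  have int0: "0 \<le> integral {s..t} (\<lambda>x. f (\<sigma> x y))" if "\<And>z. 0 \<le> f z" for f :: "real^2 \<Rightarrow> real" and y
  proof (cases "(\<lambda>x. f (\<sigma> x y)) integrable_on {s..t}")
    case True
    then show ?thesis by (rule integral_nonneg) (rule that)
  next
    case False
    then have "integral {s..t} (\<lambda>x. f (\<sigma> x y)) = 0" by (rule not_integrable_integral)
    then show ?thesis by (rule eq_refl[OF sym])
  qed
  have "I g y \<le> ennreal c * I h y + ennreal d * I k y" for y
  proof (cases "y \<in> {s..t}")
    case True
    have "ennreal (integral {s..t} (\<lambda>x. g (\<sigma> x y)))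
      \<le> ennreal (c * integral {s..t} (\<lambda>x. h (\<sigma> x y)) + d * integral {s..t} (\<lambda>x. k (\<sigma> x y)))"
      using slice[OF True] by (rule ennreal_leI)
    moreover have "0 \<le> integral {s..t} (\<lambda>x. h (\<sigma> x y))" "0 \<le> integral {s..t} (\<lambda>x. k (\<sigma> x y))"
      by (rule int0, rule nn)+
    ultimately show ?thesis
      using cd
      by (simp add: I_in[OF cont(1) nn(1) True] I_in[OF cont(2) nn(2) True] I_in[OF cont(3) nn(3) True]
          ennreal_mult ennreal_plus)
  qed (simp add: I_out)
  then have "(\<integral>\<^sup>+ y. I g y \<partial>lborel) \<le> (\<integral>\<^sup>+ y. ennreal c * I h y + ennreal d * I k y \<partial>lborel)"
    by (intro nn_integral_mono)
  also have "\<dots> = ennreal c * (\<integral>\<^sup>+ y. I h y \<partial>lborel) + ennreal d * (\<integral>\<^sup>+ y. I k y \<partial>lborel)"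
    using I(2)[OF cont(2)] I(2)[OF cont(3)] by (simp add: nn_integral_add nn_integral_cmult)
  finally show ?thesis by (simp only: I(1)[OF cont(1)] I(1)[OF cont(2)] I(1)[OF cont(3)])
qed

text \<open>Only restrictions to axis-parallel lines enter the estimate, and a bound on their
  degrees is available for both polynomial spaces after an affine change of coordinates. The degree
  on a line is at most \<open>n - 1\<close>.\<close>

definition slicewise_poly :: "nat \<Rightarrow> (real^2 \<Rightarrow> real) \<Rightarrow> bool" where
  "slicewise_poly n q \<longleftrightarrow>
     (\<forall>y. \<exists>p. coeffs_below n p \<and> (\<forall>x. q (pt x y) = poly p x)) \<and>
     (\<forall>x. \<exists>p. coeffs_below n p \<and> (\<forall>y. q (pt x y) = poly p y))"

text \<open>Lines in direction \<open>i\<close> see exactly the \<open>i\<close>-th partial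
  derivatives, so the estimate holds for each component separately.\<close>

lemma inverse_estimate_square:
  fixes q f :: "real^2 \<Rightarrow> real" and Q G :: "real^2 \<Rightarrow> real^2"
  assumes st: "s < t" and n: "1 \<le> n" and q: "slicewise_poly n q"
    and Q: "\<And>z. z \<in> cbox (pt s s) (pt t t) \<Longrightarrow> (q has_derivative (\<lambda>v. Q z \<bullet> v)) (at z)"
      "continuous_on (cbox (pt s s) (pt t t)) Q"
    and f: "\<And>z. z \<in> cbox (pt s s) (pt t t) \<Longrightarrow> (f has_derivative (\<lambda>v. G z \<bullet> v)) (at z)"
      "continuous_on (cbox (pt s s) (pt t t)) G"
  shows "(\<integral>\<^sup>+ z\<in>cbox (pt s s) (pt t t). ennreal ((Q z $ i)\<^sup>2) \<partial>lborel)
    \<le> ennreal 16 * (\<integral>\<^sup>+ z\<in>cbox (pt s s) (pt t t). ennreal ((G z $ i)\<^sup>2) \<partial>lborel)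
      + ennreal (1024 * ((real n)^4 / (t - s)\<^sup>2))
        * (\<integral>\<^sup>+ z\<in>cbox (pt s s) (pt t t). ennreal ((q z - f z)\<^sup>2) \<partial>lborel)"
proof -
  let ?B = "cbox (pt s s) (pt t t)"
  define \<sigma> where "\<sigma> = (if i = 1 then pt else (\<lambda>x y. pt y x))"
  have \<sigma>: "\<sigma> = pt \<or> \<sigma> = (\<lambda>x y. pt y x)" by (simp add: \<sigma>_def)
  have i12: "i = 1 \<or> i = 2" by (rule exhaust_2)
  have \<sigma>d: "((\<lambda>x. \<sigma> x y) has_derivative (\<lambda>t. t *\<^sub>R axis i 1)) (at x within S)" for x y S
    using i12 pt_has_derivative by (auto simp: \<sigma>_def)
  have cq: "continuous_on ?B q" and cf: "continuous_on ?B f"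
    using Q(1) f(1) by (auto intro!: continuous_at_imp_continuous_on dest: has_derivative_continuous)
  show ?thesis
  proof (rule square_estimate_of_slices[OF \<sigma>])
    show "continuous_on ?B (\<lambda>z. (Q z $ i)\<^sup>2)" "continuous_on ?B (\<lambda>z. (G z $ i)\<^sup>2)"
      "continuous_on ?B (\<lambda>z. (q z - f z)\<^sup>2)"
      by (intro continuous_intros Q f cq cf)+
    fix y assume y: "y \<in> {s..t}"
    have mem: "\<sigma> x y \<in> ?B" if "x \<in> {s..t}" for x using \<sigma> y that by (auto simp: mem_cbox_pt)
    have "\<exists>p. coeffs_below n p \<and> (\<forall>x. q (\<sigma> x y) = poly p x)"
      using q by (cases "i = 1") (simp_all add: slicewise_poly_def \<sigma>_def)
    then obtain p where p: "coeffs_below n p" "\<And>x. q (\<sigma> x y) = poly p x" by blast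
    have deriv: "((\<lambda>x. r (\<sigma> x y)) has_real_derivative R (\<sigma> x y) $ i) (at x within S)"
      if "x \<in> {s..t}" and r: "\<And>z. z \<in> ?B \<Longrightarrow> (r has_derivative (\<lambda>v. R z \<bullet> v)) (at z)"
      for r R x S
    proof -
      have "((\<lambda>x. r (\<sigma> x y)) has_derivative (\<lambda>t. R (\<sigma> x y) \<bullet> (t *\<^sub>R axis i 1))) (at x within S)"
        by (rule has_derivative_compose[OF \<sigma>d r[OF mem[OF that(1)]]])
      then show ?thesis
        by (simp add: has_field_derivative_def inner_axis mult_commute_abs)
    qed
    have pd: "poly (pderiv p) x = Q (\<sigma> x y) $ i" if "x \<in> {s..t}" for x
    proof -
      have "((\<lambda>x. q (\<sigma> x y)) has_real_derivative poly (pderiv p) x) (at x)"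
        unfolding p(2) by (rule poly_DERIV)
      from DERIV_unique[OF this deriv[OF that Q(1)]] show ?thesis .
    qed
    have c\<sigma>: "continuous_on {s..t} (\<lambda>x. \<sigma> x y)" using \<sigma> by (auto intro!: continuous_intros)
    have cG: "continuous_on {s..t} (\<lambda>x. G (\<sigma> x y) $ i)"
      by (intro continuous_intros continuous_on_compose2[OF f(2) c\<sigma>] image_subsetI mem)
    have "integral {s..t} (\<lambda>x. (poly (pderiv p) x)\<^sup>2)
      \<le> 16 * integral {s..t} (\<lambda>x. (G (\<sigma> x y) $ i)\<^sup>2)
        + 1024 * ((real n)^4 / (t - s)\<^sup>2) * integral {s..t} (\<lambda>x. (poly p x - f (\<sigma> x y))\<^sup>2)"
      using deriv[OF _ f(1)] by (intro inverse_estimate_interval st p n cG) auto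
    moreover have "integral {s..t} (\<lambda>x. (poly (pderiv p) x)\<^sup>2) = integral {s..t} (\<lambda>x. (Q (\<sigma> x y) $ i)\<^sup>2)"
      by (intro Henstock_Kurzweil_Integration.integral_cong) (simp add: pd)
    ultimately show "integral {s..t} (\<lambda>x. (Q (\<sigma> x y) $ i)\<^sup>2)
      \<le> 16 * integral {s..t} (\<lambda>x. (G (\<sigma> x y) $ i)\<^sup>2)
        + 1024 * ((real n)^4 / (t - s)\<^sup>2) * integral {s..t} (\<lambda>x. (q (\<sigma> x y) - f (\<sigma> x y))\<^sup>2)"
      by (simp add: p(2))
  qed auto
qed

section \<open>The inverse estimate on images of a square\<close>

lemma norm_sq_vec2: "(norm (v :: real^2))\<^sup>2 = (v $ 1)\<^sup>2 + (v $ 2)\<^sup>2"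
  unfolding power2_norm_eq_inner by (simp add: inner_vec_def sum_2 power2_eq_square)

text \<open>The columns of \<open>A\<close> have norm at most \<open>M\<close>, and by Lagrange's
  identity the product of their squared norms is \<open>det A\<close> squared plus the square of
  their inner product.\<close>

lemma abs_det2_le:
  fixes A :: "real^2^2"
  assumes "\<And>v. norm (A *v v) \<le> M * norm v"
  shows "\<bar>det A\<bar> \<le> M\<^sup>2"
proof -
  have "0 \<le> M * norm (axis 1 1 :: real^2)"
    using assms[of "axis 1 1"] norm_ge_zero[of "A *v axis 1 1"] by linarith
  then have M: "0 \<le> M" by simp
  have c: "(A $ 1 $ j)\<^sup>2 + (A $ 2 $ j)\<^sup>2 \<le> M\<^sup>2" for j
  proof -
    have "A *v axis j 1 = (\<chi> i. A $ i $ j)"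
      by (simp add: matrix_vector_mult_basis column_def)
    then have "norm (\<chi> i. A $ i $ j) \<le> M" using assms[of "axis j 1"] by simp
    then have "(norm (\<chi> i. A $ i $ j))\<^sup>2 \<le> M\<^sup>2" by (intro power_mono) auto
    then show ?thesis unfolding norm_sq_vec2 by simp
  qed
  have "(det A)\<^sup>2 + (A$1$1 * A$1$2 + A$2$1 * A$2$2)\<^sup>2
      = ((A $ 1 $ 1)\<^sup>2 + (A $ 2 $ 1)\<^sup>2) * ((A $ 1 $ 2)\<^sup>2 + (A $ 2 $ 2)\<^sup>2)"
    by (simp add: det_2 power2_eq_square algebra_simps)
  also have "\<dots> \<le> M\<^sup>2 * M\<^sup>2" by (intro mult_mono c add_nonneg_nonneg zero_le_power2)
  finally have "(det A)\<^sup>2 \<le> (M\<^sup>2)\<^sup>2"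
    using zero_le_power2[of "A$1$1 * A$1$2 + A$2$1 * A$2$2"] unfolding power2_eq_square[of "M\<^sup>2"] by linarith
  then show ?thesis using abs_le_square_iff[of "det A" "M\<^sup>2"] by simp
qed

text \<open>The lower bound makes \<open>A\<close> injective, hence invertible with an inverse of
  norm at most \<open>1 / m\<close>; the upper bound for determinants is applied to the
  inverse.\<close>

lemma abs_det2_ge:
  fixes A :: "real^2^2"
  assumes m: "0 < m" and A: "\<And>v. m * norm v \<le> norm (A *v v)"
  shows "m\<^sup>2 \<le> \<bar>det A\<bar>" and "\<exists>B. A ** B = mat 1 \<and> B ** A = mat 1"
proof -
  have "x = 0" if "A *v x = 0" for x
    using A[of x] m that by (simp add: mult_le_0_iff)
  then obtain B where B: "B ** A = mat 1" using matrix_left_invertible_ker by blast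
  then have B': "A ** B = mat 1" by (simp add: matrix_left_right_inverse)
  show "\<exists>B. A ** B = mat 1 \<and> B ** A = mat 1" using B B' by blast
  have "norm (B *v w) \<le> (1 / m) * norm w" for w
  proof -
    have "m * norm (B *v w) \<le> norm (A *v (B *v w))" by (rule A)
    also have "A *v (B *v w) = w" by (simp add: matrix_vector_mul_assoc B')
    finally show ?thesis using m by (simp add: field_simps)
  qed
  then have "\<bar>det B\<bar> \<le> (1 / m)\<^sup>2" by (rule abs_det2_le)
  moreover have "\<bar>det A\<bar> * \<bar>det B\<bar> = 1"
    using B' det_mul[of A B] by (simp add: abs_mult[symmetric])
  ultimately have "1 \<le> \<bar>det A\<bar> * (1 / m)\<^sup>2"
    by (metis abs_ge_zero mult_left_mono)
  then show "m\<^sup>2 \<le> \<bar>det A\<bar>" using m by (simp add: field_simps)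
qed

text \<open>Gradients are pulled back with the transposed Jacobian. The upper bound follows by
  testing with \<open>transpose A *v w\<close> itself, the lower one by writing \<open>w\<close> as
  \<open>A *v (B *v w)\<close>.\<close>

lemma norm_transpose_bounds:
  fixes A :: "real^2^2"
  shows "(\<And>v. norm (A *v v) \<le> M * norm v) \<Longrightarrow> norm (transpose A *v w) \<le> M * norm w"
    and "0 < m \<Longrightarrow> (\<And>v. m * norm v \<le> norm (A *v v)) \<Longrightarrow> m * norm w \<le> norm (transpose A *v w)"
proof -
  have tr: "(transpose A *v w) \<bullet> v = w \<bullet> (A *v v)" for v
    by (metis dot_lmul_matrix inner_commute transpose_matrix_vector)
  show "norm (transpose A *v w) \<le> M * norm w" if A: "\<And>v. norm (A *v v) \<le> M * norm v"
  proof (cases "transpose A *v w = 0")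
    case True
    have "0 \<le> M * norm w" if "w \<noteq> 0"
    proof -
      have "0 \<le> M * norm (axis 1 1 :: real^2)"
        using A[of "axis 1 1"] norm_ge_zero[of "A *v axis 1 1"] by linarith
      then show ?thesis by simp
    qed
    with True show ?thesis by (cases "w = 0") auto
  next
    case False
    let ?v = "transpose A *v w"
    have "norm ?v * norm ?v = ?v \<bullet> ?v" by (simp only: dot_square_norm power2_eq_square)
    also have "\<dots> = w \<bullet> (A *v ?v)" by (rule tr)
    also have "\<dots> \<le> norm w * (M * norm ?v)"
      using norm_cauchy_schwarz[of w "A *v ?v"] mult_left_mono[OF A[of ?v] norm_ge_zero[of w]] by linarith
    finally have "norm ?v * norm ?v \<le> (M * norm w) * norm ?v" by (simp only: ac_simps)
    then show ?thesis by (rule mult_right_le_imp_le) (simp only: zero_less_norm_iff False not_False_eq_True)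
  qed
  show "m * norm w \<le> norm (transpose A *v w)" if m: "0 < m" and A: "\<And>v. m * norm v \<le> norm (A *v v)"
  proof (cases "w = 0")
    case False
    obtain B where "A ** B = mat 1" using abs_det2_ge(2)[OF m A] by blast
    then have w: "A *v (B *v w) = w" by (simp add: matrix_vector_mul_assoc)
    have "norm w * norm w = w \<bullet> (A *v (B *v w))" by (simp only: w dot_square_norm power2_eq_square)
    also have "\<dots> = (transpose A *v w) \<bullet> (B *v w)" by (rule tr[symmetric])
    also have "\<dots> \<le> norm (transpose A *v w) * norm (B *v w)" by (rule norm_cauchy_schwarz)
    finally have "m * (norm w * norm w) \<le> m * (norm (transpose A *v w) * norm (B *v w))"
      using m by (intro mult_left_mono) auto
    also have "\<dots> = norm (transpose A *v w) * (m * norm (B *v w))" by (simp only: ac_simps)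
    also have "\<dots> \<le> norm (transpose A *v w) * norm w"
      using A[of "B *v w"] unfolding w by (intro mult_left_mono) auto
    finally have "(m * norm w) * norm w \<le> norm (transpose A *v w) * norm w" by (simp only: mult.assoc)
    then show ?thesis by (rule mult_right_le_imp_le) (simp only: zero_less_norm_iff False not_False_eq_True)
  qed simp
qed

declare transpose_matrix_vector [simp del]

section \<open>Change of variables with a bounded Jacobian\<close>

lemma nn_integral_compact_eq:
  fixes k :: "real^2 \<Rightarrow> real"
  assumes "compact S" "continuous_on S k"
  shows "k integrable_on S"
    and "(\<And>z. 0 \<le> k z) \<Longrightarrow> (\<integral>\<^sup>+x\<in>S. ennreal (k x) \<partial>lborel) = ennreal (integral S k)"
proof -
  have "set_integrable lborel S k"
    unfolding set_integrable_def using assms by (intro borel_integrable_compact)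
  then show i: "k integrable_on S" by (rule set_borel_integral_eq_integral)
  show "(\<integral>\<^sup>+x\<in>S. ennreal (k x) \<partial>lborel) = ennreal (integral S k)" if "\<And>z. 0 \<le> k z"
    by (rule nn_integral_has_integral_lebesgue'[OF that integrable_integral[OF i]])
qed

text \<open>The absolute value of the Jacobian determinant lies between \<open>m^2\<close> and
  \<open>M^2\<close>. On compact sets all integrals are finite, so the formula is applied to real
  integrals and then transferred.\<close>

lemma nn_integral_change_of_variables_bounds:
  fixes \<Phi> :: "real^2 \<Rightarrow> real^2" and J :: "real^2 \<Rightarrow> real^2^2" and k :: "real^2 \<Rightarrow> real"
  assumes S: "compact S" and inj: "inj_on \<Phi> S"
    and d: "\<And>z. z \<in> S \<Longrightarrow> (\<Phi> has_derivative (\<lambda>v. J z *v v)) (at z within S)" and J: "continuous_on S J"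
    and m: "0 < m" and bounds: "\<And>z v. z \<in> S \<Longrightarrow> m * norm v \<le> norm (J z *v v)"
      "\<And>z v. z \<in> S \<Longrightarrow> norm (J z *v v) \<le> M * norm v"
    and k: "continuous_on (\<Phi> ` S) k" "\<And>z. 0 \<le> k z"
  shows "(\<integral>\<^sup>+x\<in>\<Phi> ` S. ennreal (k x) \<partial>lborel) \<le> ennreal (M\<^sup>2) * (\<integral>\<^sup>+z\<in>S. ennreal (k (\<Phi> z)) \<partial>lborel)"
    and "ennreal (m\<^sup>2) * (\<integral>\<^sup>+z\<in>S. ennreal (k (\<Phi> z)) \<partial>lborel) \<le> (\<integral>\<^sup>+x\<in>\<Phi> ` S. ennreal (k x) \<partial>lborel)"
proof -
  have c\<Phi>: "continuous_on S \<Phi>"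
    unfolding continuous_on_eq_continuous_within by (intro ballI has_derivative_continuous[OF d])
  have ck: "continuous_on S (\<lambda>z. k (\<Phi> z))"
    by (rule continuous_on_compose2[OF k(1) c\<Phi>]) blast
  have cdet: "continuous_on S (\<lambda>z. \<bar>det (J z)\<bar>)"
    unfolding det_2 by (intro continuous_intros J)
  let ?D = "\<lambda>z. \<bar>det (J z)\<bar> * k (\<Phi> z)"
  have cD: "continuous_on S ?D" by (intro continuous_on_mult cdet ck)
  have S': "compact (\<Phi> ` S)" using c\<Phi> S by (rule compact_continuous_image)
  note iD = nn_integral_compact_eq[OF S cD]
  note ik = nn_integral_compact_eq[OF S ck]
  note ik' = nn_integral_compact_eq[OF S' k(1)]
  \<comment> \<open>The real function \<open>k\<close> enters the change of variables formula as a
    function into \<open>real^1\<close>.\<close>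
  have "(\<lambda>x. vec (k x) :: real^1) absolutely_integrable_on (\<Phi> ` S)"
    unfolding absolutely_integrable_on_1_iff using ik'(1) k(2)
    by (auto intro: nonnegative_absolutely_integrable_1)
  then have "integral S (\<lambda>z. \<bar>det (matrix (\<lambda>v. J z *v v))\<bar> *\<^sub>R (vec (k (\<Phi> z)) :: real^1))
      = integral (\<Phi> ` S) (\<lambda>x. vec (k x))"
    using has_absolute_integral_change_of_variables_compact[OF S d inj, where f = "\<lambda>x. vec (k x) :: real^1"]
    by blast
  then have eq: "integral S ?D = integral (\<Phi> ` S) k"
    unfolding integral_on_1_eq by (simp add: vec_eq_iff)
  show "(\<integral>\<^sup>+x\<in>\<Phi> ` S. ennreal (k x) \<partial>lborel) \<le> ennreal (M\<^sup>2) * (\<integral>\<^sup>+z\<in>S. ennreal (k (\<Phi> z)) \<partial>lborel)"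
  proof -
    have "integral S ?D \<le> integral S (\<lambda>z. M\<^sup>2 * k (\<Phi> z))"
      using iD(1) ik(1) k(2) abs_det2_le[OF bounds(2)]
      by (intro integral_le) (auto intro: mult_right_mono integrable_on_mult_right)
    then have "integral (\<Phi> ` S) k \<le> M\<^sup>2 * integral S (\<lambda>z. k (\<Phi> z))" by (simp add: eq)
    then show ?thesis unfolding ik(2)[OF k(2)] ik'(2)[OF k(2)]
      by (simp add: ennreal_mult' [symmetric] ennreal_leI)
  qed
  show "ennreal (m\<^sup>2) * (\<integral>\<^sup>+z\<in>S. ennreal (k (\<Phi> z)) \<partial>lborel) \<le> (\<integral>\<^sup>+x\<in>\<Phi> ` S. ennreal (k x) \<partial>lborel)"
  proof -
    have "integral S (\<lambda>z. m\<^sup>2 * k (\<Phi> z)) \<le> integral S ?D"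
      using iD(1) ik(1) k(2) abs_det2_ge(1)[OF m bounds(1)]
      by (intro integral_le) (auto intro: mult_right_mono integrable_on_mult_right)
    then have "m\<^sup>2 * integral S (\<lambda>z. k (\<Phi> z)) \<le> integral (\<Phi> ` S) k" by (simp add: eq)
    then show ?thesis unfolding ik(2)[OF k(2)] ik'(2)[OF k(2)]
      by (simp add: ennreal_mult' [symmetric] ennreal_leI)
  qed
qed

text \<open>Used with \<open>a = m^2\<close> and \<open>b = M^2\<close>; each of these factors comes
  from a change of variables or from the transposed Jacobian. In \<open>ennreal\<close> the factors
  \<open>a\<close> are not divided out but collected on the left.\<close>

lemma ennreal_chain:
  fixes a b c :: ennreal
  assumes "D \<le> b * x" "a * x \<le> y" "y \<le> 16 * z + 2 * c * w" "z \<le> b * h" "a * h \<le> \<Gamma>" "a * w \<le> X"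
  shows "a * a * D \<le> b * (16 * b * \<Gamma> + 2 * c * X)"
proof -
  have "a * a * D \<le> a * a * (b * x)" by (intro mult_left_mono assms) simp
  also have "\<dots> = a * b * (a * x)" by (simp only: ac_simps)
  also have "\<dots> \<le> a * b * y" by (intro mult_left_mono assms) simp
  also have "\<dots> \<le> a * b * (16 * z + 2 * c * w)" by (intro mult_left_mono assms) simp
  also have "\<dots> \<le> a * b * (16 * (b * h) + 2 * c * w)"
    by (intro mult_left_mono add_right_mono assms) simp_all
  also have "\<dots> = b * (16 * b * (a * h) + 2 * c * (a * w))"
    by (simp only: distrib_left ac_simps)
  also have "\<dots> \<le> b * (16 * b * \<Gamma> + 2 * c * X)"
    by (intro mult_left_mono add_mono assms) simp_all
  finally show ?thesis .
qed

text \<open>\<open>V\<close> has to be mollified because it is only weakly differentiable, so that the estimate on the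
  square is first applied on smaller squares.\<close>

context
  fixes \<Phi> :: "real^2 \<Rightarrow> real^2" and J :: "real^2 \<Rightarrow> real^2^2" and f V :: "real^2 \<Rightarrow> real"
    and Gf :: "real^2 \<Rightarrow> real^2" and \<gamma> :: "2 \<Rightarrow> real^2 \<Rightarrow> real" and q :: "real^2 \<Rightarrow> real"
    and K :: "(real^2) set" and n :: nat and m M :: real
  assumes n: "1 \<le> n"
    and K: "open K" "\<Phi> ` box (pt 0 0) (pt 1 1) \<subseteq> K" and inj: "inj_on \<Phi> (box (pt 0 0) (pt 1 1))"
    and d: "\<And>z. z \<in> box (pt 0 0) (pt 1 1) \<Longrightarrow> (\<Phi> has_derivative (\<lambda>v. J z *v v)) (at z)"
    and J: "continuous_on (box (pt 0 0) (pt 1 1)) J"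
    and m: "0 < m" and bounds: "\<And>z v. z \<in> box (pt 0 0) (pt 1 1) \<Longrightarrow> m * norm v \<le> norm (J z *v v)"
      "\<And>z v. z \<in> box (pt 0 0) (pt 1 1) \<Longrightarrow> norm (J z *v v) \<le> M * norm v"
    and f: "\<And>x. x \<in> K \<Longrightarrow> (f has_derivative (\<lambda>v. Gf x \<bullet> v)) (at x)" "continuous_on K Gf"
    and q: "slicewise_poly n q" "\<And>z. z \<in> box (pt 0 0) (pt 1 1) \<Longrightarrow> q z = f (\<Phi> z)"
    and V: "integrable lborel V" and \<gamma>: "\<And>i. integrable lborel (\<gamma> i)" "\<And>i. integrable lborel (\<lambda>x. (\<gamma> i x)\<^sup>2)"
    and wk: "\<And>\<phi> r i. test_function K \<phi> \<Longrightarrow> (\<And>x. (\<phi> has_derivative (\<lambda>v. r x \<bullet> v)) (at x)) \<Longrightarrow>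
      continuous_on UNIV r \<Longrightarrow> (\<integral>x. V x * r x $ i \<partial>lborel) = - (\<integral>x. \<gamma> i x * \<phi> x \<partial>lborel)"
    and E: "integrable lborel (\<lambda>x. indicator K x * (f x - V x))"
      "integrable lborel (\<lambda>x. (indicator K x * (f x - V x))\<^sup>2)"
begin

text \<open>On the inner square everything is classical: \<open>F\<close> is \<open>V\<close>
  mollified at a scale that keeps all balls in \<open>K\<close>, its gradient \<open>H\<close> is
  the mollification of \<open>\<gamma>\<close>, and \<open>inverse_estimate_square\<close> applies
  to the pull-backs of \<open>f\<close> and \<open>F\<close>. Contractivity in L^2 then brings back
  \<open>\<gamma>\<close> and \<open>f - V\<close>.\<close>

lemma inverse_estimate_parallelogram_aux:
  assumes s: "0 < s" "s \<le> 1 / 4"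
  shows "ennreal (m^4) * (\<integral>\<^sup>+x\<in>\<Phi> ` cbox (pt s s) (pt (1 - s) (1 - s)). ennreal ((norm (Gf x))\<^sup>2) \<partial>lborel)
    \<le> ennreal (16 * M^4) * (\<Sum>i\<in>UNIV. \<integral>\<^sup>+x\<in>K. ennreal ((\<gamma> i x)\<^sup>2) \<partial>lborel)
      + ennreal (16384 * M\<^sup>2 * (real n)^4) * (\<integral>\<^sup>+x\<in>K. ennreal ((f x - V x)\<^sup>2) \<partial>lborel)"
proof -
  let ?U = "box (pt 0 0) (pt 1 1) :: (real^2) set"
  let ?B = "cbox (pt s s) (pt (1 - s) (1 - s))"
  let ?D = "\<Phi> ` ?B"
  have BU: "?B \<subseteq> ?U" using s by (auto simp: mem_box_cart forall_2)
  have c\<Phi>: "continuous_on ?B \<Phi>"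
    by (intro continuous_at_imp_continuous_on ballI has_derivative_continuous[OF d] subsetD[OF BU])
  have Dc: "compact ?D" using c\<Phi> compact_cbox by (rule compact_continuous_image)
  have DK: "?D \<subseteq> K" using BU K(2) by blast
  have Dne: "?D \<noteq> {}" using s mem_cbox_pt[of s s s s "1 - s" "1 - s"] by auto
  have cf: "continuous_on K f"
    by (intro continuous_at_imp_continuous_on ballI has_derivative_continuous[OF f(1)])
  \<comment> \<open>Room for the mollifier: a closed neighbourhood of the compact image that still
    lies in \<open>K\<close>.\<close>
  obtain e where e: "0 < e" "{x. infdist x ?D \<le> e} \<subseteq> K"
    using compact_in_open_separated[OF Dne Dc K(1) DK] by blast
  define D' where "D' = {x. infdist x ?D \<le> e}"
  have D': "compact D'" unfolding D'_def using Dne Dc e(1) by (intro compact_infdist_le)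
  have near: "y \<in> D'" if "x \<in> ?D" "dist x y \<le> e" for x y
    unfolding D'_def using infdist_le2[OF that(1), of y e] that(2) by (simp add: dist_commute)
  have fD': "uniformly_continuous_on D' f"
    using D' cf e(2) by (intro compact_uniformly_continuous) (auto simp: D'_def intro: continuous_on_subset)
  \<comment> \<open>\<open>1 - s - s\<close> is the side length of the inner square. It is at least
    \<open>1 / 2\<close>, which turns 1024 into 4096.\<close>
  define C where "C = 1024 * ((real n)^4 / (1 - s - s)\<^sup>2)"
  have C: "0 \<le> C" "C \<le> 4096 * (real n)^4"
  proof -
    have "1 / 4 \<le> (1 - s - s)\<^sup>2"
      using power_mono[of "1/2" "1 - s - s" 2] s by (simp add: power2_eq_square)
    then have "(real n)^4 / (1 - s - s)\<^sup>2 \<le> (real n)^4 / (1 / 4)" by (intro divide_left_mono) auto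
    then show "C \<le> 4096 * (real n)^4" by (simp add: C_def)
  qed (simp add: C_def)
  define \<Gamma> where "\<Gamma> = (\<Sum>i\<in>UNIV. \<integral>\<^sup>+x\<in>K. ennreal ((\<gamma> i x)\<^sup>2) \<partial>lborel)"
  define \<Delta> where "\<Delta> = (\<integral>\<^sup>+x\<in>K. ennreal ((f x - V x)\<^sup>2) \<partial>lborel)"
  have \<mu>D: "emeasure lborel ?D = ennreal (measure lborel ?D)"
    using emeasure_bounded_finite[OF compact_imp_bounded[OF Dc]] by (simp add: emeasure_eq_ennreal_measure)
  have Db: "?D \<in> sets borel" using Dc by (rule borel_compact)
  \<comment> \<open>For each \<open>\<eta>\<close> a mollifier is chosen whose error on
    \<open>f\<close> is at most \<open>\<eta>\<close>; the last term is removed at the end by making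
    \<open>\<eta>\<close> small.\<close>
  have main: "ennreal (m^4) * (\<integral>\<^sup>+x\<in>?D. ennreal ((norm (Gf x))\<^sup>2) \<partial>lborel)
      \<le> ennreal (16 * M^4) * \<Gamma> + ennreal (M\<^sup>2 * (4 * C)) * \<Delta> + ennreal (M\<^sup>2 * (4 * C) * \<eta>\<^sup>2 * measure lborel ?D)"
    if \<eta>: "0 < \<eta>" for \<eta>
  proof -
    obtain \<delta> where \<delta>: "0 < \<delta>" "\<And>x y. x \<in> D' \<Longrightarrow> y \<in> D' \<Longrightarrow> dist y x < \<delta> \<Longrightarrow> dist (f y) (f x) < \<eta>"
      using fD' \<eta> unfolding uniformly_continuous_on_def by metis
    define \<epsilon> where "\<epsilon> = min e \<delta>"
    have \<epsilon>: "0 < \<epsilon>" "\<epsilon> \<le> e" "\<epsilon> \<le> \<delta>" using e \<delta> by (auto simp: \<epsilon>_def)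
    obtain \<rho> r where moll: "mollifier \<epsilon> \<rho> r" using mollifier_exists[OF \<epsilon>(1)] by blast
    have ballK: "cball x \<epsilon> \<subseteq> K" "cball x \<epsilon> \<subseteq> D'" if "x \<in> ?D" for x
      using near[OF that] \<epsilon> e(2) by (auto simp: D'_def)
    define F where "F = (\<lambda>x. \<integral>y. V y * \<rho> (y - x) \<partial>lborel)"
    define H where "H = (\<lambda>x. \<chi> i. \<integral>y. \<gamma> i y * \<rho> (y - x) \<partial>lborel)"
    have cH: "continuous_on UNIV H"
      unfolding H_def
      by (intro continuous_on_vec_lambda continuous_at_imp_continuous_on ballI
          has_derivative_continuous[OF mollified_has_derivative[OF moll \<gamma>(1)]])
    have Fd: "(F has_derivative (\<lambda>h. H x \<bullet> h)) (at x)" if x: "x \<in> ?D" for x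
    proof -
      note iv = integrable_scaleR_mollifier_deriv[OF moll V]
      have "H x $ i = - (\<integral>y. V y *\<^sub>R r (y - x) \<partial>lborel) $ i" for i
      proof -
        have "((\<lambda>y. \<rho> (y - x)) has_derivative (\<lambda>v. r (y - x) \<bullet> v)) (at y)" for y
        proof (rule has_derivative_compose[where g = \<rho>])
          show "((\<lambda>y. y - x) has_derivative (\<lambda>v. v)) (at y)" by (auto intro!: derivative_eq_intros)
        qed (rule mollifier_has_derivative[OF moll])
        moreover have "continuous_on UNIV (\<lambda>y. r (y - x))"
          by (rule continuous_on_compose2[OF mollifier_deriv_continuous[OF moll]]) (auto intro!: continuous_intros)
        ultimately have "(\<integral>y. V y * r (y - x) $ i \<partial>lborel) = - (\<integral>y. \<gamma> i y * \<rho> (y - x) \<partial>lborel)"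
          by (intro wk mollifier_test_function[OF moll] ballK(1) x)
        moreover have "(\<integral>y. V y *\<^sub>R r (y - x) \<partial>lborel) $ i = (\<integral>y. V y * r (y - x) $ i \<partial>lborel)"
        proof -
          have "(\<integral>y. (V y *\<^sub>R r (y - x)) \<bullet> axis i 1 \<partial>lborel) = (\<integral>y. V y *\<^sub>R r (y - x) \<partial>lborel) \<bullet> axis i 1"
            by (rule integral_inner_left[OF iv])
          then show ?thesis by (simp add: inner_axis del: integral_inner_left)
        qed
        ultimately show ?thesis by (simp add: H_def)
      qed
      then have "H x = - (\<integral>y. V y *\<^sub>R r (y - x) \<partial>lborel)" by (simp add: vec_eq_iff)
      then show ?thesis unfolding F_def using mollified_has_derivative[OF moll V, of x] by simp
    qed
    \<comment> \<open>For \<open>x\<close> in \<open>?D\<close> the kernel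
      \<open>\<rho> (y - x)\<close> lives in \<open>K\<close>, so functions may be cut off there;
      for \<open>f - V\<close> integrability is known for the cut-off only.\<close>
    have restr: "(\<integral>y. g y * \<rho> (y - x) \<partial>lborel) = (\<integral>y. (indicator K y * g y) * \<rho> (y - x) \<partial>lborel)"
      if x: "x \<in> ?D" for g x
    proof (rule Bochner_Integration.integral_cong)
      fix y
      show "g y * \<rho> (y - x) = (indicator K y * g y) * \<rho> (y - x)"
      proof (cases "y \<in> K")
        case False
        then have "y \<notin> cball x \<epsilon>" using ballK(1)[OF x] by blast
        then have "\<rho> (y - x) = 0"
          using mollifier_support[OF moll, of "y - x"] by (auto simp: dist_norm norm_minus_commute)
        then show ?thesis by simp
      qed simp
    qed simp
    have young: "(\<integral>\<^sup>+x\<in>?D. ennreal ((\<integral>y. g y * \<rho> (y - x) \<partial>lborel)\<^sup>2) \<partial>lborel) \<le> (\<integral>\<^sup>+x\<in>K. ennreal ((g x)\<^sup>2) \<partial>lborel)"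
      if g: "integrable lborel (\<lambda>x. indicator K x * g x)" "integrable lborel (\<lambda>x. (indicator K x * g x)\<^sup>2)" for g
    proof -
      have "(\<integral>\<^sup>+x\<in>?D. ennreal ((\<integral>y. g y * \<rho> (y - x) \<partial>lborel)\<^sup>2) \<partial>lborel)
          \<le> (\<integral>\<^sup>+x. ennreal ((\<integral>y. (indicator K y * g y) * \<rho> (y - x) \<partial>lborel)\<^sup>2) \<partial>lborel)"
      proof (intro nn_integral_mono)
        fix x
        show "ennreal ((\<integral>y. g y * \<rho> (y - x) \<partial>lborel)\<^sup>2) * indicator ?D x
            \<le> ennreal ((\<integral>y. (indicator K y * g y) * \<rho> (y - x) \<partial>lborel)\<^sup>2)"
          using restr[of x g] by (cases "x \<in> ?D") simp_all
      qed
      also have "\<dots> \<le> (\<integral>\<^sup>+y. ennreal ((indicator K y * g y)\<^sup>2) \<partial>lborel)"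
        by (rule mollified_L2_bound[OF moll g])
      also have "\<dots> = (\<integral>\<^sup>+x\<in>K. ennreal ((g x)\<^sup>2) \<partial>lborel)"
        by (intro nn_integral_cong) (auto simp: indicator_def)
      finally show ?thesis .
    qed
    have Kb: "K \<in> sets lborel" using K(1) by simp
    have H_le: "(\<integral>\<^sup>+x\<in>?D. ennreal ((norm (H x))\<^sup>2) \<partial>lborel) \<le> \<Gamma>"
    proof -
      have Hm: "(\<lambda>x. ennreal ((H x $ i)\<^sup>2) * indicator ?D x) \<in> borel_measurable lborel" for i
      proof -
        have "continuous_on ?D (\<lambda>x. (H x $ i)\<^sup>2)"
          by (intro continuous_intros continuous_on_subset[OF cH subset_UNIV])
        from measurable_continuous_times_indicator[OF this Db] show ?thesis by simp
      qed
      have "(\<integral>\<^sup>+x\<in>?D. ennreal ((H x $ i)\<^sup>2) \<partial>lborel) \<le> (\<integral>\<^sup>+x\<in>K. ennreal ((\<gamma> i x)\<^sup>2) \<partial>lborel)" for i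
      proof -
        have "integrable lborel (\<lambda>x. indicator K x * \<gamma> i x)"
          using integrable_mult_indicator[OF Kb \<gamma>(1)] by simp
        moreover have "integrable lborel (\<lambda>x. (indicator K x * \<gamma> i x)\<^sup>2)"
        proof -
          have "(\<lambda>x. (indicator K x * \<gamma> i x)\<^sup>2) = (\<lambda>x. indicator K x *\<^sub>R (\<gamma> i x)\<^sup>2)"
            by (auto simp: indicator_def)
          then show ?thesis using integrable_mult_indicator[OF Kb \<gamma>(2)] by simp
        qed
        ultimately show ?thesis using young[of "\<gamma> i"] by (simp add: H_def)
      qed
      then have "(\<Sum>i\<in>UNIV. \<integral>\<^sup>+x\<in>?D. ennreal ((H x $ i)\<^sup>2) \<partial>lborel) \<le> \<Gamma>"
        unfolding \<Gamma>_def by (intro sum_mono)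
      moreover have "(\<integral>\<^sup>+x\<in>?D. ennreal ((norm (H x))\<^sup>2) \<partial>lborel) = (\<Sum>i\<in>UNIV. \<integral>\<^sup>+x\<in>?D. ennreal ((H x $ i)\<^sup>2) \<partial>lborel)"
        using Hm by (simp add: sum_2 norm_sq_vec2 ennreal_plus distrib_right nn_integral_add)
      ultimately show ?thesis by simp
    qed
    have cFD: "continuous_on ?D F"
      using Fd by (intro continuous_at_imp_continuous_on ballI has_derivative_continuous)
    have F_le: "(\<integral>\<^sup>+x\<in>?D. ennreal ((f x - F x)\<^sup>2) \<partial>lborel) \<le> ennreal (2 * \<eta>\<^sup>2 * measure lborel ?D) + 2 * \<Delta>"
    proof -
      \<comment> \<open>\<open>T\<close> is the mollified error \<open>f - V\<close>. It differs
        from \<open>f - F\<close> by the mollification error of \<open>f\<close> alone, which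
        uniform continuity keeps at most \<open>\<eta>\<close>.\<close>
      define T where "T = (\<lambda>x. \<integral>y. (indicator K y * (f y - V y)) * \<rho> (y - x) \<partial>lborel)"
      have [measurable]: "T \<in> borel_measurable borel"
        unfolding T_def by (intro borel_measurable_continuous_onI continuous_at_imp_continuous_on ballI
          has_derivative_continuous[OF mollified_has_derivative[OF moll E(1)]])
      have pw: "(f x - F x)\<^sup>2 \<le> 2 * \<eta>\<^sup>2 + 2 * (T x)\<^sup>2" if x: "x \<in> ?D" for x
      proof -
        have Ti: "integrable lborel (\<lambda>y. (indicator K y * (f y - V y)) * \<rho> (y - x))"
          by (rule integrable_mult_mollifier[OF moll E(1)])
        have KV: "integrable lborel (\<lambda>x. indicator K x * V x)"
          using integrable_mult_indicator[OF Kb V] by simp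
        have W: "integrable lborel (\<lambda>x. indicator K x * f x)"
          using Bochner_Integration.integrable_add[OF E(1) KV] by (simp add: algebra_simps)
        have "\<bar>(\<integral>y. (indicator K y * f y) * \<rho> (y - x) \<partial>lborel) - f x\<bar> \<le> \<eta>"
        proof (rule mollified_close[OF moll W])
          fix y assume y: "y \<in> ball x \<epsilon>"
          then have "y \<in> K" "y \<in> D'" "x \<in> D'" using ballK[OF x] \<epsilon>(1) by auto
          then show "\<bar>indicator K y * f y - f x\<bar> \<le> \<eta>"
            using \<delta>(2)[of x y] y \<epsilon>(3) by (auto simp: dist_real_def dist_commute)
        qed
        moreover have "(\<integral>y. (indicator K y * f y) * \<rho> (y - x) \<partial>lborel) - F x = T x"
        proof -
          have "F x = (\<integral>y. (indicator K y * V y) * \<rho> (y - x) \<partial>lborel)"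
            unfolding F_def by (rule restr[OF x])
          moreover have "T x = (\<integral>y. (indicator K y * f y) * \<rho> (y - x) - (indicator K y * V y) * \<rho> (y - x) \<partial>lborel)"
            unfolding T_def by (simp add: algebra_simps)
          ultimately show ?thesis
            using integrable_mult_mollifier[OF moll W] integrable_mult_mollifier[OF moll KV]
            by (simp add: Bochner_Integration.integral_diff)
        qed
        ultimately have "\<bar>(f x - F x) - T x\<bar> \<le> \<eta>" by linarith
        then have "((f x - F x) - T x)\<^sup>2 \<le> \<eta>\<^sup>2" using \<eta> abs_le_square_iff by fastforce
        moreover have "(f x - F x)\<^sup>2 \<le> 2 * ((f x - F x) - T x)\<^sup>2 + 2 * (T x)\<^sup>2"
        proof -
          have "(a + b)\<^sup>2 \<le> 2 * a\<^sup>2 + 2 * b\<^sup>2" for a b :: real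
            using zero_le_power2[of "a - b"] by (simp add: power2_eq_square algebra_simps)
          from this[of "(f x - F x) - T x" "T x"] show ?thesis by simp
        qed
        ultimately show ?thesis by linarith
      qed
      have "(\<integral>\<^sup>+x\<in>?D. ennreal ((f x - F x)\<^sup>2) \<partial>lborel)
          \<le> (\<integral>\<^sup>+x. ennreal (2 * \<eta>\<^sup>2) * indicator ?D x + ennreal (2 * (T x)\<^sup>2) * indicator ?D x \<partial>lborel)"
      proof (intro nn_integral_mono)
        fix x
        show "ennreal ((f x - F x)\<^sup>2) * indicator ?D x
            \<le> ennreal (2 * \<eta>\<^sup>2) * indicator ?D x + ennreal (2 * (T x)\<^sup>2) * indicator ?D x"
        proof (cases "x \<in> ?D")
          case True
          have "ennreal ((f x - F x)\<^sup>2) \<le> ennreal (2 * \<eta>\<^sup>2 + 2 * (T x)\<^sup>2)"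
            using pw[OF True] by (rule ennreal_leI)
          then show ?thesis using True by (simp add: ennreal_plus)
        qed simp
      qed
      also have "\<dots> = ennreal (2 * \<eta>\<^sup>2) * emeasure lborel ?D + (\<integral>\<^sup>+x. ennreal (2 * (T x)\<^sup>2) * indicator ?D x \<partial>lborel)"
        using Db by (subst nn_integral_add) (auto simp: nn_integral_cmult_indicator)
      also have "(\<integral>\<^sup>+x. ennreal (2 * (T x)\<^sup>2) * indicator ?D x \<partial>lborel) \<le> 2 * \<Delta>"
      proof -
        have "(\<integral>\<^sup>+x. ennreal (2 * (T x)\<^sup>2) * indicator ?D x \<partial>lborel) \<le> (\<integral>\<^sup>+x. 2 * ennreal ((T x)\<^sup>2) \<partial>lborel)"
          by (intro nn_integral_mono) (auto simp: indicator_def ennreal_mult)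
        also have "\<dots> = 2 * (\<integral>\<^sup>+x. ennreal ((T x)\<^sup>2) \<partial>lborel)" by (intro nn_integral_cmult) measurable
        also have "(\<integral>\<^sup>+x. ennreal ((T x)\<^sup>2) \<partial>lborel) \<le> (\<integral>\<^sup>+y. ennreal ((indicator K y * (f y - V y))\<^sup>2) \<partial>lborel)"
          unfolding T_def by (rule mollified_L2_bound[OF moll E])
        also have "\<dots> = \<Delta>"
          unfolding \<Delta>_def by (intro nn_integral_cong) (auto simp: indicator_def)
        finally show ?thesis by (simp add: mult_left_mono)
      qed
      finally show ?thesis using \<eta> by (simp add: \<mu>D ennreal_mult' [symmetric] mult.assoc)
    qed
    have tr_cont: "continuous_on ?B (\<lambda>z. transpose (J z) *v w z)" if "continuous_on ?B w" for w
    proof -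
      have "(\<lambda>z. transpose (J z) *v w z) = (\<lambda>z. \<chi> j. \<Sum>i\<in>UNIV. J z $ i $ j * w z $ i)"
        by (simp add: matrix_vector_mult_def transpose_def)
      moreover have "continuous_on ?B (\<lambda>z. \<chi> j. \<Sum>i\<in>UNIV. J z $ i $ j * w z $ i)"
        by (intro continuous_on_vec_lambda continuous_intros that continuous_on_subset[OF J BU])
      ultimately show ?thesis by (simp only:)
    qed
    have chain: "((\<lambda>z. g (\<Phi> z)) has_derivative (\<lambda>v. (transpose (J z) *v w) \<bullet> v)) (at z)"
      if z: "z \<in> ?B" and g: "(g has_derivative (\<lambda>v. w \<bullet> v)) (at (\<Phi> z))" for g w z
    proof -
      have "w \<bullet> (J z *v v) = (transpose (J z) *v w) \<bullet> v" for v
        by (metis dot_lmul_matrix transpose_matrix_vector)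
      then show ?thesis
        using has_derivative_compose[OF d[OF subsetD[OF BU z]] g] by simp
    qed
    define Q where "Q = (\<lambda>z. transpose (J z) *v Gf (\<Phi> z))"
    define G where "G = (\<lambda>z. transpose (J z) *v H (\<Phi> z))"
    have cGf: "continuous_on ?B (\<lambda>z. Gf (\<Phi> z))"
      by (rule continuous_on_compose2[OF f(2) c\<Phi> DK])
    have cH\<Phi>: "continuous_on ?B (\<lambda>z. H (\<Phi> z))"
      by (rule continuous_on_compose2[OF cH c\<Phi> subset_UNIV])
    have cQ: "continuous_on ?B Q" and cG: "continuous_on ?B G"
      unfolding Q_def G_def by (intro tr_cont cGf cH\<Phi>)+
    have qd: "(q has_derivative (\<lambda>v. Q z \<bullet> v)) (at z)" if z: "z \<in> ?B" for z
    proof -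
      have "((\<lambda>z. f (\<Phi> z)) has_derivative (\<lambda>v. Q z \<bullet> v)) (at z)"
        unfolding Q_def using z DK by (intro chain f(1)) auto
      then show ?thesis
        by (rule has_derivative_transform_within_open[OF _ open_box subsetD[OF BU z]]) (simp add: q(2))
    qed
    have F\<Phi>d: "((\<lambda>z. F (\<Phi> z)) has_derivative (\<lambda>v. G z \<bullet> v)) (at z)" if z: "z \<in> ?B" for z
      unfolding G_def using z by (intro chain Fd) auto
    have s1: "s < 1 - s" using s by simp
    note est = inverse_estimate_square[OF s1 n q(1) qd cQ F\<Phi>d cG, folded C_def]
    let ?x = "\<integral>\<^sup>+z\<in>?B. ennreal ((norm (Gf (\<Phi> z)))\<^sup>2) \<partial>lborel"
    let ?y = "\<integral>\<^sup>+z\<in>?B. ennreal ((norm (Q z))\<^sup>2) \<partial>lborel"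
    let ?z = "\<integral>\<^sup>+z\<in>?B. ennreal ((norm (G z))\<^sup>2) \<partial>lborel"
    let ?h = "\<integral>\<^sup>+z\<in>?B. ennreal ((norm (H (\<Phi> z)))\<^sup>2) \<partial>lborel"
    let ?w = "\<integral>\<^sup>+z\<in>?B. ennreal ((f (\<Phi> z) - F (\<Phi> z))\<^sup>2) \<partial>lborel"
    have Bb: "?B \<in> sets borel" by simp
    have split: "(\<integral>\<^sup>+z\<in>?B. ennreal ((norm (g z))\<^sup>2) \<partial>lborel)
        = (\<integral>\<^sup>+z\<in>?B. ennreal ((g z $ 1)\<^sup>2) \<partial>lborel) + (\<integral>\<^sup>+z\<in>?B. ennreal ((g z $ 2)\<^sup>2) \<partial>lborel)"
      if g: "continuous_on ?B g" for g :: "real^2 \<Rightarrow> real^2"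
    proof -
      have "(\<lambda>z. ennreal ((g z $ i)\<^sup>2) * indicator ?B z) \<in> borel_measurable lborel" for i
      proof -
        have "continuous_on ?B (\<lambda>x. (g x $ i)\<^sup>2)" by (intro continuous_intros g)
        from measurable_continuous_times_indicator[OF this Bb] show ?thesis by simp
      qed
      then show ?thesis by (simp add: norm_sq_vec2 ennreal_plus distrib_right nn_integral_add)
    qed
    have qf: "(\<integral>\<^sup>+z\<in>?B. ennreal ((q z - F (\<Phi> z))\<^sup>2) \<partial>lborel) = ?w"
      using q(2) BU by (intro nn_integral_cong) (auto simp: indicator_def)
    \<comment> \<open>The L^2 term occurs once for each of the two directions, hence the factor
      2.\<close>
    have c3: "?y \<le> 16 * ?z + 2 * ennreal C * ?w"
    proof -
      have "?y \<le> (ennreal 16 * (\<integral>\<^sup>+z\<in>?B. ennreal ((G z $ 1)\<^sup>2) \<partial>lborel) + ennreal C * ?w)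
          + (ennreal 16 * (\<integral>\<^sup>+z\<in>?B. ennreal ((G z $ 2)\<^sup>2) \<partial>lborel) + ennreal C * ?w)"
        unfolding split[OF cQ] using est[of 1] est[of 2] unfolding qf by (rule add_mono)
      also have "\<dots> = 16 * ?z + 2 * ennreal C * ?w"
        unfolding split[OF cG] by (simp add: distrib_left mult_2 distrib_right ac_simps)
      finally show ?thesis .
    qed
    have subd: "(\<Phi> has_derivative (\<lambda>v. J z *v v)) (at z within ?B)" if "z \<in> ?B" for z
      using d[OF subsetD[OF BU that]] by (rule has_derivative_at_withinI)
    have bB: "m * norm v \<le> norm (J z *v v)" "norm (J z *v v) \<le> M * norm v" if "z \<in> ?B" for z v
      using bounds subsetD[OF BU that] by blast+
    have cv: "(\<integral>\<^sup>+x\<in>?D. ennreal (k x) \<partial>lborel) \<le> ennreal (M\<^sup>2) * (\<integral>\<^sup>+z\<in>?B. ennreal (k (\<Phi> z)) \<partial>lborel)"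
      "ennreal (m\<^sup>2) * (\<integral>\<^sup>+z\<in>?B. ennreal (k (\<Phi> z)) \<partial>lborel) \<le> (\<integral>\<^sup>+x\<in>?D. ennreal (k x) \<partial>lborel)"
      if k: "continuous_on ?D k" "\<And>z. 0 \<le> k z" for k
    proof -
      note * = nn_integral_change_of_variables_bounds[OF compact_cbox inj_on_subset[OF inj BU] subd
        continuous_on_subset[OF J BU] m bB k]
      show "(\<integral>\<^sup>+x\<in>?D. ennreal (k x) \<partial>lborel) \<le> ennreal (M\<^sup>2) * (\<integral>\<^sup>+z\<in>?B. ennreal (k (\<Phi> z)) \<partial>lborel)"
        by (rule *(1))
      show "ennreal (m\<^sup>2) * (\<integral>\<^sup>+z\<in>?B. ennreal (k (\<Phi> z)) \<partial>lborel) \<le> (\<integral>\<^sup>+x\<in>?D. ennreal (k x) \<partial>lborel)"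
        by (rule *(2))
    qed
    have cGfD: "continuous_on ?D (\<lambda>x. (norm (Gf x))\<^sup>2)"
      by (intro continuous_intros continuous_on_subset[OF f(2) DK])
    have cHD: "continuous_on ?D (\<lambda>x. (norm (H x))\<^sup>2)"
      by (intro continuous_intros continuous_on_subset[OF cH subset_UNIV])
    have cfFD: "continuous_on ?D (\<lambda>x. (f x - F x)\<^sup>2)"
      by (intro continuous_intros continuous_on_subset[OF cf DK] cFD)
    have c1: "(\<integral>\<^sup>+x\<in>?D. ennreal ((norm (Gf x))\<^sup>2) \<partial>lborel) \<le> ennreal (M\<^sup>2) * ?x"
      by (rule cv(1)[OF cGfD zero_le_power2])
    have c5: "ennreal (m\<^sup>2) * ?h \<le> \<Gamma>"
      using cv(2)[OF cHD zero_le_power2] H_le by (rule order_trans)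
    have c6: "ennreal (m\<^sup>2) * ?w \<le> ennreal (2 * \<eta>\<^sup>2 * measure lborel ?D) + 2 * \<Delta>"
      using cv(2)[OF cfFD zero_le_power2] F_le by (rule order_trans)
    have c2: "ennreal (m\<^sup>2) * ?x \<le> ?y"
    proof -
      have "ennreal (m\<^sup>2) * ?x = (\<integral>\<^sup>+z. ennreal (m\<^sup>2) * (ennreal ((norm (Gf (\<Phi> z)))\<^sup>2) * indicator ?B z) \<partial>lborel)"
      proof -
        have "continuous_on ?B (\<lambda>z. (norm (Gf (\<Phi> z)))\<^sup>2)" by (intro continuous_intros cGf)
        from measurable_continuous_times_indicator[OF this Bb] show ?thesis by (simp add: nn_integral_cmult)
      qed
      also have "\<dots> \<le> ?y"
      proof (intro nn_integral_mono)
        fix z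
        show "ennreal (m\<^sup>2) * (ennreal ((norm (Gf (\<Phi> z)))\<^sup>2) * indicator ?B z) \<le> ennreal ((norm (Q z))\<^sup>2) * indicator ?B z"
        proof (cases "z \<in> ?B")
          case True
          have "m * norm (Gf (\<Phi> z)) \<le> norm (Q z)"
            unfolding Q_def using bounds(1)[OF subsetD[OF BU True]] m by (intro norm_transpose_bounds(2))
          then have "(m * norm (Gf (\<Phi> z)))\<^sup>2 \<le> (norm (Q z))\<^sup>2" using m by (intro power_mono) auto
          then show ?thesis using True by (simp add: power_mult_distrib ennreal_mult' [symmetric] ennreal_leI)
        qed simp
      qed
      finally show ?thesis .
    qed
    have c4: "?z \<le> ennreal (M\<^sup>2) * ?h"
    proof -
      have "?z \<le> (\<integral>\<^sup>+z. ennreal (M\<^sup>2) * (ennreal ((norm (H (\<Phi> z)))\<^sup>2) * indicator ?B z) \<partial>lborel)"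
      proof (intro nn_integral_mono)
        fix z
        show "ennreal ((norm (G z))\<^sup>2) * indicator ?B z \<le> ennreal (M\<^sup>2) * (ennreal ((norm (H (\<Phi> z)))\<^sup>2) * indicator ?B z)"
        proof (cases "z \<in> ?B")
          case True
          have "norm (G z) \<le> M * norm (H (\<Phi> z))"
            unfolding G_def using bounds(2)[OF subsetD[OF BU True]] by (intro norm_transpose_bounds(1))
          then have "(norm (G z))\<^sup>2 \<le> (M * norm (H (\<Phi> z)))\<^sup>2" by (intro power_mono) auto
          then show ?thesis using True by (simp add: power_mult_distrib ennreal_mult' [symmetric] ennreal_leI)
        qed simp
      qed
      also have "\<dots> = ennreal (M\<^sup>2) * ?h"
      proof -
        have "continuous_on ?B (\<lambda>z. (norm (H (\<Phi> z)))\<^sup>2)" by (intro continuous_intros cH\<Phi>)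
        from measurable_continuous_times_indicator[OF this Bb] show ?thesis by (simp add: nn_integral_cmult)
      qed
      finally show ?thesis .
    qed
    have "ennreal (m^4) = ennreal (m\<^sup>2) * ennreal (m\<^sup>2)"
      by (simp add: ennreal_mult' [symmetric] power4_eq_xxxx power2_eq_square mult.assoc)
    then have "ennreal (m^4) * (\<integral>\<^sup>+x\<in>?D. ennreal ((norm (Gf x))\<^sup>2) \<partial>lborel)
        \<le> ennreal (M\<^sup>2) * (16 * ennreal (M\<^sup>2) * \<Gamma> + 2 * ennreal C * (ennreal (2 * \<eta>\<^sup>2 * measure lborel ?D) + 2 * \<Delta>))"
      using ennreal_chain[OF c1 c2 c3 c4 c5 c6] by simp
    also have "\<dots> = ennreal (M\<^sup>2) * (16 * ennreal (M\<^sup>2)) * \<Gamma> + ennreal (M\<^sup>2) * (2 * ennreal C * 2) * \<Delta>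
        + ennreal (M\<^sup>2) * (2 * ennreal C * ennreal (2 * \<eta>\<^sup>2 * measure lborel ?D))"
      by (simp only: distrib_left ac_simps)
    also have "ennreal (M\<^sup>2) * (16 * ennreal (M\<^sup>2)) = ennreal (16 * M^4)"
      unfolding ennreal_numeral[symmetric] by (simp add: ennreal_mult' [symmetric] power4_eq_xxxx power2_eq_square ac_simps del: ennreal_numeral)
    also have "ennreal (M\<^sup>2) * (2 * ennreal C * 2) = ennreal (M\<^sup>2 * (4 * C))"
      unfolding ennreal_numeral[symmetric] using C by (simp add: ennreal_mult' [symmetric] ennreal_mult'' [symmetric] ac_simps del: ennreal_numeral)
    also have "ennreal (M\<^sup>2) * (2 * ennreal C * ennreal (2 * \<eta>\<^sup>2 * measure lborel ?D)) = ennreal (M\<^sup>2 * (4 * C) * \<eta>\<^sup>2 * measure lborel ?D)"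
      unfolding ennreal_numeral[symmetric] using C by (simp add: ennreal_mult' [symmetric] ac_simps del: ennreal_numeral)
    finally show ?thesis .
  qed
  have "ennreal (m^4) * (\<integral>\<^sup>+x\<in>?D. ennreal ((norm (Gf x))\<^sup>2) \<partial>lborel)
      \<le> ennreal (16 * M^4) * \<Gamma> + ennreal (M\<^sup>2 * (4 * C)) * \<Delta>"
  proof (rule ennreal_le_epsilon)
    fix t :: real assume t: "0 < t"
    \<comment> \<open>The summand 1 avoids division by zero. With
      \<open>\<eta> = sqrt (t / b)\<close> the error term becomes \<open>(b - 1) (t / b)\<close>,
      which is at most \<open>t\<close>.\<close>
    define b where "b = M\<^sup>2 * (4 * C) * measure lborel ?D + 1"
    have b: "1 \<le> b" using C by (simp add: b_def)
    have "ennreal (m^4) * (\<integral>\<^sup>+x\<in>?D. ennreal ((norm (Gf x))\<^sup>2) \<partial>lborel)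
      \<le> ennreal (16 * M^4) * \<Gamma> + ennreal (M\<^sup>2 * (4 * C)) * \<Delta> + ennreal (M\<^sup>2 * (4 * C) * (sqrt (t / b))\<^sup>2 * measure lborel ?D)"
      using t b by (intro main) auto
    also have "M\<^sup>2 * (4 * C) * (sqrt (t / b))\<^sup>2 * measure lborel ?D = (b - 1) * (t / b)"
      using t b by (simp add: b_def)
    also have "\<dots> \<le> t" using t b by (simp add: field_simps)
    finally show "ennreal (m^4) * (\<integral>\<^sup>+x\<in>?D. ennreal ((norm (Gf x))\<^sup>2) \<partial>lborel)
      \<le> ennreal (16 * M^4) * \<Gamma> + ennreal (M\<^sup>2 * (4 * C)) * \<Delta> + ennreal t"
      by (simp add: add_left_mono ennreal_leI)
  qed
  also have "\<dots> \<le> ennreal (16 * M^4) * \<Gamma> + ennreal (16384 * M\<^sup>2 * (real n)^4) * \<Delta>"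
  proof -
    have "M\<^sup>2 * (4 * C) \<le> M\<^sup>2 * (4 * (4096 * (real n)^4))" using C by (intro mult_left_mono) auto
    then have "M\<^sup>2 * (4 * C) \<le> 16384 * M\<^sup>2 * (real n)^4" by simp
    then show ?thesis by (intro add_left_mono mult_right_mono ennreal_leI) auto
  qed
  finally show ?thesis by (simp only: \<Gamma>_def \<Delta>_def)
qed

text \<open>Monotone convergence along inner squares that exhaust the open unit square; the bounds
  on them do not depend on \<open>s\<close>.\<close>

lemma inverse_estimate_parallelogram:
  shows "ennreal (m^4) * (\<integral>\<^sup>+x\<in>\<Phi> ` box (pt 0 0) (pt 1 1). ennreal ((norm (Gf x))\<^sup>2) \<partial>lborel)
    \<le> ennreal (16 * M^4) * (\<Sum>i\<in>UNIV. \<integral>\<^sup>+x\<in>K. ennreal ((\<gamma> i x)\<^sup>2) \<partial>lborel)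
      + ennreal (16384 * M\<^sup>2 * (real n)^4) * (\<integral>\<^sup>+x\<in>K. ennreal ((f x - V x)\<^sup>2) \<partial>lborel)" (is "_ \<le> ?R")
proof -
  let ?U = "box (pt 0 0) (pt 1 1) :: (real^2) set"
  \<comment> \<open>The offset 4 ensures \<open>s k \<le> 1 / 4\<close>, the condition under which
    the constant is uniform.\<close>
  define s where "s k = 1 / (real k + 4)" for k :: nat
  define B where "B k = cbox (pt (s k) (s k)) (pt (1 - s k) (1 - s k))" for k
  define g where "g k x = ennreal ((norm (Gf x))\<^sup>2) * indicator (\<Phi> ` B k) x" for k x
  have s: "0 < s k" "s k \<le> 1 / 4" for k by (auto simp: s_def)
  have s_mono: "s l \<le> s k" if "k \<le> l" for k l using that by (auto simp: s_def frac_le)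
  have BU: "B k \<subseteq> ?U" for k using s[of k] by (auto simp: B_def mem_box_cart forall_2)
  have B_mono: "B k \<subseteq> B l" if "k \<le> l" for k l
    using s_mono[OF that] by (auto simp: B_def mem_box_cart forall_2)
  have B_UN: "\<exists>k. z \<in> B k" if z: "z \<in> ?U" for z
  proof -
    define \<delta> where "\<delta> = min (min (z $ 1) (1 - z $ 1)) (min (z $ 2) (1 - z $ 2))"
    have "0 < \<delta>" using z by (auto simp: \<delta>_def mem_box_cart forall_2)
    moreover have "s \<longlonglongrightarrow> 0" unfolding s_def by real_asymp
    ultimately obtain k where "s k < \<delta>" using order_tendstoD(2) eventually_sequentially by (metis order_refl)
    then have "z \<in> B k" by (auto simp: \<delta>_def B_def mem_box_cart forall_2)
    then show ?thesis by blast
  qed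
  have est: "ennreal (m^4) * (\<integral>\<^sup>+x. g k x \<partial>lborel) \<le> ?R" for k
    unfolding g_def B_def by (rule inverse_estimate_parallelogram_aux[OF s])
  have c\<Phi>: "continuous_on ?U \<Phi>"
    by (intro continuous_at_imp_continuous_on ballI has_derivative_continuous[OF d])
  have meas: "g k \<in> borel_measurable borel" for k
    unfolding g_def
  proof (rule measurable_continuous_times_indicator)
    show "continuous_on (\<Phi> ` B k) (\<lambda>x. (norm (Gf x))\<^sup>2)"
      using BU K(2) by (intro continuous_intros continuous_on_subset[OF f(2)]) blast
    have "compact (\<Phi> ` B k)"
      using BU by (intro compact_continuous_image continuous_on_subset[OF c\<Phi>]) (auto simp: B_def)
    then show "\<Phi> ` B k \<in> sets borel" by (rule borel_compact)
  qed
  have sup: "ennreal ((norm (Gf x))\<^sup>2) * indicator (\<Phi> ` ?U) x = (SUP k. g k x)" for x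
  proof (rule antisym)
    show "ennreal ((norm (Gf x))\<^sup>2) * indicator (\<Phi> ` ?U) x \<le> (SUP k. g k x)"
    proof (cases "x \<in> \<Phi> ` ?U")
      case True
      then obtain k where "x \<in> \<Phi> ` B k" using B_UN by blast
      then have "ennreal ((norm (Gf x))\<^sup>2) = g k x" by (simp add: g_def)
      then show ?thesis using True by (auto intro: SUP_upper2[of k])
    qed simp
    show "(SUP k. g k x) \<le> ennreal ((norm (Gf x))\<^sup>2) * indicator (\<Phi> ` ?U) x"
      unfolding g_def using BU by (intro SUP_least mult_left_mono) (auto simp: indicator_def)
  qed
  have inc: "incseq g"
    unfolding incseq_def le_fun_def g_def
    using B_mono by (intro allI impI mult_left_mono) (auto simp: indicator_def)
  have "ennreal (m^4) * (\<integral>\<^sup>+x\<in>\<Phi> ` ?U. ennreal ((norm (Gf x))\<^sup>2) \<partial>lborel)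
      = ennreal (m^4) * (SUP k. \<integral>\<^sup>+x. g k x \<partial>lborel)"
    unfolding sup using meas by (subst nn_integral_monotone_convergence_SUP[OF inc]) auto
  also have "\<dots> = (SUP k. ennreal (m^4) * (\<integral>\<^sup>+x. g k x \<partial>lborel))"
    by (rule SUP_mult_left_ennreal)
  also have "\<dots> \<le> ?R" by (intro SUP_least est)
  finally show ?thesis .
qed

end

section \<open>The K-method\<close>

lemma sqrt_ennreal_mono: "a \<le> b \<Longrightarrow> sqrt_ennreal a \<le> sqrt_ennreal b"
  unfolding sqrt_ennreal_def
  by (auto simp: top_unique intro!: ennreal_leI enn2real_mono simp: less_top)

lemma sqrt_ennreal_mult: "0 < c \<Longrightarrow> sqrt_ennreal (ennreal c * a) = ennreal (sqrt c) * sqrt_ennreal a"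
  unfolding sqrt_ennreal_def
  by (auto simp: ennreal_mult_eq_top_iff enn2real_mult real_sqrt_mult ennreal_mult ennreal_mult_top)

lemma sqrt_ennreal_square: "0 \<le> x \<Longrightarrow> sqrt_ennreal (ennreal (x\<^sup>2)) = ennreal x"
  by (simp add: sqrt_ennreal_def)

lemma nn_integral_powr_from_0:
  assumes "0 < b" "0 < c"
  shows "(\<integral>\<^sup>+t\<in>{0<..c}. ennreal (t powr (b - 1)) \<partial>lborel) = ennreal (c powr b / b)"
proof -
  have "((\<lambda>x. x powr (b - 1)) has_integral (c powr (b - 1 + 1) / (b - 1 + 1))) {0..c}"
    using assms by (intro has_integral_powr_from_0) auto
  then have "(\<integral>\<^sup>+t\<in>{0..c}. ennreal (t powr (b - 1)) \<partial>lborel) = ennreal (c powr b / b)"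
    by (subst nn_integral_has_integral_lebesgue') auto
  moreover have "(\<integral>\<^sup>+t\<in>{0<..c}. ennreal (t powr (b - 1)) \<partial>lborel) = (\<integral>\<^sup>+t\<in>{0..c}. ennreal (t powr (b - 1)) \<partial>lborel)"
    by (intro nn_integral_cong) (auto simp: indicator_def)
  ultimately show ?thesis by simp
qed

lemma nn_integral_powr_to_inf:
  assumes "0 < a" "0 < c"
  shows "(\<integral>\<^sup>+t\<in>{c<..}. ennreal (t powr (- a - 1)) \<partial>lborel) = ennreal (c powr (- a) / a)"
proof -
  have "((\<lambda>x. x powr (- a - 1)) has_integral (- (c powr (- a - 1 + 1)) / (- a - 1 + 1))) {c..}"
    using assms by (intro has_integral_powr_to_inf) auto
  then have "(\<integral>\<^sup>+t\<in>{c..}. ennreal (t powr (- a - 1)) \<partial>lborel) = ennreal (c powr (- a) / a)"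
    by (subst nn_integral_has_integral_lebesgue') auto
  moreover have "(\<integral>\<^sup>+t\<in>{c<..}. ennreal (t powr (- a - 1)) \<partial>lborel) = (\<integral>\<^sup>+t\<in>{c..}. ennreal (t powr (- a - 1)) \<partial>lborel)"
    using AE_lborel_singleton[of c] by (intro nn_integral_cong_AE) (auto simp: indicator_def elim: eventually_mono)
  ultimately show ?thesis by simp
qed

text \<open>The type only has a subtraction, so \<open>u - u\<close> and the element
  \<open>z\<close> stand in for the zero vector. The constant collects the cases:
  \<open>2 C0\<close> is for \<open>\<mu> = 1\<close>, \<open>C0 / (1 - \<mu>)\<close> comes from
  the integral up to \<open>t0\<close>, \<open>1 / \<mu>\<close> from the tail when
  \<open>\<theta> = 0\<close>, and 1 from the tail otherwise and from
  \<open>\<theta> = \<mu>\<close>. For \<open>\<mu>\<close> equal to 0 or 1 the undefined fraction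
  is 0 by convention, and its case does not occur.\<close>

lemma interp_norm_inverse_estimate:
  fixes u :: "'v::minus"
  assumes \<theta>\<mu>: "0 \<le> \<theta>" "\<theta> \<le> \<mu>" "\<mu> \<le> 1" and C0: "0 < C0" and t0: "0 < t0"
    and u: "u \<in> X0" "u \<in> X1" and nn: "\<And>v. 0 \<le> n0 v" "\<And>v. 0 \<le> n1 v" and uu: "n0 (u - u) = 0"
    and z: "z \<in> X1" "n0 (u - z) = n0 u" "n1 z = 0"
    and key: "\<And>v. v \<in> X1 \<Longrightarrow> t0\<^sup>2 * (n1 u)\<^sup>2 \<le> C0 * ((n0 (u - v))\<^sup>2 + t0\<^sup>2 * (n1 v)\<^sup>2)"
  shows "ennreal (t0 powr (\<mu> - \<theta>)) * interp_norm X0 n0 X1 n1 \<mu> u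
    \<le> ennreal (sqrt (2 * C0 + C0 / (1 - \<mu>) + 1 / \<mu> + 1)) * interp_norm X0 n0 X1 n1 \<theta> u"
proof -
  define k where "k t = K_sq n0 X1 n1 t u" for t
  have bdd: "bdd_below ((\<lambda>v. (n0 (u - v))\<^sup>2 + t\<^sup>2 * (n1 v)\<^sup>2) ` X1)" for t
    by (rule bdd_belowI[of _ 0]) auto
  have ne: "X1 \<noteq> {}" using u by blast
  have k_le: "k t \<le> (n0 (u - v))\<^sup>2 + t\<^sup>2 * (n1 v)\<^sup>2" if "v \<in> X1" for t v
    unfolding k_def K_sq_def using that by (intro cINF_lower bdd)
  have k_ge: "c \<le> k t" if "\<And>v. v \<in> X1 \<Longrightarrow> c \<le> (n0 (u - v))\<^sup>2 + t\<^sup>2 * (n1 v)\<^sup>2" for c t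
    unfolding k_def K_sq_def using that by (intro cINF_greatest ne)
  have k0: "0 \<le> k t" for t by (rule k_ge) simp
  have k_n0: "k t \<le> (n0 u)\<^sup>2" for t using k_le[OF z(1), of t] z by simp
  have k_n1: "k t \<le> t\<^sup>2 * (n1 u)\<^sup>2" for t using k_le[OF u(2), of t] uu by simp
  have k_mono: "k s \<le> k t" if "0 \<le> s" "s \<le> t" for s t
  proof (rule k_ge)
    fix v assume "v \<in> X1"
    have "s\<^sup>2 * (n1 v)\<^sup>2 \<le> t\<^sup>2 * (n1 v)\<^sup>2" using that by (intro mult_right_mono power_mono) auto
    then show "k s \<le> (n0 (u - v))\<^sup>2 + t\<^sup>2 * (n1 v)\<^sup>2" using k_le[OF \<open>v \<in> X1\<close>, of s] by linarith
  qed
  have k_key: "t0\<^sup>2 * (n1 u)\<^sup>2 \<le> C0 * k t0"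
  proof -
    have "t0\<^sup>2 * (n1 u)\<^sup>2 / C0 \<le> k t0"
      using key C0 by (intro k_ge) (simp add: field_simps)
    then show ?thesis using C0 by (simp add: field_simps)
  qed
  \<comment> \<open>\<open>k t\<close> depends on \<open>t\<close> through \<open>t^2\<close> and is
    monotone for \<open>t \<ge> 0\<close> only. With \<open>max 0\<close> it becomes monotone on the
    line, hence Borel measurable, and is unchanged on the range of integration.\<close>
  have "mono (\<lambda>t. k (max 0 t))" by (intro monoI k_mono) auto
  then have [measurable]: "(\<lambda>t. k (max 0 t)) \<in> borel_measurable borel" by (rule borel_measurable_mono)
  define w where "w \<theta> t = ennreal (t powr (-2 * \<theta>) * k t / t)" for \<theta> t
  have w_meas: "(\<lambda>t. w \<theta> t * indicator S t) \<in> borel_measurable lborel" if "S \<in> sets borel" "S \<subseteq> {0<..}" for \<theta> S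
  proof -
    have "(\<lambda>t. ennreal (t powr (-2 * \<theta>) * k (max 0 t) / t) * indicator S t) \<in> borel_measurable lborel"
      using that(1) by measurable
    moreover have "(\<lambda>t. ennreal (t powr (-2 * \<theta>) * k (max 0 t) / t) * indicator S t) = (\<lambda>t. w \<theta> t * indicator S t)"
    proof
      show "ennreal (t powr (-2 * \<theta>) * k (max 0 t) / t) * indicator S t = w \<theta> t * indicator S t" for t
      proof (cases "t \<in> S")
        case True
        then have "max 0 t = t" using that(2) by (auto simp: max_def)
        then show ?thesis by (simp only: w_def)
      qed simp
    qed
    ultimately show ?thesis by simp
  qed
  define N where "N \<theta> = (if \<theta> = 0 then ennreal ((n0 u)\<^sup>2) else if \<theta> = 1 then ennreal ((n1 u)\<^sup>2)
      else \<integral>\<^sup>+t\<in>{0<..}. w \<theta> t \<partial>lborel)" for \<theta>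
  have N: "interp_norm X0 n0 X1 n1 \<theta> u = sqrt_ennreal (N \<theta>)" for \<theta>
    using u nn by (simp add: interp_norm_def N_def w_def k_def sqrt_ennreal_square)
  have w_eq: "w \<theta> t = ennreal (k t * t powr (- (2 * \<theta>) - 1))" if "0 < t" for \<theta> t
  proof -
    have "t powr (-2 * \<theta>) * k t / t = k t * (t powr (- (2 * \<theta>)) / t powr 1)" using that by simp
    also have "\<dots> = k t * t powr (- (2 * \<theta>) - 1)" by (simp add: powr_diff)
    finally show ?thesis by (simp add: w_def)
  qed
  have powr2: "t0 powr (2 - 2 * \<theta>) = t0\<^sup>2 * t0 powr (- (2 * \<theta>))" for \<theta>
    using t0 by (simp add: powr_diff powr_minus divide_inverse powr_numeral)
  \<comment> \<open>For \<open>t > t0\<close> the K-functional is at least its value at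
    \<open>t0\<close>, so the tail of the integral alone gives \<open>k t0\<close> times
    \<open>t0 powr (- 2 \<theta>) / (2 \<theta>)\<close>. Since \<open>\<theta> < 1\<close>, the
    factor \<open>1 / (2 \<theta>)\<close> exceeds \<open>1 / 2\<close>, and \<open>2 C0\<close>
    serves all such \<open>\<theta>\<close>.\<close>
  have lower: "ennreal (t0 powr (2 - 2 * \<theta>)) * ennreal ((n1 u)\<^sup>2) \<le> ennreal (2 * C0) * N \<theta>" if "\<theta> < 1"
  proof (cases "\<theta> = 0")
    case True
    have "t0\<^sup>2 * (n1 u)\<^sup>2 \<le> C0 * (n0 u)\<^sup>2"
      using k_key mult_left_mono[OF k_n0[of t0], of C0] C0 by linarith
    also have "\<dots> \<le> 2 * C0 * (n0 u)\<^sup>2" using C0 by simp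
    finally show ?thesis using True t0 C0
      by (simp add: N_def ennreal_mult'[symmetric] ennreal_leI powr_numeral)
  next
    case False
    have \<theta>: "0 < \<theta>" using False \<theta>\<mu> by simp
    have "ennreal (k t0 * (t0 powr (- (2 * \<theta>)) / (2 * \<theta>)))
        = ennreal (k t0) * (\<integral>\<^sup>+t\<in>{t0<..}. ennreal (t powr (- (2 * \<theta>) - 1)) \<partial>lborel)"
      using nn_integral_powr_to_inf[of "2 * \<theta>" t0] \<theta> t0
      by (simp only: ennreal_mult'[OF k0] mult_pos_pos zero_less_numeral)
    also have "\<dots> = (\<integral>\<^sup>+t. ennreal (k t0) * (ennreal (t powr (- (2 * \<theta>) - 1)) * indicator {t0<..} t) \<partial>lborel)"
      by (rule nn_integral_cmult[symmetric]) measurable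
    also have "\<dots> \<le> (\<integral>\<^sup>+t\<in>{0<..}. w \<theta> t \<partial>lborel)"
    proof (intro nn_integral_mono)
      fix t
      show "ennreal (k t0) * (ennreal (t powr (- (2 * \<theta>) - 1)) * indicator {t0<..} t) \<le> w \<theta> t * indicator {0<..} t"
      proof (cases "t0 < t")
        case True
        then have "k t0 * t powr (- (2 * \<theta>) - 1) \<le> k t * t powr (- (2 * \<theta>) - 1)"
          using t0 by (intro mult_right_mono k_mono) auto
        then show ?thesis using True t0 k0 by (simp add: w_eq ennreal_mult'[symmetric] ennreal_leI)
      qed simp
    qed
    also have "\<dots> = N \<theta>" using False that by (simp add: N_def)
    finally have *: "ennreal (k t0 * (t0 powr (- (2 * \<theta>)) / (2 * \<theta>))) \<le> N \<theta>" .
    have "t0 powr (2 - 2 * \<theta>) * (n1 u)\<^sup>2 = t0 powr (- (2 * \<theta>)) * (t0\<^sup>2 * (n1 u)\<^sup>2)"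
      by (simp add: powr2)
    also have "\<dots> \<le> t0 powr (- (2 * \<theta>)) * (C0 * k t0)" by (intro mult_left_mono k_key) simp
    also have "\<dots> = \<theta> * (2 * C0 * (k t0 * (t0 powr (- (2 * \<theta>)) / (2 * \<theta>))))" using \<theta> by simp
    also have "\<dots> \<le> 1 * (2 * C0 * (k t0 * (t0 powr (- (2 * \<theta>)) / (2 * \<theta>))))"
      using that C0 k0 \<theta> by (intro mult_right_mono) auto
    finally have "ennreal (t0 powr (2 - 2 * \<theta>) * (n1 u)\<^sup>2)
        \<le> ennreal (2 * C0 * (k t0 * (t0 powr (- (2 * \<theta>)) / (2 * \<theta>))))" by (intro ennreal_leI) simp
    also have "\<dots> = ennreal (2 * C0) * ennreal (k t0 * (t0 powr (- (2 * \<theta>)) / (2 * \<theta>)))"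
      using C0 by (intro ennreal_mult') auto
    also have "\<dots> \<le> ennreal (2 * C0) * N \<theta>" by (intro mult_left_mono *) simp
    finally show ?thesis by (simp add: ennreal_mult'[symmetric])
  qed
  let ?C = "2 * C0 + C0 / (1 - \<mu>) + 1 / \<mu> + 1"
  have "0 \<le> C0 / (1 - \<mu>)" "0 \<le> 1 / \<mu>" using C0 \<theta>\<mu> by auto
  then have C: "1 \<le> ?C" "2 * C0 \<le> ?C" using C0 by linarith+
  have sq: "ennreal (t0 powr (2 * (\<mu> - \<theta>))) * N \<mu> \<le> ennreal ?C * N \<theta>"
  proof -
    consider "\<theta> = \<mu>" | "\<theta> < \<mu>" "\<mu> = 1" | "\<theta> < \<mu>" "\<mu> < 1" using \<theta>\<mu> by linarith
    then show ?thesis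
    proof cases
      case 1
      have "ennreal 1 * N \<mu> \<le> ennreal ?C * N \<mu>"
        by (intro mult_right_mono ennreal_leI C) simp
      then show ?thesis using 1 t0 by simp
    next
      case 2
      have "ennreal (t0 powr (2 * (\<mu> - \<theta>))) * N \<mu> \<le> ennreal (2 * C0) * N \<theta>"
        using lower 2 by (simp add: N_def algebra_simps)
      also have "\<dots> \<le> ennreal ?C * N \<theta>" by (intro mult_right_mono ennreal_leI C) simp
      finally show ?thesis .
    next
      case 3
      have \<mu>: "0 < \<mu>" using 3 \<theta>\<mu> by linarith
      have N\<mu>: "N \<mu> = (\<integral>\<^sup>+t\<in>{0<..t0}. w \<mu> t \<partial>lborel) + (\<integral>\<^sup>+t\<in>{t0<..}. w \<mu> t \<partial>lborel)"
      proof -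
        have "N \<mu> = (\<integral>\<^sup>+t. w \<mu> t * indicator {0<..t0} t + w \<mu> t * indicator {t0<..} t \<partial>lborel)"
          using \<mu> 3 t0 by (simp add: N_def) (intro nn_integral_cong, auto simp: indicator_def)
        also have "\<dots> = (\<integral>\<^sup>+t\<in>{0<..t0}. w \<mu> t \<partial>lborel) + (\<integral>\<^sup>+t\<in>{t0<..}. w \<mu> t \<partial>lborel)"
          using t0 by (intro nn_integral_add w_meas) auto
        finally show ?thesis .
      qed
      have "(\<integral>\<^sup>+t\<in>{0<..t0}. w \<mu> t \<partial>lborel)
          \<le> (\<integral>\<^sup>+t. ennreal ((n1 u)\<^sup>2) * (ennreal (t powr ((2 - 2 * \<mu>) - 1)) * indicator {0<..t0} t) \<partial>lborel)"
      \<comment> \<open>Below \<open>t0\<close> the competitor \<open>u\<close> itself gives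
        \<open>k t \<le> t^2 (n1 u)^2\<close>; the factor \<open>t^2\<close> makes the integral
        converge at 0 because \<open>\<mu> < 1\<close>.\<close>
      proof (intro nn_integral_mono)
        fix t
        show "w \<mu> t * indicator {0<..t0} t
            \<le> ennreal ((n1 u)\<^sup>2) * (ennreal (t powr ((2 - 2 * \<mu>) - 1)) * indicator {0<..t0} t)"
        proof (cases "t \<in> {0<..t0}")
          case True
          then have t: "0 < t" by simp
          have "k t * t powr (- (2 * \<mu>) - 1) \<le> (t\<^sup>2 * (n1 u)\<^sup>2) * t powr (- (2 * \<mu>) - 1)"
            by (intro mult_right_mono k_n1) simp
          also have "\<dots> = (n1 u)\<^sup>2 * (t powr 2 * t powr (- (2 * \<mu>) - 1))" using t by (simp add: powr_numeral)
          also have "\<dots> = (n1 u)\<^sup>2 * t powr ((2 - 2 * \<mu>) - 1)"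
            by (simp add: powr_add[symmetric] algebra_simps)
          finally show ?thesis using True t by (simp add: w_eq ennreal_mult'[symmetric] ennreal_leI)
        qed simp
      qed
      also have "\<dots> = ennreal ((n1 u)\<^sup>2) * (\<integral>\<^sup>+t\<in>{0<..t0}. ennreal (t powr ((2 - 2 * \<mu>) - 1)) \<partial>lborel)"
        by (rule nn_integral_cmult) measurable
      also have "\<dots> = ennreal ((n1 u)\<^sup>2 * (t0 powr (2 - 2 * \<mu>) / (2 - 2 * \<mu>)))"
      proof -
        have "(\<integral>\<^sup>+t\<in>{0<..t0}. ennreal (t powr ((2 - 2 * \<mu>) - 1)) \<partial>lborel) = ennreal (t0 powr (2 - 2 * \<mu>) / (2 - 2 * \<mu>))"
          using 3 t0 by (intro nn_integral_powr_from_0) auto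
        then show ?thesis by (simp only: ennreal_mult'[OF zero_le_power2])
      qed
      finally have "ennreal (t0 powr (2 * (\<mu> - \<theta>))) * (\<integral>\<^sup>+t\<in>{0<..t0}. w \<mu> t \<partial>lborel)
          \<le> ennreal (t0 powr (2 * (\<mu> - \<theta>))) * ennreal ((n1 u)\<^sup>2 * (t0 powr (2 - 2 * \<mu>) / (2 - 2 * \<mu>)))"
        by (intro mult_left_mono) auto
      also have "\<dots> = ennreal (1 / (2 - 2 * \<mu>)) * (ennreal (t0 powr (2 - 2 * \<theta>)) * ennreal ((n1 u)\<^sup>2))"
      proof -
        have "t0 powr (2 * (\<mu> - \<theta>)) * t0 powr (2 - 2 * \<mu>) = t0 powr (2 - 2 * \<theta>)"
          by (simp add: powr_add[symmetric] algebra_simps)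
        then have "t0 powr (2 * (\<mu> - \<theta>)) * ((n1 u)\<^sup>2 * (t0 powr (2 - 2 * \<mu>) / (2 - 2 * \<mu>)))
            = (1 / (2 - 2 * \<mu>)) * (t0 powr (2 - 2 * \<theta>) * (n1 u)\<^sup>2)" by (simp add: ac_simps)
        then show ?thesis using 3 by (simp add: ennreal_mult'[symmetric])
      qed
      also have "\<dots> \<le> ennreal (1 / (2 - 2 * \<mu>)) * (ennreal (2 * C0) * N \<theta>)"
        using 3 by (intro mult_left_mono lower) auto
      also have "\<dots> = ennreal (C0 / (1 - \<mu>)) * N \<theta>"
      proof -
        have "1 / (2 - 2 * \<mu>) * (2 * C0) = C0 / (1 - \<mu>)" using 3 by (simp add: field_simps)
        then show ?thesis using 3 C0 by (simp add: ennreal_mult'[symmetric] mult.assoc[symmetric])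
      qed
      finally have p1: "ennreal (t0 powr (2 * (\<mu> - \<theta>))) * (\<integral>\<^sup>+t\<in>{0<..t0}. w \<mu> t \<partial>lborel)
          \<le> ennreal (C0 / (1 - \<mu>)) * N \<theta>" .
      \<comment> \<open>Above \<open>t0\<close> the norms are compared directly: for
        \<open>\<theta> = 0\<close> through \<open>k t \<le> (n0 u)^2\<close>, otherwise through the
        weights, as \<open>t0 powr (2 (\<mu> - \<theta>))\<close> is at most
        \<open>t powr (2 (\<mu> - \<theta>))\<close>.\<close>
      have p2: "ennreal (t0 powr (2 * (\<mu> - \<theta>))) * (\<integral>\<^sup>+t\<in>{t0<..}. w \<mu> t \<partial>lborel)
          \<le> ennreal (1 / \<mu> + 1) * N \<theta>"
      proof (cases "\<theta> = 0")
        case True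
        have "(\<integral>\<^sup>+t\<in>{t0<..}. w \<mu> t \<partial>lborel)
            \<le> (\<integral>\<^sup>+t. ennreal ((n0 u)\<^sup>2) * (ennreal (t powr (- (2 * \<mu>) - 1)) * indicator {t0<..} t) \<partial>lborel)"
        proof (intro nn_integral_mono)
          fix t
          show "w \<mu> t * indicator {t0<..} t
              \<le> ennreal ((n0 u)\<^sup>2) * (ennreal (t powr (- (2 * \<mu>) - 1)) * indicator {t0<..} t)"
          proof (cases "t0 < t")
            case True
            have "k t * t powr (- (2 * \<mu>) - 1) \<le> (n0 u)\<^sup>2 * t powr (- (2 * \<mu>) - 1)"
              by (intro mult_right_mono k_n0) simp
            then show ?thesis using True t0 by (simp add: w_eq ennreal_mult'[symmetric] ennreal_leI)
          qed simp
        qed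
        also have "\<dots> = ennreal ((n0 u)\<^sup>2) * (\<integral>\<^sup>+t\<in>{t0<..}. ennreal (t powr (- (2 * \<mu>) - 1)) \<partial>lborel)"
          by (rule nn_integral_cmult) measurable
        also have "\<dots> = ennreal ((n0 u)\<^sup>2 * (t0 powr (- (2 * \<mu>)) / (2 * \<mu>)))"
          using nn_integral_powr_to_inf[of "2 * \<mu>" t0] \<mu> t0
          by (simp only: ennreal_mult'[OF zero_le_power2] mult_pos_pos zero_less_numeral)
        finally have "ennreal (t0 powr (2 * (\<mu> - \<theta>))) * (\<integral>\<^sup>+t\<in>{t0<..}. w \<mu> t \<partial>lborel)
            \<le> ennreal (t0 powr (2 * (\<mu> - \<theta>))) * ennreal ((n0 u)\<^sup>2 * (t0 powr (- (2 * \<mu>)) / (2 * \<mu>)))"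
          by (intro mult_left_mono) auto
        also have "\<dots> = ennreal (1 / (2 * \<mu>) * (n0 u)\<^sup>2)"
        proof -
          have "t0 powr (2 * \<mu>) * t0 powr (- (2 * \<mu>)) = 1" using t0 by (simp add: powr_add[symmetric])
          then have "t0 powr (2 * (\<mu> - \<theta>)) * ((n0 u)\<^sup>2 * (t0 powr (- (2 * \<mu>)) / (2 * \<mu>))) = 1 / (2 * \<mu>) * (n0 u)\<^sup>2"
            using True by simp
          then show ?thesis by (simp only: ennreal_mult'[OF powr_ge_zero, symmetric])
        qed
        also have "\<dots> = ennreal (1 / (2 * \<mu>)) * N \<theta>"
        proof -
          have "N \<theta> = ennreal ((n0 u)\<^sup>2)" using True by (simp add: N_def)
          then show ?thesis by (simp only: ennreal_mult''[OF zero_le_power2])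
        qed
        also have "\<dots> \<le> ennreal (1 / \<mu> + 1) * N \<theta>"
          using \<mu> by (intro mult_right_mono ennreal_leI) (auto simp: field_simps)
        finally show ?thesis .
      next
        case False
        have "ennreal (t0 powr (2 * (\<mu> - \<theta>))) * (\<integral>\<^sup>+t\<in>{t0<..}. w \<mu> t \<partial>lborel)
            = (\<integral>\<^sup>+t. ennreal (t0 powr (2 * (\<mu> - \<theta>))) * (w \<mu> t * indicator {t0<..} t) \<partial>lborel)"
          using t0 by (intro nn_integral_cmult[symmetric] w_meas) auto
        also have "\<dots> \<le> (\<integral>\<^sup>+t\<in>{0<..}. w \<theta> t \<partial>lborel)"
        proof (intro nn_integral_mono)
          fix t
          show "ennreal (t0 powr (2 * (\<mu> - \<theta>))) * (w \<mu> t * indicator {t0<..} t) \<le> w \<theta> t * indicator {0<..} t"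
          proof (cases "t0 < t")
            case True
            then have t: "0 < t" using t0 by simp
            have "t0 powr (2 * (\<mu> - \<theta>)) * (k t * t powr (- (2 * \<mu>) - 1))
                \<le> t powr (2 * (\<mu> - \<theta>)) * (k t * t powr (- (2 * \<mu>) - 1))"
              using True t0 3 k0 by (intro mult_right_mono powr_mono2) auto
            also have "\<dots> = k t * (t powr (2 * (\<mu> - \<theta>)) * t powr (- (2 * \<mu>) - 1))" by simp
            also have "\<dots> = k t * t powr (- (2 * \<theta>) - 1)"
            proof -
              have "2 * (\<mu> - \<theta>) + (- (2 * \<mu>) - 1) = - (2 * \<theta>) - 1" by simp
              then show ?thesis by (simp only: powr_add[symmetric])
            qed
            finally show ?thesis using True t by (simp add: w_eq ennreal_mult'[symmetric] ennreal_leI)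
          qed simp
        qed
        also have "\<dots> = ennreal 1 * N \<theta>" using False 3 by (simp add: N_def)
        also have "\<dots> \<le> ennreal (1 / \<mu> + 1) * N \<theta>"
          using \<mu> by (intro mult_right_mono ennreal_leI) auto
        finally show ?thesis .
      qed
      have "ennreal (t0 powr (2 * (\<mu> - \<theta>))) * N \<mu>
          \<le> ennreal (C0 / (1 - \<mu>)) * N \<theta> + ennreal (1 / \<mu> + 1) * N \<theta>"
        unfolding N\<mu> distrib_left by (intro add_mono p1 p2)
      also have "\<dots> = ennreal (C0 / (1 - \<mu>) + (1 / \<mu> + 1)) * N \<theta>"
        using 3 \<mu> C0 by (simp add: ennreal_plus distrib_right)
      also have "\<dots> \<le> ennreal ?C * N \<theta>" using C0 by (intro mult_right_mono ennreal_leI) simp_all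
      finally show ?thesis .
    qed
  qed
  have "ennreal (t0 powr (\<mu> - \<theta>)) * sqrt_ennreal (N \<mu>) = sqrt_ennreal (ennreal (t0 powr (2 * (\<mu> - \<theta>))) * N \<mu>)"
  proof -
    have "t0 powr (\<mu> - \<theta>) = sqrt (t0 powr (2 * (\<mu> - \<theta>)))"
    proof -
      have "t0 powr (2 * (\<mu> - \<theta>)) = (t0 powr (\<mu> - \<theta>))\<^sup>2" by (simp only: mult_2 powr_add power2_eq_square)
      then show ?thesis by (simp only: real_sqrt_abs abs_of_nonneg powr_ge_zero)
    qed
    then show ?thesis using t0 by (subst sqrt_ennreal_mult) auto
  qed
  also have "\<dots> \<le> sqrt_ennreal (ennreal ?C * N \<theta>)" by (intro sqrt_ennreal_mono sq)
  also have "\<dots> = ennreal (sqrt ?C) * sqrt_ennreal (N \<theta>)" using C(1) by (intro sqrt_ennreal_mult) linarith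
  finally show ?thesis unfolding N .
qed

section \<open>Element maps\<close>

lemma is_eigenvalue_of_char_poly:
  fixes A :: "real^2^2"
  assumes sym: "A $ 2 $ 1 = A $ 1 $ 2" and l: "(A $ 1 $ 1 - l) * (A $ 2 $ 2 - l) = (A $ 1 $ 2)\<^sup>2"
  shows "is_eigenvalue A l"
proof -
  let ?b = "A $ 1 $ 2" and ?\<alpha> = "A $ 1 $ 1 - l"
  have eig: "A *v v = l *\<^sub>R v" if "?\<alpha> * v $ 1 + ?b * v $ 2 = 0" "?b * v $ 1 + (A $ 2 $ 2 - l) * v $ 2 = 0" for v
    using that by (simp add: vec_eq_iff forall_2 matrix_vector_mult_def sum_2 sym algebra_simps)
  show ?thesis
  \<comment> \<open>The vector \<open>(- ?b, ?\<alpha>)\<close> solves the first equation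
    identically and the second by the characteristic equation. It fails only when it is zero, and
    then \<open>(1, 0)\<close> is an eigenvector.\<close>
  proof (cases "?b = 0 \<and> ?\<alpha> = 0")
    case True
    have "A *v pt 1 0 = l *\<^sub>R pt 1 0" using True by (intro eig) auto
    moreover have "pt 1 0 \<noteq> 0" by (simp add: vec_eq_iff forall_2)
    ultimately show ?thesis unfolding is_eigenvalue_def by blast
  next
    case False
    have "A *v pt (- ?b) ?\<alpha> = l *\<^sub>R pt (- ?b) ?\<alpha>"
      using l by (intro eig) (auto simp: power2_eq_square algebra_simps)
    moreover have "pt (- ?b) ?\<alpha> \<noteq> 0" using False by (auto simp: vec_eq_iff forall_2)
    ultimately show ?thesis unfolding is_eigenvalue_def by blast
  qed
qed

lemma quadratic_form_nonneg:
  fixes \<alpha> b \<delta> x y :: real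
  assumes "0 \<le> \<alpha>" "0 \<le> \<delta>" "\<alpha> * \<delta> = b\<^sup>2"
  shows "0 \<le> \<alpha> * x\<^sup>2 + 2 * b * x * y + \<delta> * y\<^sup>2"
proof (cases "\<alpha> = 0")
  case True
  then show ?thesis using assms by simp
next
  case False
  have "\<alpha> * (\<alpha> * x\<^sup>2 + 2 * b * x * y + \<delta> * y\<^sup>2) = (\<alpha> * x + b * y)\<^sup>2 + (\<alpha> * \<delta> - b\<^sup>2) * y\<^sup>2"
    by (simp add: power2_eq_square algebra_simps)
  then have "0 \<le> \<alpha> * (\<alpha> * x\<^sup>2 + 2 * b * x * y + \<delta> * y\<^sup>2)" using assms(3) by simp
  then show ?thesis using False assms(1) by (simp add: zero_le_mult_iff)
qed

text \<open>The hypothesis bounds eigenvalues without asserting that there are any, so the two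
  extreme ones are constructed as roots \<open>l\<close> and \<open>L\<close> of the characteristic
  equation. \<open>A - l\<close> and \<open>L - A\<close> have determinant zero and nonnegative
  diagonal, hence are positive semidefinite.\<close>

lemma norm_bounds_of_gramian_eigenvalues:
  fixes J :: "real^2^2"
  assumes ev: "\<And>l. is_eigenvalue (transpose J ** J) l \<Longrightarrow> c \<le> l \<and> l \<le> d"
  shows "c * (norm v)\<^sup>2 \<le> (norm (J *v v))\<^sup>2" "(norm (J *v v))\<^sup>2 \<le> d * (norm v)\<^sup>2"
proof -
  define A where "A = transpose J ** J"
  define a where "a = A $ 1 $ 1"
  define b where "b = A $ 1 $ 2"
  define e where "e = A $ 2 $ 2"
  have sym: "A $ 2 $ 1 = b" by (simp add: A_def b_def matrix_matrix_mult_def transpose_def sum_2 mult.commute)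
  have form: "(norm (J *v v))\<^sup>2 = a * (v $ 1)\<^sup>2 + 2 * b * v $ 1 * v $ 2 + e * (v $ 2)\<^sup>2"
    unfolding norm_sq_vec2
    by (simp add: a_def b_def e_def A_def matrix_matrix_mult_def matrix_vector_mult_def transpose_def sum_2
        power2_eq_square algebra_simps)
  define s where "s = sqrt ((a - e)\<^sup>2 + 4 * b\<^sup>2)"
  have s2: "s\<^sup>2 = (a - e)\<^sup>2 + 4 * b\<^sup>2" by (simp add: s_def)
  have s_ge: "\<bar>a - e\<bar> \<le> s" unfolding s_def by (intro real_le_rsqrt) simp
  define l where "l = (a + e - s) / 2"
  define L where "L = (a + e + s) / 2"
  have q: "(a - l) * (e - l) = b\<^sup>2" "(a - L) * (e - L) = b\<^sup>2"
    using s2 by (simp_all add: l_def L_def power2_eq_square field_simps)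
  have "is_eigenvalue A l" "is_eigenvalue A L"
    using q by (auto intro!: is_eigenvalue_of_char_poly simp: a_def e_def b_def sym)
  then have cl: "c \<le> l" and dL: "L \<le> d" using ev by (auto simp: A_def)
  have 1: "0 \<le> (a - l) * (v $ 1)\<^sup>2 + 2 * b * v $ 1 * v $ 2 + (e - l) * (v $ 2)\<^sup>2"
    using s_ge q by (intro quadratic_form_nonneg) (auto simp: l_def field_simps)
  have 2: "0 \<le> (L - a) * (v $ 1)\<^sup>2 + 2 * (- b) * v $ 1 * v $ 2 + (L - e) * (v $ 2)\<^sup>2"
  proof (rule quadratic_form_nonneg)
    show "(L - a) * (L - e) = (- b)\<^sup>2" using q(2) by (simp add: algebra_simps)
  qed (use s_ge in \<open>auto simp: L_def field_simps\<close>)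
  have "c * (norm v)\<^sup>2 \<le> l * (norm v)\<^sup>2" "L * (norm v)\<^sup>2 \<le> d * (norm v)\<^sup>2"
    using cl dL by (auto intro: mult_right_mono)
  then show "c * (norm v)\<^sup>2 \<le> (norm (J *v v))\<^sup>2" "(norm (J *v v))\<^sup>2 \<le> d * (norm v)\<^sup>2"
    unfolding form using 1 2 unfolding norm_sq_vec2 by (simp_all add: algebra_simps)
qed

text \<open>With \<open>h = diameter K\<close> the eigenvalues of the Gramian lie in
  \<open>[h^2 / \<gamma>, h^2 \<gamma>]\<close>; the singular values of the Jacobian are their
  square roots.\<close>

lemma shape_regular_bounds:
  assumes sr: "shape_regular \<gamma> K Kh F" and x: "x \<in> Kh" and h: "0 < diameter K" and \<gamma>: "0 < \<gamma>"
    and F: "(F has_derivative (\<lambda>v. J *v v)) (at x)"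
  shows "(diameter K / sqrt \<gamma>) * norm v \<le> norm (J *v v)" "norm (J *v v) \<le> (diameter K * sqrt \<gamma>) * norm v"
proof -
  have "frechet_derivative F (at x) = (\<lambda>v. J *v v)" using frechet_derivative_at[OF F] by simp
  then have g: "gramian F x = transpose J ** J"
    by (simp add: gramian_def Let_def)
  have ev: "(diameter K)\<^sup>2 / \<gamma> \<le> l \<and> l \<le> (diameter K)\<^sup>2 * \<gamma>" if "is_eigenvalue (transpose J ** J) l" for l
  proof -
    have "0 < l" "(diameter K)\<^sup>2 / l \<le> \<gamma>" "l / (diameter K)\<^sup>2 \<le> \<gamma>"
      using sr x that by (auto simp: shape_regular_def g)
    then show ?thesis using h \<gamma> by (simp add: field_simps)
  qed
  have *: "(diameter K)\<^sup>2 / \<gamma> * (norm v)\<^sup>2 \<le> (norm (J *v v))\<^sup>2" "(norm (J *v v))\<^sup>2 \<le> (diameter K)\<^sup>2 * \<gamma> * (norm v)\<^sup>2"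
    using norm_bounds_of_gramian_eigenvalues[OF ev] by auto
  have "((diameter K / sqrt \<gamma>) * norm v)\<^sup>2 \<le> (norm (J *v v))\<^sup>2"
    using *(1) \<gamma> by (simp add: power_mult_distrib power_divide)
  then show "(diameter K / sqrt \<gamma>) * norm v \<le> norm (J *v v)" by (rule power2_le_imp_le) simp
  have "(norm (J *v v))\<^sup>2 \<le> ((diameter K * sqrt \<gamma>) * norm v)\<^sup>2"
    using *(2) \<gamma> by (simp add: power_mult_distrib)
  then show "norm (J *v v) \<le> (diameter K * sqrt \<gamma>) * norm v"
    by (rule power2_le_imp_le) (use h \<gamma> in simp)
qed

section \<open>Parallelograms covering the reference elements\<close>

definition aff :: "real^2 \<Rightarrow> real^2 \<Rightarrow> real^2 \<Rightarrow> real^2 \<Rightarrow> real^2" where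
  "aff V a b z = V + z $ 1 *\<^sub>R a + z $ 2 *\<^sub>R b"

text \<open>A bound \<open>[1 / 2, 2]\<close> for the singular values of the matrix with columns
  \<open>a\<close> and \<open>b\<close>. It is wide enough for both reference elements: orthogonal
  edges of lengths 2 and \<open>sqrt 3\<close> for the square, unit vectors at 60 degrees for the
  triangle.\<close>

definition good_frame :: "real^2 \<Rightarrow> real^2 \<Rightarrow> bool" where
  "good_frame a b \<longleftrightarrow> (\<forall>v :: real^2. 1 / 2 * norm v \<le> norm (v $ 1 *\<^sub>R a + v $ 2 *\<^sub>R b) \<and>
     norm (v $ 1 *\<^sub>R a + v $ 2 *\<^sub>R b) \<le> 2 * norm v)"

lemma good_frameI:
  assumes "\<And>x y. (1 / 4) * (x\<^sup>2 + y\<^sup>2) \<le> (a \<bullet> a) * x\<^sup>2 + 2 * (a \<bullet> b) * x * y + (b \<bullet> b) * y\<^sup>2"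
    "\<And>x y. (a \<bullet> a) * x\<^sup>2 + 2 * (a \<bullet> b) * x * y + (b \<bullet> b) * y\<^sup>2 \<le> 4 * (x\<^sup>2 + y\<^sup>2)"
  shows "good_frame a b"
  unfolding good_frame_def
proof (intro allI conjI)
  fix v :: "real^2"
  have e: "(norm (v $ 1 *\<^sub>R a + v $ 2 *\<^sub>R b))\<^sup>2 = (a \<bullet> a) * (v $ 1)\<^sup>2 + 2 * (a \<bullet> b) * v $ 1 * v $ 2 + (b \<bullet> b) * (v $ 2)\<^sup>2"
    unfolding power2_norm_eq_inner
    by (simp add: inner_add_left inner_add_right inner_commute power2_eq_square algebra_simps)
  have "(1 / 2 * norm v)\<^sup>2 \<le> (norm (v $ 1 *\<^sub>R a + v $ 2 *\<^sub>R b))\<^sup>2"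
    unfolding e unfolding power_mult_distrib norm_sq_vec2 using assms(1)[of "v $ 1" "v $ 2"] by (simp add: power_divide)
  then show "1 / 2 * norm v \<le> norm (v $ 1 *\<^sub>R a + v $ 2 *\<^sub>R b)" by (rule power2_le_imp_le) simp
  have "(norm (v $ 1 *\<^sub>R a + v $ 2 *\<^sub>R b))\<^sup>2 \<le> (2 * norm v)\<^sup>2"
    unfolding e unfolding power_mult_distrib norm_sq_vec2 using assms(2)[of "v $ 1" "v $ 2"] by simp
  then show "norm (v $ 1 *\<^sub>R a + v $ 2 *\<^sub>R b) \<le> 2 * norm v" by (rule power2_le_imp_le) simp
qed

lemma vec2_inner: "(a :: real^2) \<bullet> b = a $ 1 * b $ 1 + a $ 2 * b $ 2"
  by (simp add: inner_vec_def sum_2)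

text \<open>The reference triangle is equilateral with side 2, so the halves of two edges at a
  vertex are unit vectors at 60 degrees.\<close>

lemma good_frame_unit:
  assumes "a \<bullet> a = 1" "b \<bullet> b = 1" "a \<bullet> b = 1 / 2"
  shows "good_frame a b"
proof (rule good_frameI; unfold assms)
  fix x y :: real
  have "0 \<le> (x + y)\<^sup>2" "0 \<le> (x - y)\<^sup>2" "0 \<le> x\<^sup>2" "0 \<le> y\<^sup>2" by simp_all
  then show "(1 / 4) * (x\<^sup>2 + y\<^sup>2) \<le> 1 * x\<^sup>2 + 2 * (1 / 2) * x * y + 1 * y\<^sup>2"
    "1 * x\<^sup>2 + 2 * (1 / 2) * x * y + 1 * y\<^sup>2 \<le> 4 * (x\<^sup>2 + y\<^sup>2)"
    unfolding power2_sum power2_diff by (simp_all add: algebra_simps)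
qed

lemma ref_triangle_eq:
  defines "T0 \<equiv> pt 0 (2 / sqrt 3)" and "T1 \<equiv> pt 1 (- 1 / sqrt 3)" and "T2 \<equiv> pt (- 1) (- 1 / sqrt 3)"
  shows "ref_triangle = {v. \<exists>x y z. 0 < x \<and> 0 < y \<and> 0 < z \<and> x + y + z = 1 \<and> x *\<^sub>R T0 + y *\<^sub>R T1 + z *\<^sub>R T2 = v}"
proof -
  have v: "(vector [0, 2 / sqrt 3] :: real^2) = T0" "(vector [1, - 1 / sqrt 3] :: real^2) = T1"
    "(vector [- 1, - 1 / sqrt 3] :: real^2) = T2"
    by (simp_all add: vec_eq_iff forall_2 T0_def T1_def T2_def)
  have s3: "sqrt 3 \<noteq> 0" by simp
  have "\<not> collinear {T0, T1, T2}"
  proof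
    assume "collinear {T0, T1, T2}"
    then consider "T0 = T2" | u where "T1 = u *\<^sub>R T0 + (1 - u) *\<^sub>R T2"
      unfolding collinear_3_expand by blast
    then show False
    proof cases
      case 1
      then have "T0 $ 1 = T2 $ 1" by simp
      then show False by (simp add: T0_def T2_def)
    next
      case 2
      then have "T1 $ 1 = u * T0 $ 1 + (1 - u) * T2 $ 1" "T1 $ 2 = u * T0 $ 2 + (1 - u) * T2 $ 2" by simp_all
      then have "u = 2" "- 1 / sqrt 3 = u * (2 / sqrt 3) + (1 - u) * (- 1 / sqrt 3)"
        by (simp_all add: T0_def T1_def T2_def)
      then show False using s3 by (simp add: field_simps)
    qed
  qed
  then show ?thesis unfolding ref_triangle_def v
    by (intro interior_convex_hull_3_minimal) auto
qed

text \<open>The square is one parallelogram; the triangle is covered by the three parallelograms spanned at a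
  vertex by the halves of the adjacent edges, since at most one barycentric coordinate is at least \<open>1/2\<close>.\<close>

lemma reference_cover:
  assumes "Kh \<in> {ref_square, ref_triangle}"
  shows "\<exists>S. finite S \<and> card S \<le> 3 \<and> Kh \<subseteq> (\<Union>(V, a, b)\<in>S. aff V a b ` box (pt 0 0) (pt 1 1)) \<and>
    (\<forall>(V, a, b)\<in>S. good_frame a b \<and> aff V a b ` box (pt 0 0) (pt 1 1) \<subseteq> Kh)"
proof (cases "Kh = ref_square")
  case True
  let ?V = "pt (- 1) (- 1 / sqrt 3)" and ?a = "pt 2 0" and ?b = "pt 0 (sqrt 3)"
  have gf: "good_frame ?a ?b"
    by (intro good_frameI) (auto simp: vec2_inner)
  have sq: "2 / sqrt 3 = sqrt 3 - 1 / sqrt 3"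
    by (simp add: field_simps)
  have mem: "z \<in> ref_square \<longleftrightarrow> - 1 < z $ 1 \<and> z $ 1 < 1 \<and> - 1 / sqrt 3 < z $ 2 \<and> z $ 2 < 2 / sqrt 3" for z
    by (auto simp: ref_square_def mem_box_cart forall_2)
  have "aff ?V ?a ?b z \<in> ref_square" if "z \<in> box (pt 0 0) (pt 1 1)" for z
    using that unfolding mem sq by (auto simp: aff_def mem_box_cart forall_2)
  moreover have "z \<in> aff ?V ?a ?b ` box (pt 0 0) (pt 1 1)" if "z \<in> ref_square" for z
  proof (rule image_eqI)
    show "z = aff ?V ?a ?b (pt ((z $ 1 + 1) / 2) ((z $ 2 + 1 / sqrt 3) / sqrt 3))"
      by (simp add: aff_def vec_eq_iff forall_2) (simp add: add_divide_distrib)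
    show "pt ((z $ 1 + 1) / 2) ((z $ 2 + 1 / sqrt 3) / sqrt 3) \<in> box (pt 0 0) (pt 1 1)"
      using that unfolding mem sq by (auto simp: mem_box_cart forall_2)
  qed
  ultimately show ?thesis using True gf
    by (intro exI[of _ "{(?V, ?a, ?b)}"]) auto
next
  case False
  define T0 where "T0 = pt 0 (2 / sqrt 3)"
  define T1 where "T1 = pt 1 (- 1 / sqrt 3)"
  define T2 where "T2 = pt (- 1) (- 1 / sqrt 3)"
  have Kh: "Kh = {v. \<exists>x y z. 0 < x \<and> 0 < y \<and> 0 < z \<and> x + y + z = 1 \<and> x *\<^sub>R T0 + y *\<^sub>R T1 + z *\<^sub>R T2 = v}"
    using False assms ref_triangle_eq by (simp add: T0_def T1_def T2_def)
  define E where "E V W = (1 / 2) *\<^sub>R (W - V)" for V W :: "real^2"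
  \<comment> \<open>In barycentric coordinates \<open>z\<close> is sent to the point with weights
    \<open>z $ 1 / 2\<close> at \<open>W\<close> and \<open>z $ 2 / 2\<close> at \<open>Z\<close>;
    the open unit square thus yields the points whose weights at \<open>W\<close> and
    \<open>Z\<close> are positive and below \<open>1 / 2\<close>.\<close>
  have corner: "aff V (E V W) (E V Z) z = (1 - z $ 1 / 2 - z $ 2 / 2) *\<^sub>R V + (z $ 1 / 2) *\<^sub>R W + (z $ 2 / 2) *\<^sub>R Z"
    for V W Z z by (simp add: aff_def E_def algebra_simps)
  have in_box: "z \<in> box (pt 0 0) (pt 1 1) \<longleftrightarrow> 0 < z $ 1 \<and> z $ 1 < 1 \<and> 0 < z $ 2 \<and> z $ 2 < 1" for z :: "real^2"
    by (auto simp: mem_box_cart forall_2)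
  have sub: "aff T0 (E T0 T1) (E T0 T2) ` box (pt 0 0) (pt 1 1) \<subseteq> Kh"
    "aff T1 (E T1 T0) (E T1 T2) ` box (pt 0 0) (pt 1 1) \<subseteq> Kh"
    "aff T2 (E T2 T0) (E T2 T1) ` box (pt 0 0) (pt 1 1) \<subseteq> Kh"
  proof -
    have I: "x *\<^sub>R T0 + y *\<^sub>R T1 + z *\<^sub>R T2 \<in> Kh" if "0 < x" "0 < y" "0 < z" "x + y + z = 1" for x y z
      using that unfolding Kh by blast
    show "aff T0 (E T0 T1) (E T0 T2) ` box (pt 0 0) (pt 1 1) \<subseteq> Kh"
      by (auto simp: corner in_box intro!: I)
    show "aff T1 (E T1 T0) (E T1 T2) ` box (pt 0 0) (pt 1 1) \<subseteq> Kh"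
    proof safe
      fix z assume "z \<in> box (pt 0 0) (pt 1 1 :: real^2)"
      then have "(z $ 1 / 2) *\<^sub>R T0 + (1 - z $ 1 / 2 - z $ 2 / 2) *\<^sub>R T1 + (z $ 2 / 2) *\<^sub>R T2 \<in> Kh"
        by (intro I) (auto simp: in_box)
      then show "aff T1 (E T1 T0) (E T1 T2) z \<in> Kh" by (simp only: corner ac_simps)
    qed
    show "aff T2 (E T2 T0) (E T2 T1) ` box (pt 0 0) (pt 1 1) \<subseteq> Kh"
    proof safe
      fix z assume "z \<in> box (pt 0 0) (pt 1 1 :: real^2)"
      then have "(z $ 1 / 2) *\<^sub>R T0 + (z $ 2 / 2) *\<^sub>R T1 + (1 - z $ 1 / 2 - z $ 2 / 2) *\<^sub>R T2 \<in> Kh"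
        by (intro I) (auto simp: in_box)
      then show "aff T2 (E T2 T0) (E T2 T1) z \<in> Kh" by (simp only: corner ac_simps)
    qed
  qed
  have cover: "v \<in> aff T0 (E T0 T1) (E T0 T2) ` box (pt 0 0) (pt 1 1)
      \<union> aff T1 (E T1 T0) (E T1 T2) ` box (pt 0 0) (pt 1 1)
      \<union> aff T2 (E T2 T0) (E T2 T1) ` box (pt 0 0) (pt 1 1)" if vK: "v \<in> Kh" for v
  proof -
    obtain x y z where xyz: "0 < x" "0 < y" "0 < z" "x + y + z = 1" "x *\<^sub>R T0 + y *\<^sub>R T1 + z *\<^sub>R T2 = v"
      using vK unfolding Kh by blast
    consider "y < 1/2" "z < 1/2" | "x < 1/2" "z < 1/2" | "x < 1/2" "y < 1/2" using xyz by linarith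
    then show ?thesis
    proof cases
      case 1
      have "v = aff T0 (E T0 T1) (E T0 T2) (pt (2 * y) (2 * z))"
      proof -
        have e: "x = 1 - y - z" using xyz by simp
        show ?thesis unfolding corner xyz(5)[symmetric] e by (simp add: ac_simps)
      qed
      moreover have "pt (2 * y) (2 * z) \<in> box (pt 0 0) (pt 1 1)" using 1 xyz by (simp add: in_box)
      ultimately show ?thesis by blast
    next
      case 2
      have "v = aff T1 (E T1 T0) (E T1 T2) (pt (2 * x) (2 * z))"
      proof -
        have e: "y = 1 - x - z" using xyz by simp
        show ?thesis unfolding corner xyz(5)[symmetric] e by (simp add: ac_simps)
      qed
      moreover have "pt (2 * x) (2 * z) \<in> box (pt 0 0) (pt 1 1)" using 2 xyz by (simp add: in_box)
      ultimately show ?thesis by blast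
    next
      case 3
      have "v = aff T2 (E T2 T0) (E T2 T1) (pt (2 * x) (2 * y))"
      proof -
        have e: "z = 1 - x - y" using xyz by simp
        show ?thesis unfolding corner xyz(5)[symmetric] e by (simp add: ac_simps)
      qed
      moreover have "pt (2 * x) (2 * y) \<in> box (pt 0 0) (pt 1 1)" using 3 xyz by (simp add: in_box)
      ultimately show ?thesis by blast
    qed
  qed
  have gf: "good_frame (E T0 T1) (E T0 T2)" "good_frame (E T1 T0) (E T1 T2)" "good_frame (E T2 T0) (E T2 T1)"
    by (intro good_frame_unit; simp add: E_def vec2_inner T0_def T1_def T2_def field_simps)+
  show ?thesis
  proof (intro exI[of _ "{(T0, E T0 T1, E T0 T2), (T1, E T1 T0, E T1 T2), (T2, E T2 T0, E T2 T1)}"] conjI)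
    show "card {(T0, E T0 T1, E T0 T2), (T1, E T1 T0, E T1 T2), (T2, E T2 T0, E T2 T1)} \<le> 3"
      by (rule order_trans[OF card_insert_le_m1[of 3] order_refl]) (auto simp: card_insert_if)
    show "Kh \<subseteq> (\<Union>(V, a, b)\<in>{(T0, E T0 T1, E T0 T2), (T1, E T1 T0, E T1 T2), (T2, E T2 T0, E T2 T1)}.
        aff V a b ` box (pt 0 0) (pt 1 1))"
      using cover by fastforce
  qed (use gf sub in auto)
qed

text \<open>Along an axis-parallel line both components of the affine map are linear in the
  parameter, so a monomial with exponents \<open>i, j \<le> p\<close> becomes a polynomial of degree
  at most \<open>i + j \<le> 2 p\<close>. Both polynomial spaces are covered.\<close>

lemma slicewise_poly_aff:
  assumes I: "I \<subseteq> {..p} \<times> {..p}" and q: "q \<in> monomial_span I"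
  shows "slicewise_poly (2 * p + 1) (\<lambda>z. q (aff V a b z))"
proof -
  obtain c where c: "q = (\<lambda>x. \<Sum>(i, j)\<in>I. c i j * ((x $ 1) ^ i * (x $ 2) ^ j))"
    using q by (auto simp: monomial_span_def)
  have lin: "\<exists>r. coeffs_below (2 * p + 1) r \<and> (\<forall>x. q (w x) = poly r x)"
    if w: "\<And>x. w x $ 1 = poly [:e, d:] x" "\<And>x. w x $ 2 = poly [:e', d':] x" for w :: "real \<Rightarrow> real^2" and e d e' d'
  proof -
    define r where "r = (\<Sum>(i, j)\<in>I. smult (c i j) ([:e, d:] ^ i * [:e', d':] ^ j))"
    have "q (w x) = poly r x" for x
      unfolding c r_def poly_sum w by (intro sum.cong) (auto simp: poly_power)
    moreover have "coeffs_below (2 * p + 1) r"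
    proof -
      have "degree r \<le> 2 * p" unfolding r_def
      proof (intro degree_sum_le, goal_cases)
        case 1
        show ?case using I finite_subset by blast
      next
        case (2 x)
        obtain i j where x: "x = (i, j)" "i \<le> p" "j \<le> p" using 2 I by auto
        have d1: "degree ([:e, d:] ^ i) \<le> i" "degree ([:e', d':] ^ j) \<le> j"
          using degree_power_le[of "[:e, d:]" i] degree_power_le[of "[:e', d':]" j]
          by (auto elim!: order_trans simp: degree_pCons_eq_if split: if_splits)
        have "degree (smult (c i j) ([:e, d:] ^ i * [:e', d':] ^ j)) \<le> i + j"
          using degree_smult_le degree_mult_le d1 by (meson add_mono order_trans)
        then show ?case using x by simp
      qed
      then show ?thesis by (auto simp: coeffs_below_def intro: coeff_eq_0)
    qed
    ultimately show ?thesis by blast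
  qed
  show ?thesis
    unfolding slicewise_poly_def
  proof (intro conjI allI)
    fix y
    show "\<exists>r. coeffs_below (2 * p + 1) r \<and> (\<forall>x. q (aff V a b (pt x y)) = poly r x)"
      by (rule lin[of _ "V $ 1 + y * b $ 1" "a $ 1" "V $ 2 + y * b $ 2" "a $ 2"]) (simp_all add: aff_def algebra_simps)
    show "\<exists>r. coeffs_below (2 * p + 1) r \<and> (\<forall>x. q (aff V a b (pt y x)) = poly r x)"
      by (rule lin[of _ "V $ 1 + y * a $ 1" "b $ 1" "V $ 2 + y * a $ 2" "b $ 2"]) (simp_all add: aff_def algebra_simps)
  qed
qed

section \<open>Polynomials transported to the physical element\<close>

lemma monomial_span_C1:
  assumes "q \<in> monomial_span I"
  obtains G where "\<And>x. (q has_derivative (\<lambda>v. G x \<bullet> v)) (at x)" "continuous_on UNIV G"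
proof -
  obtain c where c: "q = (\<lambda>x. \<Sum>(i, j)\<in>I. c i j * ((x $ 1) ^ i * (x $ 2) ^ j))"
    using assms by (auto simp: monomial_span_def)
  \<comment> \<open>For exponent 0 the truncated \<open>i - 1\<close> is harmless, since the factor
    \<open>of_nat i\<close> is 0.\<close>
  define G where "G x = (\<Sum>(i, j)\<in>I. c i j *\<^sub>R pt (of_nat i * (x $ 1) ^ (i - 1) * (x $ 2) ^ j)
      ((x $ 1) ^ i * (of_nat j * (x $ 2) ^ (j - 1))))" for x :: "real^2"
  have nth: "((\<lambda>x::real^2. x $ k) has_derivative (\<lambda>v. v $ k)) (at x)" for k x
    by (rule bounded_linear.has_derivative[OF bounded_linear_vec_nth has_derivative_ident])
  have "(q has_derivative (\<lambda>v. G x \<bullet> v)) (at x)" for x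
  proof -
    have "(q has_derivative (\<lambda>v. \<Sum>t\<in>I. (case t of (i, j) \<Rightarrow> c i j *\<^sub>R pt (of_nat i * (x $ 1) ^ (i - 1) * (x $ 2) ^ j)
      ((x $ 1) ^ i * (of_nat j * (x $ 2) ^ (j - 1)))) \<bullet> v)) (at x)"
      unfolding c
    proof (intro has_derivative_sum)
      fix t assume "t \<in> I"
      obtain i j where t: "t = (i, j)" by (cases t)
      show "((\<lambda>x. case t of (i, j) \<Rightarrow> c i j * ((x $ 1) ^ i * (x $ 2) ^ j)) has_derivative
        (\<lambda>v. (case t of (i, j) \<Rightarrow> c i j *\<^sub>R pt (of_nat i * (x $ 1) ^ (i - 1) * (x $ 2) ^ j)
          ((x $ 1) ^ i * (of_nat j * (x $ 2) ^ (j - 1)))) \<bullet> v)) (at x)"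
        unfolding t prod.case
        by (rule has_derivative_eq_rhs, (rule derivative_intros nth)+)
          (auto simp: vec2_inner algebra_simps)
    qed
    then show ?thesis by (simp add: G_def inner_sum_left)
  qed
  moreover have "continuous_on UNIV G"
    unfolding G_def by (intro continuous_on_sum) (auto intro!: continuous_intros simp: case_prod_beta)
  ultimately show ?thesis by (rule that)
qed

text \<open>The solution of \<open>transpose A *v y = w\<close> by Cramer's rule; in this form its continuous
  dependence on \<open>A\<close> is visible.\<close>

definition solve_transpose :: "real^2^2 \<Rightarrow> real^2 \<Rightarrow> real^2" where
  "solve_transpose A w = (1 / det A) *\<^sub>R pt (A $ 2 $ 2 * w $ 1 - A $ 2 $ 1 * w $ 2) (A $ 1 $ 1 * w $ 2 - A $ 1 $ 2 * w $ 1)"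

lemma solve_transpose: "det A \<noteq> 0 \<Longrightarrow> transpose A *v solve_transpose A w = w"
proof -
  assume "det A \<noteq> 0"
  moreover have "transpose A *v pt (A $ 2 $ 2 * w $ 1 - A $ 2 $ 1 * w $ 2) (A $ 1 $ 1 * w $ 2 - A $ 1 $ 2 * w $ 1) = det A *\<^sub>R w"
    by (simp add: vec_eq_iff forall_2 matrix_vector_mult_def transpose_def sum_2 det_2 algebra_simps)
  ultimately show ?thesis by (simp add: solve_transpose_def matrix_vector_mult_scaleR)
qed

text \<open>The inverse map has the Jacobian \<open>B\<close>, the inverse matrix of
  \<open>J\<close>, and the gradient is multiplied by the transpose of \<open>B\<close>;
  \<open>solve_transpose J w\<close> is that product.\<close>

lemma compose_inverse_has_derivative:
  fixes F :: "real^2 \<Rightarrow> real^2" and q :: "real^2 \<Rightarrow> real"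
  assumes g: "continuous (at y) g" and K: "open K" "y \<in> K" "\<And>z. z \<in> K \<Longrightarrow> F (g z) = z"
    and F: "(F has_derivative (\<lambda>v. J *v v)) (at (g y))" and J: "0 < m" "\<And>v. m * norm v \<le> norm (J *v v)"
    and q: "(q has_derivative (\<lambda>v. w \<bullet> v)) (at (g y))"
  shows "((\<lambda>z. q (g z)) has_derivative (\<lambda>v. solve_transpose J w \<bullet> v)) (at y)"
proof -
  obtain B where B: "J ** B = mat 1" "B ** J = mat 1" using abs_det2_ge(2)[OF J] by blast
  have det: "det J \<noteq> 0" using abs_det2_ge(1)[OF J] J(1) by (metis abs_zero not_less zero_less_power)
  have "(g has_derivative (\<lambda>v. B *v v)) (at y)"
  proof (rule has_derivative_inverse_basic[OF F _ _ g K(1,2)])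
    show "bounded_linear (\<lambda>v. B *v v)" by simp
    show "(\<lambda>v. B *v v) \<circ> (\<lambda>v. J *v v) = id" by (auto simp: matrix_vector_mul_assoc B)
  qed (rule K(3))
  from has_derivative_compose[OF this q]
  have "((\<lambda>z. q (g z)) has_derivative (\<lambda>v. w \<bullet> (B *v v))) (at y)" .
  moreover have "w \<bullet> (B *v v) = solve_transpose J w \<bullet> v" for v
  proof -
    have "w \<bullet> (B *v v) = (transpose J *v solve_transpose J w) \<bullet> (B *v v)" by (simp add: solve_transpose[OF det])
    also have "\<dots> = solve_transpose J w \<bullet> (J *v (B *v v))" by (metis dot_lmul_matrix transpose_matrix_vector)
    also have "J *v (B *v v) = v" by (simp add: matrix_vector_mul_assoc B)
    finally show ?thesis .
  qed
  ultimately show ?thesis by simp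
qed

definition frame_matrix :: "real^2 \<Rightarrow> real^2 \<Rightarrow> real^2^2" where
  "frame_matrix a b = (\<chi> i j. if j = 1 then a $ i else b $ i)"

lemma frame_matrix_mult: "frame_matrix a b *v v = v $ 1 *\<^sub>R a + v $ 2 *\<^sub>R b"
  by (simp add: frame_matrix_def matrix_vector_mult_def vec_eq_iff forall_2 sum_2)

lemma aff_has_derivative: "(aff V a b has_derivative (\<lambda>v. frame_matrix a b *v v)) (at z)"
proof -
  have nth: "((\<lambda>x::real^2. x $ k) has_derivative (\<lambda>v. v $ k)) (at z)" for k
    by (rule bounded_linear.has_derivative[OF bounded_linear_vec_nth has_derivative_ident])
  show ?thesis
    unfolding aff_def[abs_def] frame_matrix_mult by (auto intro!: derivative_eq_intros nth)
qed

lemma aff_inj: "good_frame a b \<Longrightarrow> inj (aff V a b)"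
proof (rule injI)
  fix z w assume gf: "good_frame a b" and "aff V a b z = aff V a b w"
  then have "(z - w) $ 1 *\<^sub>R a + (z - w) $ 2 *\<^sub>R b = 0" by (simp add: aff_def algebra_simps)
  moreover have "1 / 2 * norm (z - w) \<le> norm ((z - w) $ 1 *\<^sub>R a + (z - w) $ 2 *\<^sub>R b)"
    using gf unfolding good_frame_def by blast
  ultimately have "norm (z - w) \<le> 0" by simp
  then show "z = w" by simp
qed

section \<open>The estimate on one element\<close>

lemma L2_diff:
  assumes u: "u \<in> L2 \<Omega>" and v: "v \<in> L2 \<Omega>"
  shows "u - v \<in> L2 \<Omega>"
proof -
  have m: "u - v \<in> borel_measurable (lebesgue_on \<Omega>)"
    using u v unfolding fun_diff_def by (intro borel_measurable_diff) (auto simp: L2_def)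
  have "integrable (lebesgue_on \<Omega>) (\<lambda>x. 2 * (u x)\<^sup>2 + 2 * (v x)\<^sup>2)" using u v by (simp add: L2_def)
  then have "integrable (lebesgue_on \<Omega>) (\<lambda>x. ((u - v) x)\<^sup>2)"
  proof (rule Bochner_Integration.integrable_bound)
    show "(\<lambda>x. ((u - v) x)\<^sup>2) \<in> borel_measurable (lebesgue_on \<Omega>)" using m by (rule borel_measurable_power)
    have "((u - v) x)\<^sup>2 \<le> 2 * (u x)\<^sup>2 + 2 * (v x)\<^sup>2" for x
      using zero_le_power2[of "u x + v x"] by (simp add: power2_eq_square algebra_simps)
    then show "AE x in lebesgue_on \<Omega>. norm (((u - v) x)\<^sup>2) \<le> norm (2 * (u x)\<^sup>2 + 2 * (v x)\<^sup>2)"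
      by simp
  qed
  with m show ?thesis by (simp add: L2_def)
qed

text \<open>48 is 3 times 16: three parallelograms, and \<open>16 \<gamma>^2\<close> from
  \<open>1 / m^4\<close> with \<open>m = h / (2 sqrt \<gamma>)\<close>. With
  \<open>M = 2 h sqrt \<gamma>\<close> the term \<open>256 \<gamma>^2\<close> is
  \<open>16 M^4 / h^4\<close>. The number 5308416 is \<open>16384 * 4 * 81\<close>, where 4 stems
  from \<open>M^2\<close> and 81 from \<open>(2 p + 1)^4 \<le> (3 p)^4\<close>.\<close>

definition element_const :: "real \<Rightarrow> real" where
  "element_const \<gamma> = 48 * \<gamma>\<^sup>2 * (256 * \<gamma>\<^sup>2 + 5308416 * \<gamma>)"

text \<open>On \<open>K\<close> the discrete function is \<open>q\<close> composed with the inverse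
  element map, so its weak gradient is a classical one.
  \<open>inverse_estimate_parallelogram\<close> applies to each parallelogram mapped by
  \<open>F\<close>; the images cover \<open>K\<close>, and in the sum over at most three of them
  overlaps are merely counted repeatedly.\<close>

lemma element_inverse_estimate:
  fixes F :: "real^2 \<Rightarrow> real^2" and \<gamma> :: real and u v :: "real^2 \<Rightarrow> real"
  assumes \<Omega>: "open \<Omega>" "bounded \<Omega>" and K: "open K" "K \<noteq> {}" "K \<subseteq> \<Omega>"
    and Kh: "Kh \<in> {ref_square, ref_triangle}"
    and F: "bij_betw F (closure Kh) (closure K)" "F ` Kh = K" "C1_on_closure Kh F"
    and \<gamma>: "0 < \<gamma>" and sr: "shape_regular \<gamma> K Kh F" and p: "1 \<le> p"
    and q: "q \<in> ref_poly Kh p" and uq: "AE x in lebesgue_on Kh. (u \<circ> F) x = q x"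
    and u: "u \<in> L2 \<Omega>" "L2_weak_gradient \<Omega> u g" and v: "v \<in> L2 \<Omega>" "L2_weak_gradient \<Omega> v g'"
    and reps: "\<And>i. borel_rep \<Omega> (\<lambda>x. g x $ i) (G i)" "\<And>i. borel_rep \<Omega> (\<lambda>x. g' x $ i) (H i)"
      "borel_rep \<Omega> (u - v) e"
  shows "ennreal ((diameter K)\<^sup>2) * (\<Sum>i\<in>UNIV. \<integral>\<^sup>+x\<in>K. ennreal ((G i x)\<^sup>2) \<partial>lborel)
    \<le> ennreal (element_const \<gamma>) * (ennreal ((diameter K)\<^sup>2) * (\<Sum>i\<in>UNIV. \<integral>\<^sup>+x\<in>K. ennreal ((H i x)\<^sup>2) \<partial>lborel)
      + ennreal ((real p)^4) * (\<integral>\<^sup>+x\<in>K. ennreal ((e x)\<^sup>2) \<partial>lborel))"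
proof -
  let ?U = "box (pt 0 0) (pt 1 1) :: (real^2) set"
  define h where "h = diameter K"
  have Kb: "bounded K" using \<Omega>(2) K(3) bounded_subset by blast
  have h: "0 < h"
  proof -
    obtain x r where "0 < r" "ball x r \<subseteq> K" using K(1,2) by (metis all_not_in_conv open_contains_ball)
    then have "diameter (ball x r) \<le> h" unfolding h_def using Kb by (intro diameter_subset)
    then show ?thesis using \<open>0 < r\<close> by (simp add: diameter_ball)
  qed
  have Kho: "open Kh" using Kh by (auto simp: ref_square_def ref_triangle_def)
  have Khc: "convex Kh" using Kh by (auto simp: ref_square_def ref_triangle_def convex_interior)
  have Khb: "bounded Kh"
  proof -
    have "bounded ref_triangle" unfolding ref_triangle_def
      by (intro bounded_subset[OF _ interior_subset] bounded_convex_hull finite_imp_bounded) simp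
    moreover have "bounded ref_square" unfolding ref_square_def by (rule bounded_box)
    ultimately show ?thesis using Kh by auto
  qed
  obtain J where J: "continuous_on (closure Kh) J"
      "\<And>x. x \<in> closure Kh \<Longrightarrow> (F has_derivative (\<lambda>v. J x *v v)) (at x within closure Kh)"
    using F(3) unfolding C1_on_closure_def by blast
  have Jat: "(F has_derivative (\<lambda>v. J x *v v)) (at x)" if x: "x \<in> Kh" for x
  proof -
    have "(F has_derivative (\<lambda>v. J x *v v)) (at x within Kh)"
      by (rule has_derivative_subset[OF J(2)[OF subsetD[OF closure_subset x]] closure_subset])
    then show ?thesis by (simp only: at_within_open[OF x Kho])
  qed
  have JKh: "continuous_on Kh J" by (rule continuous_on_subset[OF J(1) closure_subset])
  note Jb = shape_regular_bounds[OF sr _ h[unfolded h_def] \<gamma> Jat, folded h_def]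
  have ms: "0 < h / sqrt \<gamma>" using h \<gamma> by simp
  have injF: "inj_on F (closure Kh)" using F(1) by (rule bij_betw_imp_inj_on)
  define gi where "gi = inv_into (closure Kh) F"
  have Fgi: "F (gi y) = y" "gi y \<in> Kh" if y: "y \<in> K" for y
  proof -
    obtain x where x: "x \<in> Kh" "y = F x" using y F(2) by blast
    have "gi y = x" unfolding gi_def
      by (rule inv_into_f_eq[OF injF subsetD[OF closure_subset x(1)] x(2)[symmetric]])
    then show "F (gi y) = y" "gi y \<in> Kh" using x by auto
  qed
  have giF: "gi (F x) = x" if "x \<in> Kh" for x
    unfolding gi_def by (rule inv_into_f_eq[OF injF subsetD[OF closure_subset that] refl])
  have cF: "continuous_on (closure Kh) F"
    unfolding continuous_on_eq_continuous_within by (intro ballI has_derivative_continuous[OF J(2)])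
  have cgi: "continuous_on K gi"
  proof -
    have "compact (closure Kh)" using Khb by (simp add: compact_closure)
    then have "continuous_on (F ` closure Kh) gi"
      unfolding gi_def by (intro continuous_on_inv[OF cF] ballI inv_into_f_f[OF injF])
    then show ?thesis by (rule continuous_on_subset) (use F(2) closure_subset in blast)
  qed
  have cgi_at: "continuous (at y) gi" if "y \<in> K" for y
    using cgi K(1) that by (simp add: continuous_on_eq_continuous_at)
  obtain I where I: "I \<subseteq> {..p} \<times> {..p}" "q \<in> monomial_span I"
  proof -
    have "{(i, j). i + j \<le> p} \<subseteq> {..p} \<times> {..p}" "{(i, j). i \<le> p \<and> j \<le> p} \<subseteq> {..p} \<times> {..p}" by auto
    then show ?thesis using q that by (auto simp: ref_poly_def poly_P_def poly_Q_def split: if_splits)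
  qed
  obtain Gq where Gq: "\<And>x. (q has_derivative (\<lambda>v. Gq x \<bullet> v)) (at x)" "continuous_on UNIV Gq"
    using monomial_span_C1[OF I(2)] by blast
  define f where "f = (\<lambda>y. q (gi y))"
  define Gf where "Gf = (\<lambda>y. solve_transpose (J (gi y)) (Gq (gi y)))"
  have fd: "(f has_derivative (\<lambda>v. Gf y \<bullet> v)) (at y)" if y: "y \<in> K" for y
    unfolding f_def Gf_def
    by (rule compose_inverse_has_derivative[OF cgi_at[OF y] K(1) y Fgi(1) Jat[OF Fgi(2)[OF y]] ms Jb(1)[OF Fgi(2)[OF y] Fgi(2)[OF y]] Gq(1)])
  have cGf: "continuous_on K Gf"
  proof -
    have cJ: "continuous_on K (\<lambda>y. J (gi y))"
      by (rule continuous_on_compose2[OF JKh cgi]) (use Fgi(2) in blast)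
    have cG: "continuous_on K (\<lambda>y. Gq (gi y))"
      by (rule continuous_on_compose2[OF Gq(2) cgi subset_UNIV])
    have "det (J (gi y)) \<noteq> 0" if y: "y \<in> K" for y
    proof -
      have "(h / sqrt \<gamma>)\<^sup>2 \<le> \<bar>det (J (gi y))\<bar>"
        by (rule abs_det2_ge(1)[OF ms Jb(1)[OF Fgi(2)[OF y] Fgi(2)[OF y]]])
      then show ?thesis using zero_less_power[OF ms, of 2] by linarith
    qed
    then show ?thesis unfolding Gf_def solve_transpose_def det_2
      by (intro continuous_intros cJ cG) auto
  qed
  \<comment> \<open>Equality almost everywhere is given on the reference element. The exceptional
    null set is carried to \<open>K\<close> by \<open>F\<close>, whose differentiability keeps it
    null.\<close>
  have uf: "AE x in lebesgue. x \<in> K \<longrightarrow> u x = f x"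
  proof -
    define N where "N = {x \<in> Kh. u (F x) \<noteq> q x}"
    have KhL: "Kh \<in> sets lebesgue" using Kho by simp
    have "AE x in lebesgue. x \<in> Kh \<longrightarrow> u (F x) = q x"
      using uq KhL by (simp add: AE_restrict_space_iff)
    then have "{x. \<not> (x \<in> Kh \<longrightarrow> u (F x) = q x)} \<in> null_sets lebesgue"
      by (simp add: completion.AE_iff_null_sets)
    then have "negligible N" by (simp add: negligible_iff_null_sets N_def conj_commute)
    moreover have "F differentiable_on N"
      unfolding differentiable_on_def N_def
      using Jat by (auto intro!: differentiableI dest: has_derivative_at_withinI)
    ultimately have "negligible (F ` N)" by (intro negligible_differentiable_image_negligible) auto
    then have "AE x in lebesgue. x \<notin> F ` N" by (intro AE_not_in) (simp add: negligible_iff_null_sets)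
    then show ?thesis
    proof eventually_elim
      case (elim y)
      show ?case
      proof
        assume y: "y \<in> K"
        then have "gi y \<notin> N" using elim Fgi(1)[OF y] by (metis image_eqI)
        then show "u y = f y" using Fgi[OF y] by (auto simp: N_def f_def)
      qed
    qed
  qed
  have G_eq: "AE x in lborel. x \<in> K \<longrightarrow> G i x = Gf x $ i" for i
  proof -
    have "AE x in lebesgue. x \<in> K \<longrightarrow> g x $ i = Gf x $ i"
      by (rule weak_gradient_eq_classical[OF \<Omega> u K(1,3) uf fd cGf])
    moreover have "AE x in lebesgue. x \<in> \<Omega> \<longrightarrow> g x $ i = G i x" using reps(1) by (auto simp: borel_rep_def)
    ultimately have "AE x in lebesgue. x \<in> K \<longrightarrow> G i x = Gf x $ i"
      by eventually_elim (use K(3) in auto)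
    then show ?thesis by (simp add: AE_completion_iff)
  qed
  obtain V where V: "borel_rep \<Omega> v V" "integrable lborel V" using L2_borel_rep[OF \<Omega> v(1)] by metis
  have H: "integrable lborel (H i)" "integrable lborel (\<lambda>x. (H i x)\<^sup>2)" for i
  proof -
    have g'2: "(\<lambda>x. g' x $ i) \<in> L2 \<Omega>" using v(2) by (simp add: L2_weak_gradient_def)
    show *: "integrable lborel (\<lambda>x. (H i x)\<^sup>2)"
      using borel_rep_integral(2)[OF \<Omega>(1) borel_rep_square[OF reps(2)]] g'2 by (simp add: L2_def)
    show "integrable lborel (H i)"
      by (rule integrable_of_square_integrable[OF \<Omega>(2) _ _ *]) (use reps(2) in \<open>auto simp: borel_rep_def\<close>)
  qed
  have wk: "(\<integral>x. V x * r x $ i \<partial>lborel) = - (\<integral>x. H i x * \<phi> x \<partial>lborel)"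
    if "test_function K \<phi>" "\<And>x. (\<phi> has_derivative (\<lambda>v. r x \<bullet> v)) (at x)" "continuous_on UNIV r" for \<phi> r i
  proof (rule weak_gradient_borel_rep[OF \<Omega>(1) _ V(1) reps(2) _ that(2,3)])
    show "has_weak_gradient \<Omega> v g'" using v(2) by (simp add: L2_weak_gradient_def)
    show "test_function \<Omega> \<phi>" using that(1) K(3) by (auto simp: test_function_def)
  qed
  have fV: "AE x in lborel. indicator K x * (f x - V x) = indicator K x * e x"
  proof -
    have "AE x in lebesgue. indicator K x * (f x - V x) = indicator K x * e x"
      using uf V(1)[unfolded borel_rep_def, THEN conjunct2, THEN conjunct2]
        reps(3)[unfolded borel_rep_def, THEN conjunct2, THEN conjunct2]
    proof eventually_elim
      case (elim x)
      then show ?case using K(3) by (cases "x \<in> K") auto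
    qed
    then show ?thesis by (simp add: AE_completion_iff)
  qed
  have em: "e \<in> borel_measurable borel" and Vm: "V \<in> borel_measurable borel"
    using reps(3) V(1) by (auto simp: borel_rep_def)
  have Km: "K \<in> sets borel" using K(1) by simp
  have fVm: "(\<lambda>x. indicator K x * (f x - V x)) \<in> borel_measurable lborel"
  proof -
    have "continuous_on K f"
      by (intro continuous_at_imp_continuous_on ballI has_derivative_continuous[OF fd])
    then have "(\<lambda>x. indicator K x *\<^sub>R f x) \<in> borel_measurable borel"
      using Km by (intro borel_measurable_continuous_on_indicator) auto
    then have "(\<lambda>x. indicator K x *\<^sub>R f x - indicator K x * V x) \<in> borel_measurable borel"
      using Vm Km by measurable
    then show ?thesis by (simp add: right_diff_distrib)
  qed
  have e2: "integrable lborel (\<lambda>x. (e x)\<^sup>2)" "integrable lborel e"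
  proof -
    show *: "integrable lborel (\<lambda>x. (e x)\<^sup>2)"
      using borel_rep_integral(2)[OF \<Omega>(1) borel_rep_square[OF reps(3)]] L2_diff[OF u(1) v(1)]
      by (simp add: L2_def)
    show "integrable lborel e"
      by (rule integrable_of_square_integrable[OF \<Omega>(2) em _ *]) (use reps(3) in \<open>auto simp: borel_rep_def\<close>)
  qed
  have Kl: "K \<in> sets lborel" using Km by simp
  have E1: "integrable lborel (\<lambda>x. indicator K x * (f x - V x))"
  proof -
    have i: "integrable lborel (\<lambda>x. indicator K x * e x)"
      using integrable_mult_indicator[OF Kl e2(2)] by simp
    from integrable_cong_AE[OF fVm borel_measurable_integrable[OF i] fV] i show ?thesis by simp
  qed
  have E2: "integrable lborel (\<lambda>x. (indicator K x * (f x - V x))\<^sup>2)"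
  proof -
    have "(\<lambda>x. (indicator K x * e x)\<^sup>2) = (\<lambda>x. indicator K x *\<^sub>R (e x)\<^sup>2)" by (auto simp: indicator_def)
    then have i: "integrable lborel (\<lambda>x. (indicator K x * e x)\<^sup>2)"
      using integrable_mult_indicator[OF Kl e2(1)] by simp
    have ae: "AE x in lborel. (indicator K x * (f x - V x))\<^sup>2 = (indicator K x * e x)\<^sup>2"
      using fV by eventually_elim (simp only:)
    have m: "(\<lambda>x. (indicator K x * (f x - V x))\<^sup>2) \<in> borel_measurable lborel"
      using fVm by (rule borel_measurable_power)
    from integrable_cong_AE[OF m borel_measurable_integrable[OF i] ae] i show ?thesis by simp
  qed
  obtain S where S: "finite S" "card S \<le> 3" "Kh \<subseteq> (\<Union>(V, a, b)\<in>S. aff V a b ` ?U)"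
    "\<And>V a b. (V, a, b) \<in> S \<Longrightarrow> good_frame a b \<and> aff V a b ` ?U \<subseteq> Kh"
    using reference_cover[OF Kh] by (metis (no_types, lifting) case_prodD)
  define \<Gamma> where "\<Gamma> = (\<Sum>i\<in>UNIV. \<integral>\<^sup>+x\<in>K. ennreal ((H i x)\<^sup>2) \<partial>lborel)"
  define \<Delta> where "\<Delta> = (\<integral>\<^sup>+x\<in>K. ennreal ((e x)\<^sup>2) \<partial>lborel)"
  define n where "n = 2 * p + 1"
  \<comment> \<open>The frame of a parallelogram has singular values between \<open>1 / 2\<close>
    and 2; this accounts for the factors 2 against the bounds for the element map alone.\<close>
  define m where "m = h / sqrt \<gamma> / 2"
  define M where "M = 2 * (h * sqrt \<gamma>)"
  have m: "0 < m" using ms by (simp add: m_def)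
  have \<Delta>_eq: "(\<integral>\<^sup>+x\<in>K. ennreal ((f x - V x)\<^sup>2) \<partial>lborel) = \<Delta>"
    unfolding \<Delta>_def
  proof (rule nn_integral_cong_AE)
    show "AE x in lborel. ennreal ((f x - V x)\<^sup>2) * indicator K x = ennreal ((e x)\<^sup>2) * indicator K x"
      using fV by eventually_elim (auto simp: indicator_def)
  qed
  have part: "ennreal (m^4) * (\<integral>\<^sup>+x\<in>(\<lambda>z. F (aff V0 a b z)) ` ?U. ennreal ((norm (Gf x))\<^sup>2) \<partial>lborel)
      \<le> ennreal (16 * M^4) * \<Gamma> + ennreal (16384 * M\<^sup>2 * (real n)^4) * \<Delta>"
    if Vab: "(V0, a, b) \<in> S" for V0 a b
  proof -
    let ?\<Phi> = "\<lambda>z. F (aff V0 a b z)"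
    let ?J = "\<lambda>z. J (aff V0 a b z) ** frame_matrix a b"
    have gf: "good_frame a b" and sub: "\<And>z. z \<in> ?U \<Longrightarrow> aff V0 a b z \<in> Kh" using S(4)[OF Vab] by auto
    have gfb: "1 / 2 * norm v \<le> norm (frame_matrix a b *v v)" "norm (frame_matrix a b *v v) \<le> 2 * norm v" for v
      using gf unfolding good_frame_def frame_matrix_mult by blast+
    show ?thesis
      unfolding \<Gamma>_def \<Delta>_eq[symmetric]
    proof (rule inverse_estimate_parallelogram[where J = ?J and q = "\<lambda>z. q (aff V0 a b z)", OF _ K(1)])
      show "1 \<le> n" by (simp add: n_def)
      show "?\<Phi> ` ?U \<subseteq> K" using sub F(2) by blast
      show "inj_on ?\<Phi> ?U"
      proof (rule inj_onI)
        fix z w assume zw: "z \<in> ?U" "w \<in> ?U" "?\<Phi> z = ?\<Phi> w"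
        then have "aff V0 a b z = aff V0 a b w"
          using inj_onD[OF injF] sub closure_subset by (metis subsetD)
        then show "z = w" using aff_inj[OF gf] by (simp add: inj_eq)
      qed
      show "(?\<Phi> has_derivative (\<lambda>v. ?J z *v v)) (at z)" if "z \<in> ?U" for z
        using has_derivative_compose[OF aff_has_derivative Jat[OF sub[OF that]]]
        by (simp add: matrix_vector_mul_assoc)
      have caff: "continuous_on ?U (aff V0 a b)"
        unfolding aff_def by (intro continuous_intros)
      have "continuous_on ?U (\<lambda>z. J (aff V0 a b z))"
        by (rule continuous_on_compose2[OF JKh caff]) (use sub in blast)
      then show "continuous_on ?U ?J"
        unfolding matrix_matrix_mult_def by (intro continuous_on_vec_lambda continuous_intros)
      show "0 < m" by (rule m)
      show "m * norm v \<le> norm (?J z *v v)" if "z \<in> ?U" for z v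
      proof -
        have "m * norm v = (h / sqrt \<gamma>) * (1 / 2 * norm v)" by (simp add: m_def)
        also have "\<dots> \<le> (h / sqrt \<gamma>) * norm (frame_matrix a b *v v)"
          using ms by (intro mult_left_mono gfb) simp
        also have "\<dots> \<le> norm (J (aff V0 a b z) *v (frame_matrix a b *v v))"
          using Jb(1)[OF sub[OF that] sub[OF that]] .
        finally show ?thesis by (simp add: matrix_vector_mul_assoc)
      qed
      show "norm (?J z *v v) \<le> M * norm v" if "z \<in> ?U" for z v
      proof -
        have "norm (J (aff V0 a b z) *v (frame_matrix a b *v v)) \<le> (h * sqrt \<gamma>) * norm (frame_matrix a b *v v)"
          using Jb(2)[OF sub[OF that] sub[OF that]] .
        also have "\<dots> \<le> (h * sqrt \<gamma>) * (2 * norm v)"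
          using h \<gamma> by (intro mult_left_mono gfb) simp
        finally show ?thesis by (simp add: matrix_vector_mul_assoc M_def mult_ac)
      qed
      show "slicewise_poly n (\<lambda>z. q (aff V0 a b z))"
        unfolding n_def by (rule slicewise_poly_aff[OF I])
      show "q (aff V0 a b z) = f (?\<Phi> z)" if "z \<in> ?U" for z
        using giF[OF sub[OF that]] by (simp add: f_def)
    qed (fact fd cGf V(2) H wk E1 E2)+
  qed
  have GfK: "(\<Sum>i\<in>UNIV. \<integral>\<^sup>+x\<in>K. ennreal ((G i x)\<^sup>2) \<partial>lborel) = (\<integral>\<^sup>+x\<in>K. ennreal ((norm (Gf x))\<^sup>2) \<partial>lborel)"
  proof -
    have meas: "(\<lambda>x. ennreal ((Gf x $ i)\<^sup>2) * indicator K x) \<in> borel_measurable lborel" for i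
    proof -
      have "continuous_on K (\<lambda>x. (Gf x $ i)\<^sup>2)" by (intro continuous_intros cGf)
      from measurable_continuous_times_indicator[OF this Km] show ?thesis by simp
    qed
    have "(\<integral>\<^sup>+x\<in>K. ennreal ((G i x)\<^sup>2) \<partial>lborel) = (\<integral>\<^sup>+x\<in>K. ennreal ((Gf x $ i)\<^sup>2) \<partial>lborel)" for i
    proof (rule nn_integral_cong_AE)
      show "AE x in lborel. ennreal ((G i x)\<^sup>2) * indicator K x = ennreal ((Gf x $ i)\<^sup>2) * indicator K x"
        using G_eq[of i] by eventually_elim (auto simp: indicator_def)
    qed
    then show ?thesis
      using meas by (simp add: sum_2 norm_sq_vec2 ennreal_plus distrib_right nn_integral_add)
  qed
  let ?X = "\<integral>\<^sup>+x\<in>K. ennreal ((norm (Gf x))\<^sup>2) \<partial>lborel"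
  let ?R = "ennreal (16 * M^4) * \<Gamma> + ennreal (16384 * M\<^sup>2 * (real n)^4) * \<Delta>"
  define P where "P = (\<lambda>(V0, a, b). (\<lambda>z. F (aff V0 a b z)) ` ?U)"
  have KP: "K \<subseteq> (\<Union>t\<in>S. P t)"
  proof
    fix y assume "y \<in> K"
    then obtain x where x: "x \<in> Kh" "y = F x" using F(2) by blast
    then obtain V0 a b where "(V0, a, b) \<in> S" "x \<in> aff V0 a b ` ?U" using S(3) by blast
    then show "y \<in> (\<Union>t\<in>S. P t)" using x(2) by (force simp: P_def)
  qed
  have Po: "open (P t)" "P t \<subseteq> K" if t: "t \<in> S" for t
  proof -
    obtain V0 a b where Vab: "t = (V0, a, b)" by (cases t)
    have gf: "good_frame a b" and sub: "\<And>z. z \<in> ?U \<Longrightarrow> aff V0 a b z \<in> Kh"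
      using S(4)[of V0 a b] t Vab by auto
    have caff: "continuous_on ?U (aff V0 a b)" unfolding aff_def by (intro continuous_intros)
    have "continuous_on ?U (\<lambda>z. F (aff V0 a b z))"
      by (rule continuous_on_compose2[OF cF caff]) (use sub closure_subset in blast)
    moreover have "inj_on (\<lambda>z. F (aff V0 a b z)) ?U"
    proof (rule inj_onI)
      fix z w assume zw: "z \<in> ?U" "w \<in> ?U" "F (aff V0 a b z) = F (aff V0 a b w)"
      then have "aff V0 a b z = aff V0 a b w"
        using inj_onD[OF injF] sub closure_subset by (metis subsetD)
      then show "z = w" using aff_inj[OF gf] by (simp add: inj_eq)
    qed
    \<comment> \<open>Invariance of domain makes the pieces open, hence Borel.\<close>
    ultimately have "open ((\<lambda>z. F (aff V0 a b z)) ` ?U)" by (intro invariance_of_domain open_box)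
    then show "open (P t)" by (simp add: P_def Vab)
    show "P t \<subseteq> K" using sub F(2) by (auto simp: P_def Vab)
  qed
  have meas: "(\<lambda>x. ennreal ((norm (Gf x))\<^sup>2) * indicator (P t) x) \<in> borel_measurable lborel" if t: "t \<in> S" for t
  proof -
    have "continuous_on (P t) (\<lambda>x. (norm (Gf x))\<^sup>2)"
      by (intro continuous_intros continuous_on_subset[OF cGf Po(2)[OF t]])
    from measurable_continuous_times_indicator[OF this] Po(1)[OF t] show ?thesis by simp
  qed
  have "ennreal (m^4) * ?X \<le> ennreal (m^4) * (\<integral>\<^sup>+x. (\<Sum>t\<in>S. ennreal ((norm (Gf x))\<^sup>2) * indicator (P t) x) \<partial>lborel)"
  proof (intro mult_left_mono nn_integral_mono)
    fix x
    show "ennreal ((norm (Gf x))\<^sup>2) * indicator K x \<le> (\<Sum>t\<in>S. ennreal ((norm (Gf x))\<^sup>2) * indicator (P t) x)"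
    proof (cases "x \<in> K")
      case True
      then obtain t where t: "t \<in> S" "x \<in> P t" using KP by blast
      have "ennreal ((norm (Gf x))\<^sup>2) * indicator (P t) x \<le> (\<Sum>t\<in>S. ennreal ((norm (Gf x))\<^sup>2) * indicator (P t) x)"
        by (rule member_le_sum[OF t(1) _ S(1)]) simp
      then show ?thesis using t True by simp
    qed simp
  qed simp
  also have "\<dots> = (\<Sum>t\<in>S. ennreal (m^4) * (\<integral>\<^sup>+x\<in>P t. ennreal ((norm (Gf x))\<^sup>2) \<partial>lborel))"
    using meas by (simp add: nn_integral_sum sum_distrib_left)
  also have "\<dots> \<le> (\<Sum>t\<in>S. ?R)"
  proof (rule sum_mono)
    fix t assume t: "t \<in> S"
    obtain V0 a b where Vab: "t = (V0, a, b)" by (cases t)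
    show "ennreal (m^4) * (\<integral>\<^sup>+x\<in>P t. ennreal ((norm (Gf x))\<^sup>2) \<partial>lborel) \<le> ?R"
      using part[of V0 a b] t by (simp add: P_def Vab)
  qed
  also have "\<dots> = of_nat (card S) * ?R" by simp
  also have "\<dots> \<le> ennreal 3 * ?R"
  proof (rule mult_right_mono)
    have "real (card S) \<le> 3" using S(2) by simp
    then show "of_nat (card S) \<le> ennreal 3" by (metis ennreal_leI ennreal_of_nat_eq_real_of_nat)
  qed simp
  finally have tot: "ennreal (m^4) * ?X \<le> ennreal 3 * ?R" .
  \<comment> \<open>Chosen such that \<open>\<kappa> m^4 = h^2\<close>, which restores the scaling
    of the claim.\<close>
  define \<kappa> where "\<kappa> = 16 * \<gamma>\<^sup>2 / h\<^sup>2"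
  have \<kappa>: "0 \<le> \<kappa>" by (simp add: \<kappa>_def)
  have sg: "(sqrt \<gamma>)^4 = \<gamma>\<^sup>2" "(sqrt \<gamma>)\<^sup>2 = \<gamma>"
    using \<gamma> power_mult[of "sqrt \<gamma>" 2 2] by simp_all
  have k1: "\<kappa> * m^4 = h\<^sup>2"
  proof -
    have "m^4 = h^4 / (\<gamma>\<^sup>2 * 16)" unfolding m_def power_divide sg by simp
    then show ?thesis using h \<gamma> by (simp add: \<kappa>_def power4_eq_xxxx power2_eq_square)
  qed
  have k2: "\<kappa> * (3 * (16 * M^4)) \<le> element_const \<gamma> * h\<^sup>2"
  proof -
    have "M^4 = 16 * (h^4 * \<gamma>\<^sup>2)" unfolding M_def power_mult_distrib sg by simp
    then have "\<kappa> * (3 * (16 * M^4)) = 48 * \<gamma>\<^sup>2 * (256 * \<gamma>\<^sup>2) * h\<^sup>2"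
      using h by (simp add: \<kappa>_def power4_eq_xxxx power2_eq_square)
    also have "\<dots> \<le> element_const \<gamma> * h\<^sup>2"
      unfolding element_const_def using \<gamma> by (intro mult_right_mono mult_left_mono) auto
    finally show ?thesis .
  qed
  have k3: "\<kappa> * (3 * (16384 * M\<^sup>2 * (real n)^4)) \<le> element_const \<gamma> * (real p)^4"
  proof -
    have "real n \<le> 3 * real p" using p by (simp add: n_def)
    then have "(real n)^4 \<le> (3 * real p)^4" by (intro power_mono) auto
    then have n4: "(real n)^4 \<le> 81 * (real p)^4" by (simp add: power_mult_distrib)
    have "M\<^sup>2 = 4 * (h\<^sup>2 * \<gamma>)" unfolding M_def power_mult_distrib sg by simp
    then have "\<kappa> * (3 * (16384 * M\<^sup>2 * (real n)^4)) = 48 * \<gamma>\<^sup>2 * (65536 * \<gamma>) * (real n)^4"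
      using h by (simp add: \<kappa>_def power2_eq_square)
    also have "\<dots> \<le> 48 * \<gamma>\<^sup>2 * (65536 * \<gamma>) * (81 * (real p)^4)"
      using \<gamma> by (intro mult_left_mono n4) auto
    also have "\<dots> = 48 * \<gamma>\<^sup>2 * (5308416 * \<gamma>) * (real p)^4" by simp
    also have "\<dots> \<le> element_const \<gamma> * (real p)^4"
      unfolding element_const_def using \<gamma> by (intro mult_right_mono mult_left_mono) auto
    finally show ?thesis .
  qed
  have ec: "0 \<le> element_const \<gamma>" using \<gamma> by (simp add: element_const_def)
  have "ennreal (h\<^sup>2) * ?X = ennreal \<kappa> * (ennreal (m^4) * ?X)"
    using \<kappa> by (simp add: k1[symmetric] ennreal_mult mult.assoc)
  also have "\<dots> \<le> ennreal \<kappa> * (ennreal 3 * ?R)" by (intro mult_left_mono tot) simp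
  also have "\<dots> = ennreal (\<kappa> * (3 * (16 * M^4))) * \<Gamma> + ennreal (\<kappa> * (3 * (16384 * M\<^sup>2 * (real n)^4))) * \<Delta>"
  proof -
    have "ennreal (\<kappa> * (3 * x)) = ennreal \<kappa> * (ennreal 3 * ennreal x)" for x
      by (simp only: ennreal_mult'[OF \<kappa>] ennreal_mult'[OF zero_le_numeral])
    then show ?thesis by (simp only: distrib_left mult.assoc)
  qed
  also have "\<dots> \<le> ennreal (element_const \<gamma> * h\<^sup>2) * \<Gamma> + ennreal (element_const \<gamma> * (real p)^4) * \<Delta>"
    by (intro add_mono mult_right_mono ennreal_leI k2 k3) simp_all
  also have "\<dots> = ennreal (element_const \<gamma>) * (ennreal (h\<^sup>2) * \<Gamma> + ennreal ((real p)^4) * \<Delta>)"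
    using ec by (simp add: ennreal_mult distrib_left mult.assoc)
  finally show ?thesis unfolding GfK h_def \<Gamma>_def \<Delta>_def .
qed

section \<open>The estimate on the mesh\<close>

lemma sum_nn_integral_disjoint_le:
  fixes f :: "'a::euclidean_space \<Rightarrow> real"
  assumes T: "finite T" "pairwise disjnt T" "\<And>K. K \<in> T \<Longrightarrow> K \<in> sets borel" and f: "f \<in> borel_measurable borel"
  shows "(\<Sum>K\<in>T. \<integral>\<^sup>+x\<in>K. ennreal (f x) \<partial>lborel) \<le> (\<integral>\<^sup>+x. ennreal (f x) \<partial>lborel)"
proof -
  have "(\<Sum>K\<in>T. \<integral>\<^sup>+x\<in>K. ennreal (f x) \<partial>lborel) = (\<integral>\<^sup>+x. (\<Sum>K\<in>T. ennreal (f x) * indicator K x) \<partial>lborel)"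
  proof (intro nn_integral_sum[symmetric])
    fix K assume "K \<in> T"
    then have [measurable]: "K \<in> sets borel" by (rule T(3))
    show "(\<lambda>x. ennreal (f x) * indicator K x) \<in> borel_measurable lborel" using f by measurable
  qed
  also have "\<dots> \<le> (\<integral>\<^sup>+x. ennreal (f x) \<partial>lborel)"
  proof (intro nn_integral_mono)
    fix x
    have "disjoint_family_on (\<lambda>K. K) T"
      using T(2) by (auto simp: disjoint_family_on_def pairwise_def disjnt_def)
    then have "(\<Sum>K\<in>T. indicator K x :: ennreal) = indicator (\<Union>K\<in>T. K) x"
      using T(1) by (intro indicator_UN_disjoint[symmetric])
    then show "(\<Sum>K\<in>T. ennreal (f x) * indicator K x) \<le> ennreal (f x)"
      unfolding sum_distrib_left[symmetric] by (simp add: indicator_def)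
  qed
  finally show ?thesis .
qed

text \<open>Only the closures of the elements cover. The difference \<open>closure K - K\<close>
  lies in the image of the frontier of a convex reference element, which is null, and the element
  map, differentiable up to the boundary, preserves null sets.\<close>

lemma mesh_skeleton_negligible:
  assumes mesh: "admissible_mesh \<Omega> \<gamma> \<T> Kh F"
  shows "negligible (\<Omega> - \<Union>\<T>)"
proof -
  have part: "partition_of \<Omega> \<T>" using mesh by (simp add: admissible_mesh_def)
  have el: "Kh K \<in> {ref_square, ref_triangle}" "bij_betw (F K) (closure (Kh K)) (closure K)" "F K ` Kh K = K"
    "C1_on_closure (Kh K) (F K)" if "K \<in> \<T>" for K
    using mesh that by (auto simp: admissible_mesh_def)
  have "negligible (closure K - K)" if K: "K \<in> \<T>" for K
  proof -
    have Kho: "open (Kh K)" and Khc: "convex (Kh K)"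
      using el(1)[OF K] by (auto simp: ref_square_def ref_triangle_def convex_interior)
    obtain J where J: "\<And>x. x \<in> closure (Kh K) \<Longrightarrow> (F K has_derivative (\<lambda>v. J x *v v)) (at x within closure (Kh K))"
      using el(4)[OF K] unfolding C1_on_closure_def by blast
    have fr: "frontier (Kh K) = closure (Kh K) - Kh K" using Kho by (simp add: frontier_def interior_open)
    have "F K differentiable_on frontier (Kh K)"
      unfolding differentiable_on_def
    proof
      fix x assume x: "x \<in> frontier (Kh K)"
      have "(F K has_derivative (\<lambda>v. J x *v v)) (at x within frontier (Kh K))"
        by (rule has_derivative_subset[OF J]) (use x fr in auto)
      then show "F K differentiable at x within frontier (Kh K)" by (rule differentiableI)
    qed
    then have "negligible (F K ` frontier (Kh K))"
      by (intro negligible_differentiable_image_negligible negligible_convex_frontier Khc) auto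
    moreover have "closure K - K \<subseteq> F K ` frontier (Kh K)"
    proof
      fix y assume y: "y \<in> closure K - K"
      then obtain x where "x \<in> closure (Kh K)" "y = F K x" using el(2)[OF K] by (auto simp: bij_betw_def)
      then show "y \<in> F K ` frontier (Kh K)" using y el(3)[OF K] fr by blast
    qed
    ultimately show ?thesis by (rule negligible_subset)
  qed
  then have "negligible (\<Union>K\<in>\<T>. closure K - K)"
    using part by (intro negligible_Union) (auto simp: partition_of_def)
  moreover have "\<Omega> - \<Union>\<T> \<subseteq> (\<Union>K\<in>\<T>. closure K - K)"
  proof
    fix x assume x: "x \<in> \<Omega> - \<Union>\<T>"
    then have "x \<in> closure \<Omega>" using closure_subset by blast
    then have "x \<in> (\<Union>K\<in>\<T>. closure K)" using part by (simp add: partition_of_def)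
    then show "x \<in> (\<Union>K\<in>\<T>. closure K - K)" using x by blast
  qed
  ultimately show ?thesis by (rule negligible_subset)
qed

section \<open>The L^2 and H^1 norms\<close>

lemma H1_weak_gradient:
  "u \<in> H1 \<Omega> \<Longrightarrow> L2_weak_gradient \<Omega> u (weak_gradient \<Omega> u)"
proof -
  assume "u \<in> H1 \<Omega>"
  then obtain g where "L2_weak_gradient \<Omega> u g" by (auto simp: H1_def)
  then show ?thesis unfolding weak_gradient_def by (rule someI[where P = "L2_weak_gradient \<Omega> u"])
qed

lemma H1_norm_sq:
  "(H1_norm \<Omega> u)\<^sup>2 = (L2_norm \<Omega> u)\<^sup>2 + (\<Sum>i\<in>UNIV. (L2_norm \<Omega> (\<lambda>x. weak_gradient \<Omega> u x $ i))\<^sup>2)"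
  unfolding H1_norm_def by (rule real_sqrt_pow2) (intro add_nonneg_nonneg sum_nonneg zero_le_power2)

lemma L2_norm_nonneg: "0 \<le> L2_norm \<Omega> u"
  by (simp add: L2_norm_def)

lemma L2_norm_eq_0: "(AE x in lebesgue. x \<in> \<Omega> \<longrightarrow> u x = 0) \<Longrightarrow> open \<Omega> \<Longrightarrow> L2_norm \<Omega> u = 0"
proof -
  assume ae: "AE x in lebesgue. x \<in> \<Omega> \<longrightarrow> u x = 0" and \<Omega>: "open \<Omega>"
  have "borel_rep \<Omega> u (\<lambda>x. 0)" using ae by (simp add: borel_rep_def)
  from borel_rep_integral(1)[OF \<Omega> borel_rep_square[OF this]] show ?thesis by (simp add: L2_norm_def)
qed

text \<open>Zero is the competitor that bounds the K-functional by the L^2 norm. Its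
  \<open>weak_gradient\<close> is an arbitrary choice, so that the H^1 norm is 0 requires uniqueness
  of weak gradients.\<close>

lemma zero_in_H1:
  assumes \<Omega>: "open \<Omega>" "bounded \<Omega>"
  shows "(\<lambda>x. 0) \<in> H1 \<Omega>" "H1_norm \<Omega> (\<lambda>x. 0) = 0"
proof -
  have L: "(\<lambda>x. 0) \<in> L2 \<Omega>" by (simp add: L2_def)
  then have g: "L2_weak_gradient \<Omega> (\<lambda>x. 0) (\<lambda>x. 0)" by (simp add: L2_weak_gradient_def has_weak_gradient_def)
  then show H: "(\<lambda>x. 0) \<in> H1 \<Omega>" using L by (auto simp: H1_def)
  have "L2_norm \<Omega> (\<lambda>x. weak_gradient \<Omega> (\<lambda>x. 0) x $ i) = 0" for i
    using weak_gradient_unique[OF \<Omega> L H1_weak_gradient[OF H] g, of i] \<Omega>(1) by (intro L2_norm_eq_0) auto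
  moreover have "L2_norm \<Omega> (\<lambda>x. 0) = 0" by (simp add: L2_norm_def)
  ultimately show "H1_norm \<Omega> (\<lambda>x. 0) = 0" by (simp add: H1_norm_def)
qed

lemma L2_norm_sq_triangle:
  assumes u: "u \<in> L2 \<Omega>" and v: "v \<in> L2 \<Omega>"
  shows "(L2_norm \<Omega> u)\<^sup>2 \<le> 2 * (L2_norm \<Omega> (u - v))\<^sup>2 + 2 * (L2_norm \<Omega> v)\<^sup>2"
proof -
  have N: "(L2_norm \<Omega> w)\<^sup>2 = (\<integral>x. (w x)\<^sup>2 \<partial>lebesgue_on \<Omega>)" for w
    by (simp add: L2_norm_def)
  have i: "integrable (lebesgue_on \<Omega>) (\<lambda>x. (u x)\<^sup>2)" "integrable (lebesgue_on \<Omega>) (\<lambda>x. (v x)\<^sup>2)"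
    "integrable (lebesgue_on \<Omega>) (\<lambda>x. ((u - v) x)\<^sup>2)"
    using u v L2_diff[OF u v] by (auto simp: L2_def)
  have "(\<integral>x. (u x)\<^sup>2 \<partial>lebesgue_on \<Omega>) \<le> (\<integral>x. 2 * ((u - v) x)\<^sup>2 + 2 * (v x)\<^sup>2 \<partial>lebesgue_on \<Omega>)"
  proof (rule integral_mono)
    fix x
    show "(u x)\<^sup>2 \<le> 2 * ((u - v) x)\<^sup>2 + 2 * (v x)\<^sup>2"
      using zero_le_power2[of "u x - 2 * v x"] by (simp add: power2_eq_square algebra_simps)
  qed (use i in auto)
  also have "\<dots> = 2 * (\<integral>x. ((u - v) x)\<^sup>2 \<partial>lebesgue_on \<Omega>) + 2 * (\<integral>x. (v x)\<^sup>2 \<partial>lebesgue_on \<Omega>)"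
    using i by simp
  finally show ?thesis by (simp only: N)
qed

text \<open>The element estimates are summed, with \<open>h \<le> Cqu * diameter K\<close> on the
  left and \<open>diameter K \<le> h\<close> on the right; this yields the gradient part of the
  constant. For the function values, \<open>u = (u - v) + v\<close> and
  \<open>t \<le> diameter \<Omega>\<close> produce the other two summands.\<close>

lemma mesh_inverse_estimate:
  assumes \<Omega>: "open \<Omega>" "bounded \<Omega>" "\<Omega> \<noteq> {}" and \<gamma>: "0 < \<gamma>" and Cqu: "0 < Cqu"
    and mesh: "admissible_mesh \<Omega> \<gamma> \<T> Kh F" and qu: "quasi_uniform Cqu \<T>" and p: "1 \<le> p" "\<And>K. K \<in> \<T> \<Longrightarrow> pdeg K = p"
    and u: "u \<in> spline1 \<Omega> \<T> Kh F pdeg" and v: "v \<in> H1 \<Omega>"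
  defines "t \<equiv> mesh_width \<T> / (real p)\<^sup>2"
  shows "0 < t" and "t\<^sup>2 * (H1_norm \<Omega> u)\<^sup>2
    \<le> (Cqu\<^sup>2 * element_const \<gamma> + 2 * (diameter \<Omega>)\<^sup>2 + 2) * ((L2_norm \<Omega> (u - v))\<^sup>2 + t\<^sup>2 * (H1_norm \<Omega> v)\<^sup>2)"
proof -
  define h where "h = mesh_width \<T>"
  have part: "finite \<T>" "pairwise disjnt \<T>" "(\<Union>K\<in>\<T>. closure K) = closure \<Omega>"
    "\<And>K. K \<in> \<T> \<Longrightarrow> open K \<and> K \<noteq> {} \<and> K \<subseteq> \<Omega>"
    using mesh by (auto simp: admissible_mesh_def partition_of_def)
  have el: "Kh K \<in> {ref_square, ref_triangle}" "bij_betw (F K) (closure (Kh K)) (closure K)" "F K ` Kh K = K"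
    "C1_on_closure (Kh K) (F K)" "shape_regular \<gamma> K (Kh K) (F K)" if "K \<in> \<T>" for K
    using mesh that by (auto simp: admissible_mesh_def)
  have T_ne: "\<T> \<noteq> {}" using part(3) \<Omega>(3) by (metis UN_empty closure_eq_empty)
  have hK: "diameter K \<le> h" "h \<le> Cqu * diameter K" if K: "K \<in> \<T>" for K
  proof -
    show "diameter K \<le> h" unfolding h_def mesh_width_def using part(1) K by (intro Max_ge) auto
    have "Min (diameter ` \<T>) \<le> diameter K" using part(1) K by (intro Min_le) auto
    then have "Cqu * Min (diameter ` \<T>) \<le> Cqu * diameter K" using Cqu by (intro mult_left_mono) auto
    then show "h \<le> Cqu * diameter K" using qu by (simp add: quasi_uniform_def h_def mesh_width_def)
  qed
  have h0: "0 < h" and hd: "h \<le> diameter \<Omega>"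
  proof -
    have "h \<in> diameter ` \<T>" unfolding h_def mesh_width_def using part(1) T_ne by (intro Max_in) auto
    then obtain K where K: "K \<in> \<T>" "h = diameter K" by blast
    then show "h \<le> diameter \<Omega>" using part(4)[OF K(1)] \<Omega>(2) by (auto intro: diameter_subset)
    obtain x r where r: "0 < r" "ball x r \<subseteq> K"
      using part(4)[OF K(1)] by (metis all_not_in_conv open_contains_ball)
    have "bounded K" using part(4)[OF K(1)] \<Omega>(2) bounded_subset by blast
    then have "diameter (ball x r) \<le> h" unfolding K(2) by (rule diameter_subset[OF r(2)])
    then show "0 < h" using r(1) by (simp add: diameter_ball)
  qed
  have p2: "1 \<le> (real p)\<^sup>2" using p(1) by simp
  show t0: "0 < t" using h0 p(1) by (simp add: t_def h_def)
  have "t \<le> h / 1" unfolding t_def h_def[symmetric] using h0 p2 p(1) by (intro divide_left_mono) auto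
  then have td: "t\<^sup>2 \<le> (diameter \<Omega>)\<^sup>2" using t0 hd by (intro power_mono) auto
  have uL: "u \<in> L2 \<Omega>" and uH: "u \<in> H1 \<Omega>" using u by (auto simp: spline1_def spline0_def)
  have vL: "v \<in> L2 \<Omega>" using v by (simp add: H1_def)
  define g where "g = weak_gradient \<Omega> u"
  define g' where "g' = weak_gradient \<Omega> v"
  have g: "L2_weak_gradient \<Omega> u g" and g': "L2_weak_gradient \<Omega> v g'"
    using H1_weak_gradient uH v by (auto simp: g_def g'_def)
  have gL: "(\<lambda>x. g x $ i) \<in> L2 \<Omega>" "(\<lambda>x. g' x $ i) \<in> L2 \<Omega>" for i
    using g g' by (auto simp: L2_weak_gradient_def)
  have "\<forall>i. \<exists>w. borel_rep \<Omega> (\<lambda>x. g x $ i) w \<and> integrable lborel (\<lambda>x. (w x)\<^sup>2)"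
    using L2_borel_rep[OF \<Omega>(1,2) gL(1)] by metis
  then obtain G where G: "\<And>i. borel_rep \<Omega> (\<lambda>x. g x $ i) (G i)" "\<And>i. integrable lborel (\<lambda>x. (G i x)\<^sup>2)" by metis
  have "\<forall>i. \<exists>w. borel_rep \<Omega> (\<lambda>x. g' x $ i) w \<and> integrable lborel (\<lambda>x. (w x)\<^sup>2)"
    using L2_borel_rep[OF \<Omega>(1,2) gL(2)] by metis
  then obtain H where H: "\<And>i. borel_rep \<Omega> (\<lambda>x. g' x $ i) (H i)" "\<And>i. integrable lborel (\<lambda>x. (H i x)\<^sup>2)" by metis
  obtain e where e: "borel_rep \<Omega> (u - v) e" "integrable lborel (\<lambda>x. (e x)\<^sup>2)"
    using L2_borel_rep[OF \<Omega>(1,2) L2_diff[OF uL vL]] by metis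
  define gu where "gu = (\<Sum>i\<in>UNIV. (L2_norm \<Omega> (\<lambda>x. g x $ i))\<^sup>2)"
  define gv where "gv = (\<Sum>i\<in>UNIV. (L2_norm \<Omega> (\<lambda>x. g' x $ i))\<^sup>2)"
  define E where "E = (L2_norm \<Omega> (u - v))\<^sup>2"
  have nn: "0 \<le> gu" "0 \<le> gv" "0 \<le> E" by (auto simp: gu_def gv_def E_def intro: sum_nonneg)
  define X where "X K = (\<Sum>i\<in>UNIV. \<integral>\<^sup>+x\<in>K. ennreal ((G i x)\<^sup>2) \<partial>lborel)" for K
  define Y where "Y K = (\<Sum>i\<in>UNIV. \<integral>\<^sup>+x\<in>K. ennreal ((H i x)\<^sup>2) \<partial>lborel)" for K
  define D where "D K = (\<integral>\<^sup>+x\<in>K. ennreal ((e x)\<^sup>2) \<partial>lborel)" for K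
  have bm: "G i \<in> borel_measurable borel" "H i \<in> borel_measurable borel" "e \<in> borel_measurable borel" for i
    using G(1)[of i] H(1)[of i] e(1) by (auto simp: borel_rep_def)
  have Kb: "K \<in> sets borel" if "K \<in> \<T>" for K using part(4)[OF that] by simp
  \<comment> \<open>Here the elements have to cover \<open>\<Omega>\<close> up to a null set; off
    \<open>\<Omega>\<close> the representative \<open>G i\<close> is zero.\<close>
  have gu_le: "ennreal gu \<le> (\<Sum>K\<in>\<T>. X K)"
  proof -
    have "(\<integral>\<^sup>+x. ennreal ((G i x)\<^sup>2) \<partial>lborel) \<le> (\<Sum>K\<in>\<T>. \<integral>\<^sup>+x\<in>K. ennreal ((G i x)\<^sup>2) \<partial>lborel)" for i
    proof -
      have "AE x in lebesgue. x \<notin> \<Omega> - \<Union>\<T>"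
        using mesh_skeleton_negligible[OF mesh] by (intro AE_not_in) (simp add: negligible_iff_null_sets)
      then have "AE x in lborel. x \<notin> \<Omega> - \<Union>\<T>" by (simp add: AE_completion_iff)
      then have "AE x in lborel. ennreal ((G i x)\<^sup>2) \<le> (\<Sum>K\<in>\<T>. ennreal ((G i x)\<^sup>2) * indicator K x)"
      proof eventually_elim
        case (elim x)
        show ?case
        proof (cases "x \<in> \<Omega>")
          case True
          then obtain K where K: "K \<in> \<T>" "x \<in> K" using elim by blast
          have "ennreal ((G i x)\<^sup>2) * indicator K x \<le> (\<Sum>K\<in>\<T>. ennreal ((G i x)\<^sup>2) * indicator K x)"
            by (rule member_le_sum[OF K(1) _ part(1)]) simp
          then show ?thesis using K(2) by simp
        next
          case False
          then have "G i x = 0" using G(1)[of i] by (simp add: borel_rep_def)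
          then show ?thesis by simp
        qed
      qed
      then have "(\<integral>\<^sup>+x. ennreal ((G i x)\<^sup>2) \<partial>lborel) \<le> (\<integral>\<^sup>+x. (\<Sum>K\<in>\<T>. ennreal ((G i x)\<^sup>2) * indicator K x) \<partial>lborel)"
        by (rule nn_integral_mono_AE)
      also have "\<dots> = (\<Sum>K\<in>\<T>. \<integral>\<^sup>+x\<in>K. ennreal ((G i x)\<^sup>2) \<partial>lborel)"
      proof (intro nn_integral_sum)
        fix K assume "K \<in> \<T>"
        then have [measurable]: "K \<in> sets borel" by (rule Kb)
        show "(\<lambda>x. ennreal ((G i x)\<^sup>2) * indicator K x) \<in> borel_measurable lborel" using bm(1)[of i] by measurable
      qed
      finally show ?thesis .
    qed
    then have "(\<Sum>i\<in>UNIV. \<integral>\<^sup>+x. ennreal ((G i x)\<^sup>2) \<partial>lborel)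
        \<le> (\<Sum>i\<in>UNIV. \<Sum>K\<in>\<T>. \<integral>\<^sup>+x\<in>K. ennreal ((G i x)\<^sup>2) \<partial>lborel)" by (intro sum_mono)
    moreover have "(\<Sum>i\<in>UNIV. \<integral>\<^sup>+x. ennreal ((G i x)\<^sup>2) \<partial>lborel) = ennreal gu"
      unfolding gu_def L2_norm_sq_borel_rep[OF \<Omega>(1) G, symmetric] by (simp add: sum_ennreal)
    ultimately show ?thesis unfolding X_def by (subst sum.swap) simp
  qed
  \<comment> \<open>In this direction disjointness of the elements suffices.\<close>
  have Y_le: "(\<Sum>K\<in>\<T>. Y K) \<le> ennreal gv"
  proof -
    have "(\<Sum>K\<in>\<T>. Y K) = (\<Sum>i\<in>UNIV. \<Sum>K\<in>\<T>. \<integral>\<^sup>+x\<in>K. ennreal ((H i x)\<^sup>2) \<partial>lborel)"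
      unfolding Y_def by (rule sum.swap)
    also have "\<dots> \<le> (\<Sum>i\<in>UNIV. \<integral>\<^sup>+x. ennreal ((H i x)\<^sup>2) \<partial>lborel)"
    proof (intro sum_mono sum_nn_integral_disjoint_le part(1,2) Kb)
      show "(\<lambda>x. (H i x)\<^sup>2) \<in> borel_measurable borel" for i using bm(2) by (rule borel_measurable_power)
    qed
    also have "\<dots> = ennreal gv"
      unfolding gv_def L2_norm_sq_borel_rep[OF \<Omega>(1) H, symmetric] by (simp add: sum_ennreal)
    finally show ?thesis .
  qed
  have D_le: "(\<Sum>K\<in>\<T>. D K) \<le> ennreal E"
  proof -
    have "(\<Sum>K\<in>\<T>. D K) \<le> (\<integral>\<^sup>+x. ennreal ((e x)\<^sup>2) \<partial>lborel)"
      unfolding D_def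
      by (intro sum_nn_integral_disjoint_le part(1,2) Kb borel_measurable_power bm(3))
    then show ?thesis unfolding E_def L2_norm_sq_borel_rep[OF \<Omega>(1) e] .
  qed
  define c where "c = Cqu\<^sup>2 * element_const \<gamma>"
  have ec: "0 \<le> element_const \<gamma>" using \<gamma> by (simp add: element_const_def)
  have c0: "0 \<le> c" using ec by (simp add: c_def)
  have elem: "ennreal (h\<^sup>2) * X K \<le> ennreal c * (ennreal (h\<^sup>2) * Y K + ennreal ((real p)^4) * D K)" if K: "K \<in> \<T>" for K
  proof -
    obtain q where q: "q \<in> ref_poly (Kh K) p" "AE x in lebesgue_on (Kh K). (u \<circ> F K) x = q x"
      using u K p(2)[OF K] by (auto simp: spline1_def spline0_def)
    have est: "ennreal ((diameter K)\<^sup>2) * X K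
        \<le> ennreal (element_const \<gamma>) * (ennreal ((diameter K)\<^sup>2) * Y K + ennreal ((real p)^4) * D K)"
      unfolding X_def Y_def D_def
      by (rule element_inverse_estimate[OF \<Omega>(1,2) _ _ _ el(1)[OF K] el(2)[OF K] el(3)[OF K] el(4)[OF K] \<gamma> el(5)[OF K]
            p(1) q uL g vL g' G(1) H(1) e(1)]) (use part(4)[OF K] in auto)
    have "h\<^sup>2 \<le> (Cqu * diameter K)\<^sup>2" using h0 hK(2)[OF K] by (intro power_mono) auto
    then have "ennreal (h\<^sup>2) \<le> ennreal (Cqu\<^sup>2) * ennreal ((diameter K)\<^sup>2)"
      by (simp add: power_mult_distrib ennreal_mult[symmetric] ennreal_leI)
    then have "ennreal (h\<^sup>2) * X K \<le> (ennreal (Cqu\<^sup>2) * ennreal ((diameter K)\<^sup>2)) * X K" by (intro mult_right_mono) auto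
    also have "\<dots> \<le> ennreal (Cqu\<^sup>2) * (ennreal (element_const \<gamma>) * (ennreal ((diameter K)\<^sup>2) * Y K + ennreal ((real p)^4) * D K))"
      unfolding mult.assoc[of "ennreal (Cqu\<^sup>2)"] by (intro mult_left_mono est) simp
    also have "\<dots> = ennreal c * (ennreal ((diameter K)\<^sup>2) * Y K + ennreal ((real p)^4) * D K)"
      by (simp only: c_def ennreal_mult'[OF zero_le_power2] mult.assoc)
    also have "\<dots> \<le> ennreal c * (ennreal (h\<^sup>2) * Y K + ennreal ((real p)^4) * D K)"
    proof (intro mult_left_mono add_right_mono mult_right_mono ennreal_leI power_mono)
      show "diameter K \<le> h" by (rule hK(1)[OF K])
      have "bounded K" using part(4)[OF K] \<Omega>(2) bounded_subset by blast
      then show "0 \<le> diameter K" by (rule diameter_ge_0)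
    qed simp_all
    finally show ?thesis .
  qed
  have "ennreal (h\<^sup>2 * gu) = ennreal (h\<^sup>2) * ennreal gu" by (intro ennreal_mult) (use nn in auto)
  also have "\<dots> \<le> ennreal (h\<^sup>2) * (\<Sum>K\<in>\<T>. X K)" by (intro mult_left_mono gu_le) simp
  also have "\<dots> = (\<Sum>K\<in>\<T>. ennreal (h\<^sup>2) * X K)" by (rule sum_distrib_left)
  also have "\<dots> \<le> (\<Sum>K\<in>\<T>. ennreal c * (ennreal (h\<^sup>2) * Y K + ennreal ((real p)^4) * D K))" by (intro sum_mono elem)
  also have "\<dots> = ennreal c * (ennreal (h\<^sup>2) * (\<Sum>K\<in>\<T>. Y K) + ennreal ((real p)^4) * (\<Sum>K\<in>\<T>. D K))"
    by (simp only: sum_distrib_left[symmetric] sum.distrib)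
  also have "\<dots> \<le> ennreal c * (ennreal (h\<^sup>2) * ennreal gv + ennreal ((real p)^4) * ennreal E)"
    by (intro mult_left_mono add_mono Y_le D_le) simp_all
  also have "\<dots> = ennreal (c * (h\<^sup>2 * gv + (real p)^4 * E))"
    using nn c0 by (simp add: ennreal_mult ennreal_plus)
  finally have "h\<^sup>2 * gu \<le> c * (h\<^sup>2 * gv + (real p)^4 * E)"
    using nn c0 by (subst (asm) ennreal_le_iff) auto
  \<comment> \<open>Division by \<open>p^4\<close> turns \<open>h^2\<close> into \<open>t^2\<close>
    and frees the error term \<open>E\<close> of its factor.\<close>
  then have "h\<^sup>2 * gu / (real p)^4 \<le> c * (h\<^sup>2 * gv + (real p)^4 * E) / (real p)^4" by (rule divide_right_mono) simp
  moreover have t2: "t\<^sup>2 = h\<^sup>2 / (real p)^4" by (simp add: t_def h_def power_divide)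
  moreover have "(real p)^4 \<noteq> 0" using p(1) by simp
  ultimately have grad: "t\<^sup>2 * gu \<le> c * (t\<^sup>2 * gv + E)" by (simp add: add_divide_distrib distrib_left)
  define a where "a = (L2_norm \<Omega> u)\<^sup>2"
  define b where "b = (L2_norm \<Omega> v)\<^sup>2"
  have b0: "0 \<le> b" by (simp add: b_def)
  have "t\<^sup>2 * a \<le> t\<^sup>2 * (2 * E + 2 * b)"
    unfolding a_def b_def E_def by (intro mult_left_mono L2_norm_sq_triangle[OF uL vL]) simp
  also have "\<dots> = 2 * (t\<^sup>2 * E) + 2 * (t\<^sup>2 * b)" by (simp add: algebra_simps)
  also have "t\<^sup>2 * E \<le> (diameter \<Omega>)\<^sup>2 * E" by (intro mult_right_mono td nn)
  finally have l2: "t\<^sup>2 * a \<le> 2 * ((diameter \<Omega>)\<^sup>2 * E) + 2 * (t\<^sup>2 * b)" by simp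
  have "t\<^sup>2 * (a + gu) \<le> (c + 2 * (diameter \<Omega>)\<^sup>2 + 2) * (E + t\<^sup>2 * (b + gv))"
  proof -
    have "0 \<le> 2 * E" "0 \<le> c * (t\<^sup>2 * b)" "0 \<le> 2 * (diameter \<Omega>)\<^sup>2 * (t\<^sup>2 * b)"
      "0 \<le> 2 * (diameter \<Omega>)\<^sup>2 * (t\<^sup>2 * gv)" "0 \<le> 2 * (t\<^sup>2 * gv)"
      using nn c0 b0 by simp_all
    then show ?thesis using l2 grad by (simp add: algebra_simps)
  qed
  then show "t\<^sup>2 * (H1_norm \<Omega> u)\<^sup>2
    \<le> (Cqu\<^sup>2 * element_const \<gamma> + 2 * (diameter \<Omega>)\<^sup>2 + 2) * ((L2_norm \<Omega> (u - v))\<^sup>2 + t\<^sup>2 * (H1_norm \<Omega> v)\<^sup>2)"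
    unfolding H1_norm_sq a_def b_def c_def E_def gu_def gv_def g_def g'_def .
qed

theorem corollary3p3:
  fixes \<Omega> :: "(real^2) set" and \<theta> \<mu> \<gamma> Cqu :: real
  assumes "polygonal_lipschitz_domain \<Omega>"
    and "0 \<le> \<theta>" and "\<theta> \<le> \<mu>" and "\<mu> \<le> 1"
    and "0 < \<gamma>" and "0 < Cqu"
  shows "\<exists>C>0. \<forall>(\<T> :: (real^2) set set) Kh F (pdeg :: (real^2) set \<Rightarrow> nat) (p :: nat).
    admissible_mesh \<Omega> \<gamma> \<T> Kh F \<longrightarrow> quasi_uniform Cqu \<T> \<longrightarrow>
    1 \<le> p \<longrightarrow> (\<forall>K\<in>\<T>. pdeg K = p) \<longrightarrow>
    (\<forall>u\<in>spline1 \<Omega> \<T> Kh F pdeg.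
      ennreal (mesh_width \<T> powr (\<mu> - \<theta>) / real p powr (2 * (\<mu> - \<theta>))) * L2_H1_norm \<Omega> \<mu> u
        \<le> ennreal C * L2_H1_norm \<Omega> \<theta> u)"
proof -
  have \<Omega>: "open \<Omega>" "bounded \<Omega>" "\<Omega> \<noteq> {}" using assms(1) by (auto simp: polygonal_lipschitz_domain_def)
  define C0 where "C0 = Cqu\<^sup>2 * element_const \<gamma> + 2 * (diameter \<Omega>)\<^sup>2 + 2"
  have "0 \<le> element_const \<gamma>" using assms(5) by (simp add: element_const_def)
  then have C0: "0 < C0" unfolding C0_def by (intro add_nonneg_pos add_nonneg_nonneg) auto
  \<comment> \<open>Division by zero yields 0, so \<open>C\<close> is finite and positive for
    \<open>\<mu> = 0\<close> and \<open>\<mu> = 1\<close> as well.\<close>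
  define C where "C = sqrt (2 * C0 + C0 / (1 - \<mu>) + 1 / \<mu> + 1)"
  have "0 \<le> C0 / (1 - \<mu>)" "0 \<le> 1 / \<mu>" using C0 assms by auto
  then have C: "0 < C" unfolding C_def using C0 by (intro real_sqrt_gt_zero) linarith
  show ?thesis
  proof (intro exI[of _ C] conjI C allI impI ballI)
    fix \<T> Kh F pdeg p u
    assume mesh: "admissible_mesh \<Omega> \<gamma> \<T> Kh F" and qu: "quasi_uniform Cqu \<T>" and p: "1 \<le> p" "\<forall>K\<in>\<T>. pdeg K = p"
      and u: "u \<in> spline1 \<Omega> \<T> Kh F pdeg"
    define t where "t = mesh_width \<T> / (real p)\<^sup>2"
    have est: "0 < t" "t\<^sup>2 * (H1_norm \<Omega> u)\<^sup>2 \<le> C0 * ((L2_norm \<Omega> (u - v))\<^sup>2 + t\<^sup>2 * (H1_norm \<Omega> v)\<^sup>2)"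
      if "v \<in> H1 \<Omega>" for v
      using mesh_inverse_estimate[OF \<Omega> assms(5,6) mesh qu p(1) _ u that] p(2)
      unfolding t_def C0_def by blast+
    \<comment> \<open>Positivity of \<open>t\<close> comes together with the estimate for a given
      \<open>v\<close>; the zero function serves as \<open>v\<close>.\<close>
    have t: "0 < t" by (rule est(1)[OF zero_in_H1(1)[OF \<Omega>(1,2)]])
    have uL: "u \<in> L2 \<Omega>" "u \<in> H1 \<Omega>" using u by (auto simp: spline1_def spline0_def)
    have "ennreal (t powr (\<mu> - \<theta>)) * L2_H1_norm \<Omega> \<mu> u \<le> ennreal C * L2_H1_norm \<Omega> \<theta> u"
      unfolding L2_H1_norm_def C_def
    proof (rule interp_norm_inverse_estimate[OF assms(2,3,4) C0 t uL])
      show "0 \<le> L2_norm \<Omega> v" "0 \<le> H1_norm \<Omega> v" for v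
        by (auto simp: L2_norm_nonneg H1_norm_def intro!: add_nonneg_nonneg sum_nonneg)
      show "L2_norm \<Omega> (u - u) = 0" by (simp add: L2_norm_def)
      show "(\<lambda>x. 0) \<in> H1 \<Omega>" "H1_norm \<Omega> (\<lambda>x. 0) = 0" by (rule zero_in_H1[OF \<Omega>(1,2)])+
      show "L2_norm \<Omega> (u - (\<lambda>x. 0)) = L2_norm \<Omega> u" by (simp add: L2_norm_def)
    qed (rule est(2))
    moreover have "t powr (\<mu> - \<theta>) = mesh_width \<T> powr (\<mu> - \<theta>) / real p powr (2 * (\<mu> - \<theta>))"
    proof -
      have "(real p)\<^sup>2 powr (\<mu> - \<theta>) = real p powr (2 * (\<mu> - \<theta>))"
        using p(1) by (simp add: powr_powr flip: powr_numeral)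
      moreover have "0 \<le> mesh_width \<T>" using t p(1) by (simp add: t_def zero_less_divide_iff less_imp_le)
      ultimately show ?thesis unfolding t_def by (simp add: powr_divide)
    qed
    ultimately show "ennreal (mesh_width \<T> powr (\<mu> - \<theta>) / real p powr (2 * (\<mu> - \<theta>))) * L2_H1_norm \<Omega> \<mu> u
        \<le> ennreal C * L2_H1_norm \<Omega> \<theta> u" by simp
  qed
qed

end
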